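(* For every $\varepsilon>0$ and $0\le\rho<1$ there exist $r,\alpha>0$ such that the following holds. For every $n$, every $(r,\alpha)$-resilient $f:\{-1,1\}^n\to[0,1]$ and every function $g:\{-1,1\}^n\to[0,1]$, $$\langle f,g\rangle_\rho\le\langle\chi_{\mu_f},\chi_{\mu_g}\rangle_\rho+\varepsilon.$$ One can take $$r=O\!\left(\frac{1}{\varepsilon^2(1-\rho)\tau}\right),\qquad \alpha=O(\varepsilon2^{-r}),\qquad \tau=\varepsilon^{O\left(\frac{\log(1/\varepsilon)\log(1/(1-\rho))}{(1-\rho)\varepsilon}\right)},$$ the implied constants being absolute.
   Context: $\{-1,1\}^n$ carries the uniform measure and $\mu_f=\mathbb{E}[f]$. A function $f:\{-1,1\}^n\to\mathbb{R}$ is $(r,\alpha)$-resilient if $\big|\mathbb{E}[f(X)\mid X_S=z]-\mathbb{E}[f]\big|\le\alpha$ for all $S\subseteq[n]$ with $|S|\le r$ and all $z\in\{-1,1\}^S$, where $X$ is uniform on $\{-1,1\}^n$ and $X_S=(X_i)_{i\in S}$. Noisy inner product: $\langle f,g\rangle_\rho=\mathbb{E}[f(x)g(y)]$, where the pairs $(x_i,y_i)\in\{-1,1\}^2$, $1\le i\le n$, are i.i.d. with $\mathbb{E}[x_i]=\mathbb{E}[y_i]=0$ and $\mathbb{E}[x_iy_i]=\rho$. For $\phi,\psi:\mathbb{R}\to[0,1]$, $\langle\phi,\psi\rangle_\rho=\mathbb{E}[\phi(N)\psi(M)]$, where $(N,M)$ are jointly Gaussian, each standard normal, with $\mathbb{E}[NM]=\rho$.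 For $\mu\in[0,1]$, $\chi_\mu$ is the indicator of $(-\infty,\Phi^{-1}(\mu))$, where $\Phi$ is the standard normal distribution function (so $\chi_\mu$ has Gaussian measure $\mu$). *)

theory Defs
  imports "HOL-Probability.Probability"
begin

section \<open>The discrete cube\<close>

definition cube :: "nat set \<Rightarrow> (nat \<Rightarrow> real) set" where
  "cube S = S \<rightarrow>\<^sub>E {-1, 1}"

text \<open>The cube \<open>{-1,1}^n\<close> is \<^term>\<open>cube {..<n}\<close>. Functions on it are represented by functions
  \<^typ>\<open>(nat \<Rightarrow> real) \<Rightarrow> real\<close> whose values outside of \<^term>\<open>cube {..<n}\<close> are irrelevant.\<close>

definition unif_cube :: "nat \<Rightarrow> (nat \<Rightarrow> real) pmf" where
  "unif_cube n = pmf_of_set (cube {..<n})"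

definition cube_mean :: "nat \<Rightarrow> ((nat \<Rightarrow> real) \<Rightarrow> real) \<Rightarrow> real" where
  "cube_mean n f = measure_pmf.expectation (unif_cube n) f"

text \<open>The radius \<open>r\<close> is real: it is instantiated by expressions in the real parameters
  \<open>\<epsilon>\<close> and \<open>\<rho>\<close>.\<close>

definition resilient :: "nat \<Rightarrow> real \<Rightarrow> real \<Rightarrow> ((nat \<Rightarrow> real) \<Rightarrow> real) \<Rightarrow> bool" where
  "resilient n r \<alpha> f \<longleftrightarrow>
     (\<forall>S z. S \<subseteq> {..<n} \<and> real (card S) \<le> r \<and> z \<in> cube S \<longrightarrow>
        \<bar>measure_pmf.expectation (cond_pmf (unif_cube n) {x. restrict x S = z}) f - cube_mean n f\<bar> \<le> \<alpha>)"

lemma finite_cube [simp]: "finite S \<Longrightarrow> finite (cube S)"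
  by (simp add: cube_def finite_PiE)

lemma cube_nonempty [simp]: "cube S \<noteq> {}"
  by (simp add: cube_def PiE_eq_empty_iff)

lemma set_unif_cube [simp]: "set_pmf (unif_cube n) = cube {..<n}"
  by (simp add: unif_cube_def)

text \<open>The conditioning events of \<^const>\<open>resilient\<close> have positive probability, which is what
  \<^const>\<open>cond_pmf\<close> requires in order to be meaningful.\<close>

lemma unif_cube_cond_nonempty:
  assumes "S \<subseteq> {..<n}" "z \<in> cube S"
  shows "set_pmf (unif_cube n) \<inter> {x. restrict x S = z} \<noteq> {}"
proof -
  define x where "x = (\<lambda>i. if i \<in> S then z i else if i < n then 1 else undefined)"
  have "x \<in> cube {..<n}"
    using assms by (auto simp: x_def cube_def PiE_def extensional_def Pi_def)
  moreover have "restrict x S = z"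
    using assms by (auto simp: x_def cube_def PiE_def extensional_def)
  ultimately show ?thesis by auto
qed


section \<open>Noisy inner product on the cube\<close>

definition corr_pair :: "real \<Rightarrow> (real \<times> real) pmf" where
  "corr_pair \<rho> =
     do {
       x \<leftarrow> pmf_of_set {-1, 1};
       b \<leftarrow> bernoulli_pmf ((1 + \<rho>) / 2);
       return_pmf (x, if b then x else - x)
     }"

lemma pmf_corr_pair:
  assumes "-1 \<le> \<rho>" "\<rho> \<le> 1" "x \<in> {-1, 1}" "y \<in> {-1, 1}"
  shows "pmf (corr_pair \<rho>) (x, y) = (1 + \<rho> * x * y) / 4"
proof -
  have "pmf (corr_pair \<rho>) (x, y) =
      (\<Sum>a\<in>{-1, 1}. (1 + \<rho>) / 2 * indicator {(a, a)} (x, y) + (1 - \<rho>) / 2 * indicator {(a, - a)} (x, y)) / 2"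
    unfolding corr_pair_def pmf_bind using assms
    by (subst integral_pmf_of_set) (auto simp: pmf_bind indicator_def field_simps)
  also have "\<dots> = (1 + \<rho> * x * y) / 4"
    using assms by (auto simp: indicator_def field_simps)
  finally show ?thesis .
qed

lemma set_corr_pair: "set_pmf (corr_pair \<rho>) \<subseteq> {-1, 1} \<times> {-1, 1}"
  by (auto simp: corr_pair_def set_pmf_of_set split: if_splits)

text \<open>\<^const>\<open>corr_pair\<close> is the unique law of a pair of centered signs with correlation \<open>\<rho>\<close>.\<close>

lemma corr_pair_unique:
  assumes "-1 \<le> \<rho>" "\<rho> \<le> 1"
  shows "p = corr_pair \<rho> \<longleftrightarrow>
    set_pmf p \<subseteq> {-1, 1} \<times> {-1, 1} \<and>
    measure_pmf.expectation p fst = 0 \<and>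
    measure_pmf.expectation p snd = 0 \<and>
    measure_pmf.expectation p (\<lambda>(x, y). x * y) = \<rho>"
proof -
  let ?A = "{-1, 1} \<times> {-1, 1} :: (real \<times> real) set"
  have A: "?A = {(-1,-1), (-1,1), (1,-1), (1,1)}" by auto
  have E: "measure_pmf.expectation q h =
      pmf q (-1,-1) * h (-1,-1) + pmf q (-1,1) * h (-1,1) + pmf q (1,-1) * h (1,-1) + pmf q (1,1) * h (1,1)"
    if "set_pmf q \<subseteq> ?A" for q and h :: "real \<times> real \<Rightarrow> real"
    using that by (subst integral_measure_pmf_real[of ?A]) (auto simp: A)
  show ?thesis
  proof (intro iffI conjI; (elim conjE)?)
    assume p: "p = corr_pair \<rho>"
    show sp: "set_pmf p \<subseteq> ?A" using p set_corr_pair by simp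
    show "measure_pmf.expectation p fst = 0" "measure_pmf.expectation p snd = 0"
      "measure_pmf.expectation p (\<lambda>(x, y). x * y) = \<rho>"
      unfolding E[OF sp] unfolding p using assms by (simp_all add: pmf_corr_pair field_simps)
  next
    assume sp: "set_pmf p \<subseteq> ?A"
      and e: "measure_pmf.expectation p fst = 0" "measure_pmf.expectation p snd = 0"
        "measure_pmf.expectation p (\<lambda>(x, y). x * y) = \<rho>"
    have "measure_pmf.expectation p (\<lambda>_. 1 :: real) = 1" by simp
    note eqs = this[unfolded E[OF sp]] e[unfolded E[OF sp]]
    show "p = corr_pair \<rho>"
    proof (rule pmf_eqI)
      fix w
      show "pmf p w = pmf (corr_pair \<rho>) w"
      proof (cases "w \<in> ?A")
        case True
        then show ?thesis using eqs assms by (auto simp: pmf_corr_pair)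
      next
        case False
        then have "w \<notin> set_pmf p" "w \<notin> set_pmf (corr_pair \<rho>)" using sp set_corr_pair by blast+
        then show ?thesis by (simp add: set_pmf_iff)
      qed
    qed
  qed
qed

definition noisy_inner :: "nat \<Rightarrow> real \<Rightarrow> ((nat \<Rightarrow> real) \<Rightarrow> real) \<Rightarrow> ((nat \<Rightarrow> real) \<Rightarrow> real) \<Rightarrow> real" where
  "noisy_inner n \<rho> f g =
     measure_pmf.expectation (Pi_pmf {..<n} undefined (\<lambda>_. corr_pair \<rho>))
       (\<lambda>w. f (\<lambda>i\<in>{..<n}. fst (w i)) * g (\<lambda>i\<in>{..<n}. snd (w i)))"


section \<open>Noisy inner product in Gaussian space\<close>

definition gauss_pair :: "real \<Rightarrow> (real \<times> real) measure" where
  "gauss_pair \<rho> =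
     distr (std_normal_distribution \<Otimes>\<^sub>M std_normal_distribution) (borel \<Otimes>\<^sub>M borel)
       (\<lambda>(u, v). (u, \<rho> * u + sqrt (1 - \<rho>\<^sup>2) * v))"

text \<open>Joint Gaussianity: every nontrivial linear combination \<open>a N + b M\<close> is centered normal with
  variance \<open>a\<^sup>2 + 2 a b \<rho> + b\<^sup>2\<close>. This determines the law; it contains the standard normal
  marginals and the covariance \<open>\<rho>\<close>.\<close>

lemma gauss_pair_jointly_normal:
  assumes "\<bar>\<rho>\<bar> < 1" "a \<noteq> 0 \<or> b \<noteq> 0"
  shows "distributed (gauss_pair \<rho>) lborel (\<lambda>(x, y). a * x + b * y)
           (normal_density 0 (sqrt (a\<^sup>2 + 2 * a * b * \<rho> + b\<^sup>2)))"
proof -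
  let ?N = "std_normal_distribution"
  let ?P = "?N \<Otimes>\<^sub>M ?N"
  let ?s = "sqrt (1 - \<rho>\<^sup>2)"
  let ?T = "\<lambda>(u, v). (u, \<rho> * u + ?s * v)"
  interpret N: real_distribution ?N by (rule real_dist_normal_dist)
  interpret P: prob_space ?P by (intro prob_space_pair N.prob_space_axioms)
  have "\<rho>\<^sup>2 < 1" using assms(1) by (simp add: abs_square_less_1)
  then have s: "?s > 0" "?s\<^sup>2 = 1 - \<rho>\<^sup>2" by auto
  have sets_P [measurable_cong]: "sets ?P = sets (borel \<Otimes>\<^sub>M borel)" by (intro sets_pair_measure_cong) auto
  have d1: "distr ?P borel fst = ?N"
  proof -
    have "distr ?P borel fst = distr ?P ?N fst" by (intro distr_cong) auto
    also have "\<dots> = ?N" by (intro N.distr_pair_fst)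
    finally show ?thesis .
  qed
  have d2: "distr ?P borel snd = ?N"
  proof -
    interpret NN: pair_sigma_finite ?N ?N ..
    have "distr ?P borel snd = distr ?P ?N snd" by (intro distr_cong) auto
    also have "\<dots> = distr (distr ?P ?P (\<lambda>(x, y). (y, x))) ?N snd"
      by (subst NN.distr_pair_swap) simp
    also have "\<dots> = distr ?P ?N fst"
      by (subst distr_distr) (auto simp: comp_def case_prod_beta)
    also have "\<dots> = ?N" by (intro N.distr_pair_fst)
    finally show ?thesis .
  qed
  have indep: "P.indep_var borel fst borel snd"
    unfolding P.indep_var_distribution_eq d1 d2
    by (auto simp: distr_id2 sets_P)
  have D1: "distributed ?P lborel fst std_normal_density"
    and D2: "distributed ?P lborel snd std_normal_density"
    using d1 d2 by (auto simp: distributed_def cong: distr_cong)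
  have scale: "distributed ?P lborel (\<lambda>x. c * X x) (normal_density 0 \<bar>c\<bar>)"
    if "distributed ?P lborel X std_normal_density" "c \<noteq> 0" for c X
    using P.normal_density_affine[OF that(1), of c 0] that(2) by simp
  let ?p = "a + b * \<rho>" and ?q = "b * ?s"
  have pq: "?p\<^sup>2 + ?q\<^sup>2 = a\<^sup>2 + 2 * a * b * \<rho> + b\<^sup>2"
    using s(2) by (simp add: power_mult_distrib) (simp add: power2_eq_square algebra_simps)
  have "distributed ?P lborel (\<lambda>w. ?p * fst w + ?q * snd w) (normal_density 0 (sqrt (?p\<^sup>2 + ?q\<^sup>2)))"
  proof (cases "?p = 0"; cases "?q = 0")
    assume "?p = 0" "?q = 0"
    then show ?thesis using assms s by auto
  next
    assume "?p = 0" "?q \<noteq> 0"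
    then show ?thesis using scale[OF D2, of ?q] by simp
  next
    assume "?p \<noteq> 0" "?q = 0"
    then show ?thesis using scale[OF D1, of ?p] s(1) by auto
  next
    assume *: "?p \<noteq> 0" "?q \<noteq> 0"
    have "P.indep_var borel ((\<lambda>x. ?p * x) \<circ> fst) borel ((\<lambda>x. ?q * x) \<circ> snd)"
      by (intro P.indep_var_compose[OF indep]) auto
    then have "P.indep_var borel (\<lambda>w. ?p * fst w) borel (\<lambda>w. ?q * snd w)"
      by (simp add: comp_def)
    from P.add_indep_normal[OF this _ _ scale[OF D1 *(1)] scale[OF D2 *(2)]] *
    show ?thesis by simp
  qed
  then have D: "distr ?P lborel (\<lambda>w. ?p * fst w + ?q * snd w) =
      density lborel (normal_density 0 (sqrt (a\<^sup>2 + 2 * a * b * \<rho> + b\<^sup>2)))"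
    unfolding pq by (simp add: distributed_def)
  have "distr (gauss_pair \<rho>) lborel (\<lambda>(x, y). a * x + b * y) =
      distr ?P lborel ((\<lambda>(x, y). a * x + b * y) \<circ> ?T)"
    unfolding gauss_pair_def by (rule distr_distr) measurable
  also have "(\<lambda>(x, y). a * x + b * y) \<circ> ?T = (\<lambda>w. ?p * fst w + ?q * snd w)"
    by (auto simp: fun_eq_iff algebra_simps)
  finally show ?thesis
    using D by (auto simp: distributed_def gauss_pair_def)
qed

definition gauss_inner :: "real \<Rightarrow> (real \<Rightarrow> real) \<Rightarrow> (real \<Rightarrow> real) \<Rightarrow> real" where
  "gauss_inner \<rho> \<phi> \<psi> = (\<integral>(x, y). \<phi> x * \<psi> y \<partial>gauss_pair \<rho>)"

definition std_normal_cdf :: "real \<Rightarrow> real" where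
  "std_normal_cdf = cdf std_normal_distribution"

text \<open>The quantile function is extended by \<open>\<Phi>\<^sup>-\<^sup>1(0) = -\<infinity>\<close> and \<open>\<Phi>\<^sup>-\<^sup>1(1) = \<infinity>\<close>.\<close>

definition std_normal_quantile :: "real \<Rightarrow> ereal" where
  "std_normal_quantile \<mu> =
     (if \<mu> \<le> 0 then -\<infinity> else if \<mu> \<ge> 1 then \<infinity> else ereal (the_inv std_normal_cdf \<mu>))"

definition halfline_ind :: "real \<Rightarrow> real \<Rightarrow> real" where
  "halfline_ind \<mu> = indicator {x. ereal x < std_normal_quantile \<mu>}"

lemma measure_std_normal_singleton: "measure std_normal_distribution {x} = 0"
  by (simp add: measure_def emeasure_density)

lemma strict_mono_std_normal_cdf: "strict_mono std_normal_cdf"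
proof (rule strict_monoI)
  fix x y :: real
  assume "x < y"
  interpret N: real_distribution std_normal_distribution by (rule real_dist_normal_dist)
  have "emeasure std_normal_distribution {x<..y} \<noteq> 0"
  proof
    assume "emeasure std_normal_distribution {x<..y} = 0"
    then have "AE t in lborel. t \<notin> {x<..y}"
      by (simp add: emeasure_density nn_integral_0_iff_AE indicator_def normal_density_def)
    then have "emeasure lborel {x<..y} = 0"
      by (subst (asm) AE_iff_measurable[of "{x<..y}"]) auto
    with \<open>x < y\<close> show False by simp
  qed
  then have "measure std_normal_distribution {x<..y} > 0"
    by (simp add: N.emeasure_eq_measure zero_less_measure_iff)
  with N.cdf_diff_eq[OF \<open>x < y\<close>] show "std_normal_cdf x < std_normal_cdf y"
    by (simp add: std_normal_cdf_def)
qed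

lemma std_normal_cdf_surj:
  assumes "0 < \<mu>" "\<mu> < 1"
  shows "\<exists>t. std_normal_cdf t = \<mu>"
proof -
  interpret N: real_distribution std_normal_distribution by (rule real_dist_normal_dist)
  have "eventually (\<lambda>t. std_normal_cdf t < \<mu>) at_bot"
    unfolding std_normal_cdf_def using N.cdf_lim_at_bot assms(1) by (rule order_tendstoD(2))
  then obtain a where a: "\<And>t. t \<le> a \<Longrightarrow> std_normal_cdf t < \<mu>" by (auto simp: eventually_at_bot_linorder)
  have "eventually (\<lambda>t. std_normal_cdf t > \<mu>) at_top"
    unfolding std_normal_cdf_def using N.cdf_lim_at_top_prob assms(2) by (rule order_tendstoD(1))
  then obtain b where b: "\<And>t. t \<ge> b \<Longrightarrow> std_normal_cdf t > \<mu>" by (auto simp: eventually_at_top_linorder)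
  have "\<exists>t\<ge>min a b. t \<le> max a b \<and> std_normal_cdf t = \<mu>"
  proof (rule IVT)
    show "std_normal_cdf (min a b) \<le> \<mu>" using a[of "min a b"] by simp
    show "\<mu> \<le> std_normal_cdf (max a b)" using b[of "max a b"] by simp
    show "\<forall>x. min a b \<le> x \<and> x \<le> max a b \<longrightarrow> isCont std_normal_cdf x"
      by (simp add: std_normal_cdf_def N.isCont_cdf measure_std_normal_singleton)
  qed simp
  then show ?thesis by blast
qed

lemma measure_halfline_ind:
  assumes "0 \<le> \<mu>" "\<mu> \<le> 1"
  shows "(\<integral>x. halfline_ind \<mu> x \<partial>std_normal_distribution) = \<mu>"
proof -
  interpret N: real_distribution std_normal_distribution by (rule real_dist_normal_dist)
  consider "\<mu> = 0" | "\<mu> = 1" | "0 < \<mu>" "\<mu> < 1" using assms by linarith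
  then show ?thesis
  proof cases
    case 1
    then show ?thesis by (simp add: halfline_ind_def std_normal_quantile_def)
  next
    case 2
    then show ?thesis
      using N.prob_space by (simp add: halfline_ind_def std_normal_quantile_def)
  next
    case 3
    then obtain t where t: "std_normal_cdf t = \<mu>" using std_normal_cdf_surj by blast
    have "the_inv std_normal_cdf \<mu> = t"
      using t strict_mono_std_normal_cdf strict_mono_imp_inj_on by (auto intro: the_inv_f_f)
    then have "halfline_ind \<mu> = indicator {..<t}"
      using 3 by (auto simp: halfline_ind_def std_normal_quantile_def lessThan_def)
    then have "(\<integral>x. halfline_ind \<mu> x \<partial>std_normal_distribution) = measure std_normal_distribution {..<t}"
      by simp
    also have "\<dots> = std_normal_cdf t"
    proof -
      have eq: "{..<t} \<union> {t} = {..t}" by auto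
      have "measure std_normal_distribution ({..<t} \<union> {t}) =
          measure std_normal_distribution {..<t} + measure std_normal_distribution {t}"
        by (intro N.finite_measure_Union) auto
      then show ?thesis
        unfolding eq by (simp add: std_normal_cdf_def cdf_def measure_std_normal_singleton)
    qed
    finally show ?thesis using t by simp
  qed
qed

end

theory Submission
  imports Defs
begin

text \<open>
  Let \<open>J(x, y)\<close> be the probability that two \<open>\<rho>\<close>-correlated standard normal variables lie below their quantiles of
  \<open>x\<close> and \<open>y\<close>; the right-hand side of the theorem is \<open>J(\<mu>\<^sub>f, \<mu>\<^sub>g) + \<epsilon>\<close>. The proof is discrete: it follows the
  proof of \<open>majority is stablest\<close> by De, Mossel and Neeman, and works with \<open>J\<close> on the cube itself.

  The function \<open>J\<close> dominates the product \<open>x y\<close> (\<open>J_ge_prod\<close>), is \<open>1\<close>-Lipschitz and concave in each variable, and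
  the form \<open>u\<^sup>2 J\<^sub>x\<^sub>x + 2 \<rho> u v J\<^sub>x\<^sub>y + v\<^sup>2 J\<^sub>y\<^sub>y\<close> is a nonpositive multiple of a square (\<open>J_quadratic_form_nonpos\<close>). By Taylor expansion,
  the average of \<open>J(a + \<xi> u, b + \<zeta> v)\<close> over \<open>\<rho>\<close>-correlated signs \<open>\<xi>\<close>, \<open>\<zeta>\<close> exceeds \<open>J(a, b)\<close> only by a cubic error
  (\<open>J_two_point\<close>), and this tensorizes (\<open>two_point_tensorizes\<close>): averaging \<open>J(F(x), G(y))\<close> over coordinates
  of a correlated pair of points replaces \<open>F\<close> and \<open>G\<close> by their averages, up to the sum of the third moments of the
  increments in the single coordinates. That sum is small if \<open>F\<close> and \<open>G\<close> have been smoothed by a little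
  noise and the coordinates have small influence: noise makes the total influence bounded and high degrees negligible, and on low
  degrees hypercontractivity (\<open>bonami_fourth_moment\<close>) makes third moments much smaller than second moments
  (\<open>total_third_moment\<close>).

  Resilience deals with the other coordinates. Since the total noisy influence is bounded, the set \<open>S\<close> of coordinates on which \<open>f\<close> or
  \<open>g\<close> has noisy influence above \<open>\<tau>\<close> has at most \<open>r\<close> elements. After averaging over the complement of
  \<open>S\<close>, the function \<open>f\<close> has become nearly constant by resilience, and averaging over \<open>S\<close> as well is possible because \<open>J\<close> is
  concave in the variable that belongs to \<open>g\<close>. This is why \<open>g\<close> can be arbitrary (\<open>smoothed_bound\<close>).

  The noise comes for free from the correlation: if \<open>\<rho> = \<rho>' s\<^sup>2\<close>, then the noisy inner product at correlation \<open>\<rho>\<close> is the one at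
  \<open>\<rho>'\<close> of the functions smoothed by the noise operator with parameter \<open>s\<close>, and \<open>J\<close> grows from \<open>\<rho>\<close> to \<open>\<rho>'\<close> by at most
  \<open>(\<rho>' - \<rho>) / (1 - \<rho>')\<close> (\<open>J_rho_le\<close>). For \<open>\<rho> \<le> 4 \<epsilon>\<close> the theorem is immediate, since the left-hand side is at
  most \<open>\<mu>\<^sub>f \<mu>\<^sub>g + \<rho> / 4\<close>; otherwise the parameters are chosen in the lemma \<open>parameters\<close>.
\<close>

section \<open>Gaussian quadrant probabilities\<close>

abbreviation stdN :: "real measure" where
  "stdN \<equiv> std_normal_distribution"

lemma std_normal_cdf_eq_measure_lessThan: "measure stdN {..<t} = std_normal_cdf t"
proof -
  interpret N: real_distribution stdN by (rule real_dist_normal_dist)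
  have eq: "{..<t} \<union> {t} = {..t}" by auto
  have "measure stdN ({..<t} \<union> {t}) = measure stdN {..<t} + measure stdN {t}"
    by (intro N.finite_measure_Union) auto
  then show ?thesis
    unfolding eq by (simp add: std_normal_cdf_def cdf_def measure_std_normal_singleton)
qed

text \<open>The real-valued quantile function. It is meant for the open unit interval, where \<open>std_normal_quantile\<close> is
  finite and agrees with it.\<close>

definition quant :: "real \<Rightarrow> real" where
  "quant = the_inv std_normal_cdf"

lemma cdf_quant:
  assumes "0 < x" "x < 1"
  shows "std_normal_cdf (quant x) = x"
proof -
  obtain t where t: "std_normal_cdf t = x" using std_normal_cdf_surj[OF assms] by blast
  have "inj std_normal_cdf" using strict_mono_std_normal_cdf strict_mono_imp_inj_on by blast
  then show ?thesis unfolding quant_def using t by (metis the_inv_f_f)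
qed

lemma quant_cdf: "quant (std_normal_cdf t) = t"
  unfolding quant_def
  by (intro the_inv_f_f strict_mono_imp_inj_on strict_mono_std_normal_cdf)

lemma quant_mono:
  assumes "0 < x" "x \<le> y" "y < 1"
  shows "quant x \<le> quant y"
proof (rule ccontr)
  assume "\<not> ?thesis"
  then have "std_normal_cdf (quant y) < std_normal_cdf (quant x)"
    using strict_mono_std_normal_cdf by (simp add: strict_mono_def)
  then show False using assms by (simp add: cdf_quant)
qed

lemma halfline_ind_eq:
  assumes "0 < x" "x < 1"
  shows "halfline_ind x = indicator {..<quant x}"
  using assms by (auto simp: halfline_ind_def std_normal_quantile_def quant_def lessThan_def)

lemma halfline_ind_0: "x \<le> 0 \<Longrightarrow> halfline_ind x = (\<lambda>_. 0)"
  by (auto simp: halfline_ind_def std_normal_quantile_def)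

lemma halfline_ind_1: "1 \<le> x \<Longrightarrow> halfline_ind x = (\<lambda>_. 1)"
  by (auto simp: halfline_ind_def std_normal_quantile_def)

lemma halfline_ind_measurable [measurable]: "halfline_ind x \<in> borel_measurable borel"
proof -
  consider "x \<le> 0" | "0 < x" "x < 1" | "1 \<le> x" by linarith
  then show ?thesis by cases (simp_all add: halfline_ind_0 halfline_ind_eq halfline_ind_1)
qed

lemma halfline_ind_range: "0 \<le> halfline_ind x u" "halfline_ind x u \<le> 1"
  by (auto simp: halfline_ind_def)

lemma halfline_ind_mono: "x \<le> y \<Longrightarrow> halfline_ind x u \<le> halfline_ind y u"
proof -
  assume "x \<le> y"
  then consider "x \<le> 0" | "1 \<le> y" | "0 < x" "y < 1" by linarith
  then show ?thesis
  proof cases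
    case 3
    then show ?thesis using \<open>x \<le> y\<close> quant_mono[of x y]
      by (auto simp: halfline_ind_eq indicator_def)
  qed (simp_all add: halfline_ind_0 halfline_ind_1 halfline_ind_range)
qed

lemma halfline_ind_antimono: "u \<le> v \<Longrightarrow> halfline_ind x v \<le> halfline_ind x u"
  by (auto simp: halfline_ind_def indicator_def)
    (meson ereal_less_eq(3) order_le_less_trans)

lemma sets_pair_stdN: "sets (stdN \<Otimes>\<^sub>M stdN) = sets (borel \<Otimes>\<^sub>M borel)"
  by (intro sets_pair_measure_cong) auto

text \<open>Disintegration of the correlated pair: the second coordinate given the first one is normal with
  mean \<open>\<rho> u\<close> and variance \<open>1 - \<rho>\<^sup>2\<close>. In this form the symmetry of the law is visible.\<close>

lemma emeasure_gauss_pair: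
  assumes "\<bar>\<rho>\<bar> < 1" and [measurable]: "A \<in> sets (borel \<Otimes>\<^sub>M borel)"
  shows "emeasure (gauss_pair \<rho>) A =
    (\<integral>\<^sup>+u. \<integral>\<^sup>+w. ennreal (std_normal_density u * normal_density (\<rho> * u) (sqrt (1 - \<rho>\<^sup>2)) w) * indicator A (u, w) \<partial>lborel \<partial>lborel)"
proof -
  interpret N: real_distribution stdN by (rule real_dist_normal_dist)
  define s where "s = sqrt (1 - \<rho>\<^sup>2)"
  have "\<rho>\<^sup>2 < 1" using assms(1) by (simp add: abs_square_less_1)
  then have s: "0 < s" by (simp add: s_def)
  note [measurable_cong] = sets_pair_stdN
  have dens: "normal_density (\<rho> * u) s (\<rho> * u + s * v) * s = std_normal_density v" for u v
    using s by (simp add: normal_density_def real_sqrt_mult power_mult_distrib)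
  have inner: "(\<integral>\<^sup>+v. indicator A (u, \<rho> * u + s * v) \<partial>stdN) =
      (\<integral>\<^sup>+w. ennreal (normal_density (\<rho> * u) s w) * indicator A (u, w) \<partial>lborel)" for u
  proof -
    have "(\<integral>\<^sup>+v. indicator A (u, \<rho> * u + s * v) \<partial>stdN) =
      (\<integral>\<^sup>+v. ennreal (std_normal_density v) * indicator A (u, \<rho> * u + s * v) \<partial>lborel)"
      by (subst nn_integral_density) auto
    also have "\<dots> = (\<integral>\<^sup>+v. ennreal s * (ennreal (normal_density (\<rho> * u) s (\<rho> * u + s * v)) * indicator A (u, \<rho> * u + s * v)) \<partial>lborel)"
    proof (intro nn_integral_cong)
      fix v
      have "ennreal (std_normal_density v) = ennreal s * ennreal (normal_density (\<rho> * u) s (\<rho> * u + s * v))"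
        unfolding dens[symmetric, of v u] using s by (subst ennreal_mult[symmetric]) (auto simp: mult.commute)
      then show "ennreal (std_normal_density v) * indicator A (u, \<rho> * u + s * v) =
        ennreal s * (ennreal (normal_density (\<rho> * u) s (\<rho> * u + s * v)) * indicator A (u, \<rho> * u + s * v))"
        by (simp add: mult.assoc)
    qed
    also have "\<dots> = ennreal s * (\<integral>\<^sup>+v. ennreal (normal_density (\<rho> * u) s (\<rho> * u + s * v)) * indicator A (u, \<rho> * u + s * v) \<partial>lborel)"
      by (rule nn_integral_cmult) measurable
    also have "\<dots> = (\<integral>\<^sup>+w. ennreal (normal_density (\<rho> * u) s w) * indicator A (u, w) \<partial>lborel)"
      using s by (subst nn_integral_real_affine[where c=s and t="\<rho> * u"]) auto
    finally show ?thesis .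
  qed
  have "emeasure (gauss_pair \<rho>) A = (\<integral>\<^sup>+x. indicator A x \<partial>gauss_pair \<rho>)"
    by (subst nn_integral_indicator) (auto simp: gauss_pair_def)
  also have "\<dots> = (\<integral>\<^sup>+z. indicator A (case z of (u, v) \<Rightarrow> (u, \<rho> * u + s * v)) \<partial>(stdN \<Otimes>\<^sub>M stdN))"
    unfolding gauss_pair_def s_def by (subst nn_integral_distr) auto
  also have "\<dots> = (\<integral>\<^sup>+u. \<integral>\<^sup>+v. indicator A (u, \<rho> * u + s * v) \<partial>stdN \<partial>stdN)"
    by (subst N.nn_integral_fst[symmetric]) auto
  also have "\<dots> = (\<integral>\<^sup>+u. (\<integral>\<^sup>+w. ennreal (normal_density (\<rho> * u) s w) * indicator A (u, w) \<partial>lborel) \<partial>stdN)"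
    by (simp only: inner)
  also have "\<dots> = (\<integral>\<^sup>+u. ennreal (std_normal_density u) * (\<integral>\<^sup>+w. ennreal (normal_density (\<rho> * u) s w) * indicator A (u, w) \<partial>lborel) \<partial>lborel)"
    by (subst nn_integral_density) (auto simp: normal_density_def)
  also have "\<dots> = (\<integral>\<^sup>+u. \<integral>\<^sup>+w. ennreal (std_normal_density u * normal_density (\<rho> * u) s w) * indicator A (u, w) \<partial>lborel \<partial>lborel)"
    by (subst nn_integral_cmult[symmetric]) (simp_all add: ennreal_mult mult.assoc)
  finally show ?thesis by (simp add: s_def)
qed

text \<open>Both sides are the bivariate normal density, whose exponent
  \<open>(u\<^sup>2 - 2 \<rho> u w + w\<^sup>2) / (2 (1 - \<rho>\<^sup>2))\<close> is symmetric. The identity is used twice: for the symmetry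
  of the law, and for the vanishing determinant of the Hessian form of \<open>J\<close> below.\<close>

lemma bivariate_density_sym:
  assumes "\<bar>\<rho>\<bar> < 1"
  shows "std_normal_density u * normal_density (\<rho> * u) (sqrt (1 - \<rho>\<^sup>2)) w =
    std_normal_density w * normal_density (\<rho> * w) (sqrt (1 - \<rho>\<^sup>2)) u"
proof -
  have "\<rho>\<^sup>2 < 1" using assms(1) by (simp add: abs_square_less_1)
  then have q: "1 - \<rho>\<^sup>2 > 0" by simp
  have "u\<^sup>2 / 2 + (w - \<rho> * u)\<^sup>2 / (2 * (1 - \<rho>\<^sup>2)) = w\<^sup>2 / 2 + (u - \<rho> * w)\<^sup>2 / (2 * (1 - \<rho>\<^sup>2))"
    using q by (simp add: divide_simps) (simp add: power2_eq_square algebra_simps)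
  then have "exp (- u\<^sup>2 / 2) * exp (- (w - \<rho> * u)\<^sup>2 / (2 * (1 - \<rho>\<^sup>2))) =
      exp (- w\<^sup>2 / 2) * exp (- (u - \<rho> * w)\<^sup>2 / (2 * (1 - \<rho>\<^sup>2)))"
    by (simp add: exp_add[symmetric])
  then show ?thesis using q by (simp add: normal_density_def)
qed

lemma gauss_pair_swap:
  assumes "\<bar>\<rho>\<bar> < 1"
  shows "distr (gauss_pair \<rho>) (borel \<Otimes>\<^sub>M borel) (\<lambda>(x, y). (y, x)) = gauss_pair \<rho>"
proof (rule measure_eqI)
  show "sets (distr (gauss_pair \<rho>) (borel \<Otimes>\<^sub>M borel) (\<lambda>(x, y). (y, x))) = sets (gauss_pair \<rho>)"
    by (simp add: gauss_pair_def)
next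
  fix A :: "(real \<times> real) set"
  assume "A \<in> sets (distr (gauss_pair \<rho>) (borel \<Otimes>\<^sub>M borel) (\<lambda>(x, y). (y, x)))"
  then have A [measurable]: "A \<in> sets (borel \<Otimes>\<^sub>M borel)" by simp
  define p where "p = (\<lambda>u w. ennreal (std_normal_density u * normal_density (\<rho> * u) (sqrt (1 - \<rho>\<^sup>2)) w))"
  have [measurable]: "case_prod p \<in> borel_measurable (borel \<Otimes>\<^sub>M borel)"
    unfolding p_def normal_density_def by measurable
  have p: "p u w = p w u" for u w
    unfolding p_def using bivariate_density_sym[OF assms] by metis
  let ?B = "(\<lambda>(x, y). (y, x)) -` A"
  have B: "?B \<in> sets (borel \<Otimes>\<^sub>M borel)"
    using measurable_sets[of "\<lambda>(x::real, y::real). (y, x)" "borel \<Otimes>\<^sub>M borel" "borel \<Otimes>\<^sub>M borel" A]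
    by (simp add: space_pair_measure)
  have "emeasure (distr (gauss_pair \<rho>) (borel \<Otimes>\<^sub>M borel) (\<lambda>(x, y). (y, x))) A =
      emeasure (gauss_pair \<rho>) ?B"
    by (subst emeasure_distr) (auto simp: gauss_pair_def space_pair_measure)
  also have "\<dots> = (\<integral>\<^sup>+u. \<integral>\<^sup>+w. p u w * indicator ?B (u, w) \<partial>lborel \<partial>lborel)"
    unfolding p_def by (rule emeasure_gauss_pair[OF assms B])
  also have "\<dots> = (\<integral>\<^sup>+u. \<integral>\<^sup>+w. p w u * indicator A (w, u) \<partial>lborel \<partial>lborel)"
    by (intro nn_integral_cong) (auto simp: p[of _] indicator_def)
  also have "\<dots> = (\<integral>\<^sup>+w. \<integral>\<^sup>+u. p w u * indicator A (w, u) \<partial>lborel \<partial>lborel)"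
    by (rule lborel_pair.Fubini') measurable
  also have "\<dots> = emeasure (gauss_pair \<rho>) A"
    unfolding p_def by (rule emeasure_gauss_pair[OF assms A, symmetric])
  finally show "emeasure (distr (gauss_pair \<rho>) (borel \<Otimes>\<^sub>M borel) (\<lambda>(x, y). (y, x))) A = emeasure (gauss_pair \<rho>) A" .
qed

lemma gauss_inner_sym:
  assumes "\<bar>\<rho>\<bar> < 1" and [measurable]: "\<phi> \<in> borel_measurable borel" "\<psi> \<in> borel_measurable borel"
  shows "gauss_inner \<rho> \<phi> \<psi> = gauss_inner \<rho> \<psi> \<phi>"
proof -
  have [measurable_cong]: "sets (gauss_pair \<rho>) = sets (borel \<Otimes>\<^sub>M borel)" by (simp add: gauss_pair_def)
  have "gauss_inner \<rho> \<phi> \<psi> =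
      (\<integral>(x, y). \<phi> x * \<psi> y \<partial>distr (gauss_pair \<rho>) (borel \<Otimes>\<^sub>M borel) (\<lambda>(x, y). (y, x)))"
    unfolding gauss_inner_def gauss_pair_swap[OF assms(1)] ..
  also have "\<dots> = gauss_inner \<rho> \<psi> \<phi>"
    unfolding gauss_inner_def by (subst integral_distr) (auto simp: case_prod_beta' mult.commute)
  finally show ?thesis .
qed

lemma integrable_stdN_bounded:
  assumes [measurable]: "h \<in> borel_measurable borel" and "\<And>u. \<bar>h u\<bar> \<le> (B::real)"
  shows "integrable stdN h"
proof -
  interpret N: real_distribution stdN by (rule real_dist_normal_dist)
  show ?thesis by (rule N.integrable_const_bound[of _ B]) (use assms in auto)
qed

lemma gauss_inner_iterated:
  assumes [measurable]: "\<phi> \<in> borel_measurable borel" "\<psi> \<in> borel_measurable borel"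
    and b: "\<And>u. \<bar>\<phi> u\<bar> \<le> 1" "\<And>u. \<bar>\<psi> u\<bar> \<le> 1"
  shows "gauss_inner \<rho> \<phi> \<psi> =
    (\<integral>u. \<phi> u * (\<integral>v. \<psi> (\<rho> * u + sqrt (1 - \<rho>\<^sup>2) * v) \<partial>stdN) \<partial>stdN)"
proof -
  interpret N: real_distribution stdN by (rule real_dist_normal_dist)
  interpret P: pair_prob_space stdN stdN ..
  note [measurable_cong] = sets_pair_stdN
  have int: "integrable (stdN \<Otimes>\<^sub>M stdN) (\<lambda>(u, v). \<phi> u * \<psi> (\<rho> * u + sqrt (1 - \<rho>\<^sup>2) * v))"
  proof (rule P.integrable_const_bound[of _ 1])
    show "AE x in stdN \<Otimes>\<^sub>M stdN. norm (case x of (u, v) \<Rightarrow> \<phi> u * \<psi> (\<rho> * u + sqrt (1 - \<rho>\<^sup>2) * v)) \<le> 1"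
      using b by (intro AE_I2) (auto simp: abs_mult case_prod_beta' intro!: mult_le_one)
  qed measurable
  have "gauss_inner \<rho> \<phi> \<psi> = (\<integral>(u, v). \<phi> u * \<psi> (\<rho> * u + sqrt (1 - \<rho>\<^sup>2) * v) \<partial>(stdN \<Otimes>\<^sub>M stdN))"
    unfolding gauss_inner_def gauss_pair_def by (subst integral_distr) (auto simp: case_prod_beta')
  also have "\<dots> = (\<integral>u. \<integral>v. \<phi> u * \<psi> (\<rho> * u + sqrt (1 - \<rho>\<^sup>2) * v) \<partial>stdN \<partial>stdN)"
    using P.integral_fst[OF int] by simp
  finally show ?thesis by simp
qed

text \<open>The Gaussian side of the theorem as a function of the two means: the probability that two
  \<open>\<rho>\<close>-correlated standard normal variables lie below their \<open>x\<close>- and \<open>y\<close>-quantile.\<close>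

definition J :: "real \<Rightarrow> real \<Rightarrow> real \<Rightarrow> real" where
  "J \<rho> x y = gauss_inner \<rho> (halfline_ind x) (halfline_ind y)"

lemma J_sym: "\<bar>\<rho>\<bar> < 1 \<Longrightarrow> J \<rho> x y = J \<rho> y x"
  unfolding J_def by (rule gauss_inner_sym) auto

text \<open>The conditional probability that the second variable lies below its \<open>y\<close>-quantile, given that the
  first one equals \<open>u\<close>. It turns \<open>J\<close> into a one-dimensional integral, and at \<open>u = quant x\<close> it is the
  derivative of \<open>J\<close> in \<open>x\<close>.\<close>

definition noisy_half :: "real \<Rightarrow> real \<Rightarrow> real \<Rightarrow> real" where
  "noisy_half \<rho> y u = (\<integral>v. halfline_ind y (\<rho> * u + sqrt (1 - \<rho>\<^sup>2) * v) \<partial>stdN)"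

lemma noisy_half_measurable [measurable]: "noisy_half \<rho> y \<in> borel_measurable borel"
proof -
  interpret N: real_distribution stdN by (rule real_dist_normal_dist)
  show ?thesis unfolding noisy_half_def by measurable
qed

lemma noisy_half_range: "0 \<le> noisy_half \<rho> y u" "noisy_half \<rho> y u \<le> 1"
proof -
  interpret N: real_distribution stdN by (rule real_dist_normal_dist)
  show "0 \<le> noisy_half \<rho> y u" unfolding noisy_half_def
    by (rule Bochner_Integration.integral_nonneg) (simp add: halfline_ind_range)
  have "noisy_half \<rho> y u \<le> (\<integral>v. 1 \<partial>stdN)" unfolding noisy_half_def
    by (rule integral_mono) (auto simp: halfline_ind_range intro!: integrable_stdN_bounded[of _ 1])
  then show "noisy_half \<rho> y u \<le> 1" using N.prob_space by simp
qed

lemma noisy_half_antimono: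
  assumes "0 \<le> \<rho>" "u \<le> v"
  shows "noisy_half \<rho> y v \<le> noisy_half \<rho> y u"
  unfolding noisy_half_def
  by (rule integral_mono)
    (use assms in \<open>auto simp: halfline_ind_range mult_left_mono intro!: integrable_stdN_bounded[of _ 1] halfline_ind_antimono\<close>)

lemma noisy_half_eq:
  assumes "\<bar>\<rho>\<bar> < 1" "0 < y" "y < 1"
  shows "noisy_half \<rho> y u = std_normal_cdf ((quant y - \<rho> * u) / sqrt (1 - \<rho>\<^sup>2))"
proof -
  have "\<rho>\<^sup>2 < 1" using assms(1) by (simp add: abs_square_less_1)
  then have s: "sqrt (1 - \<rho>\<^sup>2) > 0" by simp
  have "noisy_half \<rho> y u = (\<integral>v. indicator {..<(quant y - \<rho> * u) / sqrt (1 - \<rho>\<^sup>2)} v \<partial>stdN)"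
    unfolding noisy_half_def using s assms
    by (intro Bochner_Integration.integral_cong) (auto simp: halfline_ind_eq indicator_def field_simps)
  then show ?thesis by (simp add: std_normal_cdf_eq_measure_lessThan)
qed

lemma J_eq: "J \<rho> x y = (\<integral>u. halfline_ind x u * noisy_half \<rho> y u \<partial>stdN)"
  unfolding J_def noisy_half_def by (rule gauss_inner_iterated) (auto simp: halfline_ind_range)

lemma integrable_halfline: "integrable stdN (halfline_ind x)"
  by (rule integrable_stdN_bounded[of _ 1]) (auto simp: halfline_ind_range)

lemma integrable_noisy_half: "integrable stdN (noisy_half \<rho> y)"
  by (rule integrable_stdN_bounded[of _ 1]) (auto simp: noisy_half_range)

lemma integrable_halfline_noisy: "integrable stdN (\<lambda>u. halfline_ind x u * noisy_half \<rho> y u)"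
  by (rule integrable_stdN_bounded[of _ 1])
    (auto simp: noisy_half_range halfline_ind_range abs_mult intro!: mult_le_one)

lemma integral_noisy_half:
  assumes "\<bar>\<rho>\<bar> < 1" "0 \<le> y" "y \<le> 1"
  shows "(\<integral>u. noisy_half \<rho> y u \<partial>stdN) = y"
proof -
  interpret N: real_distribution stdN by (rule real_dist_normal_dist)
  have "(\<integral>u. noisy_half \<rho> y u \<partial>stdN) = J \<rho> 1 y" by (simp add: J_eq halfline_ind_1)
  also have "\<dots> = J \<rho> y 1" using assms by (intro J_sym) auto
  also have "\<dots> = y"
    using assms measure_halfline_ind[of y] N.prob_space by (simp add: J_eq noisy_half_def halfline_ind_1)
  finally show ?thesis .
qed

text \<open>Positive association. The integrand \<open>(halfline_ind x u - x) (noisy_half \<rho> y u - c)\<close>, with \<open>c\<close> the value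
  of \<open>noisy_half\<close> at the quantile of \<open>x\<close>, is pointwise nonnegative because both factors change sign
  there, from nonnegative to nonpositive; its integral is \<open>J \<rho> x y - x y\<close>.\<close>

lemma J_ge_prod:
  assumes "0 \<le> \<rho>" "\<rho> < 1" "0 \<le> x" "x \<le> 1" "0 \<le> y" "y \<le> 1"
  shows "x * y \<le> J \<rho> x y"
proof -
  interpret N: real_distribution stdN by (rule real_dist_normal_dist)
  consider "x = 0" | "x = 1" | "0 < x" "x < 1" using assms by linarith
  then show ?thesis
  proof cases
    case 1 then show ?thesis by (simp add: J_eq halfline_ind_0)
  next
    case 2
    then show ?thesis using integral_noisy_half[of \<rho> y] assms by (simp add: J_eq halfline_ind_1)
  next
    case 3
    let ?c = "noisy_half \<rho> y (quant x)"
    have "0 \<le> (\<integral>u. (halfline_ind x u - x) * (noisy_half \<rho> y u - ?c) \<partial>stdN)"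
    proof (rule Bochner_Integration.integral_nonneg)
      fix u
      show "0 \<le> (halfline_ind x u - x) * (noisy_half \<rho> y u - ?c)"
        using 3 noisy_half_antimono[OF assms(1), of u "quant x" y] noisy_half_antimono[OF assms(1), of "quant x" u y]
        by (cases "u < quant x") (auto simp: halfline_ind_eq intro!: mult_nonneg_nonneg mult_nonneg_nonpos)
    qed
    also have "\<dots> = (\<integral>u. halfline_ind x u * noisy_half \<rho> y u - x * noisy_half \<rho> y u - ?c * halfline_ind x u + x * ?c \<partial>stdN)"
      by (intro Bochner_Integration.integral_cong) (auto simp: algebra_simps)
    also have "\<dots> = J \<rho> x y - x * y - ?c * x + x * ?c"
      using integrable_halfline_noisy[of x \<rho> y] integrable_noisy_half[of \<rho> y] integrable_halfline[of x]
      by (simp add: J_eq integral_noisy_half measure_halfline_ind assms N.prob_space[simplified])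
    finally show ?thesis by simp
  qed
qed

text \<open>Increments of \<open>J\<close> are averages of \<open>noisy_half\<close> over a slab of Gaussian mass \<open>x - x'\<close>. Depending on
  the bounds inserted this gives the Lipschitz property, the concavity and the derivative of \<open>J\<close>.\<close>

lemma J_diff_bounds:
  assumes "0 \<le> x'" "x' \<le> x" "x \<le> 1"
    and lo: "\<And>u. halfline_ind x' u < halfline_ind x u \<Longrightarrow> lo \<le> noisy_half \<rho> y u"
    and hi: "\<And>u. halfline_ind x' u < halfline_ind x u \<Longrightarrow> noisy_half \<rho> y u \<le> hi"
  shows "(x - x') * lo \<le> J \<rho> x y - J \<rho> x' y" "J \<rho> x y - J \<rho> x' y \<le> (x - x') * hi"
proof -
  let ?d = "\<lambda>u. halfline_ind x u - halfline_ind x' u"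
  have d: "0 \<le> ?d u" for u using halfline_ind_mono[OF assms(2)] by simp
  have I: "(\<integral>u. ?d u * c \<partial>stdN) = (x - x') * c" for c
    using assms by (simp add: integrable_halfline measure_halfline_ind)
  have int_c: "integrable stdN (\<lambda>u. ?d u * c)" for c by (simp add: integrable_halfline)
  have int: "integrable stdN (\<lambda>u. ?d u * noisy_half \<rho> y u)"
    by (simp add: left_diff_distrib integrable_halfline_noisy)
  have eq: "J \<rho> x y - J \<rho> x' y = (\<integral>u. ?d u * noisy_half \<rho> y u \<partial>stdN)"
    by (simp add: J_eq left_diff_distrib integrable_halfline_noisy)
  show "(x - x') * lo \<le> J \<rho> x y - J \<rho> x' y"
    unfolding eq I[symmetric]
  proof (intro integral_mono int int_c)
    fix u show "?d u * lo \<le> ?d u * noisy_half \<rho> y u"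
      using d[of u] lo[of u] by (cases "?d u = 0") (auto intro!: mult_left_mono)
  qed
  show "J \<rho> x y - J \<rho> x' y \<le> (x - x') * hi"
    unfolding eq I[symmetric]
  proof (intro integral_mono int int_c)
    fix u show "?d u * noisy_half \<rho> y u \<le> ?d u * hi"
      using d[of u] hi[of u] by (cases "?d u = 0") (auto intro!: mult_left_mono)
  qed
qed

lemma J_lipschitz_left:
  assumes "0 \<le> x" "x \<le> 1" "0 \<le> x'" "x' \<le> 1"
  shows "\<bar>J \<rho> x y - J \<rho> x' y\<bar> \<le> \<bar>x - x'\<bar>"
proof -
  have "\<bar>J \<rho> x y - J \<rho> x' y\<bar> \<le> x - x'" if "0 \<le> x'" "x' \<le> x" "x \<le> 1" for x x'
    using J_diff_bounds[OF that, of 0 \<rho> y 1] by (auto simp: noisy_half_range)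
  from this[of x x'] this[of x' x] show ?thesis using assms by (cases "x' \<le> x") (auto simp: abs_minus_commute)
qed

lemma J_lipschitz_right:
  assumes "\<bar>\<rho>\<bar> < 1" "0 \<le> y" "y \<le> 1" "0 \<le> y'" "y' \<le> 1"
  shows "\<bar>J \<rho> x y - J \<rho> x y'\<bar> \<le> \<bar>y - y'\<bar>"
  using J_lipschitz_left[OF assms(2-), of \<rho> x] by (simp add: J_sym[OF assms(1), of x])

text \<open>The secants of \<open>J\<close> lie between the values of an antitone function at the two end points. This expresses
  concavity, and together with continuity of that function it identifies the derivative.\<close>

lemma J_secant:
  assumes "0 \<le> \<rho>" "0 < x'" "x' \<le> x" "x < 1"
  shows "(x - x') * noisy_half \<rho> y (quant x) \<le> J \<rho> x y - J \<rho> x' y"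
    and "J \<rho> x y - J \<rho> x' y \<le> (x - x') * noisy_half \<rho> y (quant x')"
  using assms
  by (intro J_diff_bounds(1)[where hi = 1] J_diff_bounds(2)[where lo = 0];
      auto intro!: noisy_half_antimono noisy_half_range simp: halfline_ind_eq indicator_def split: if_splits)+

section \<open>Second-order expansion for a pair of correlated signs\<close>

lemma taylor1:
  fixes h h1 :: "real \<Rightarrow> real"
  assumes D1: "\<And>x. x \<in> {lo..hi} \<Longrightarrow> (h has_real_derivative h1 x) (at x within {lo..hi})"
    and M: "\<And>x. x \<in> {lo..hi} \<Longrightarrow> \<bar>h1 x\<bar> \<le> M"
    and in_range: "a \<in> {lo..hi}" "a + u \<in> {lo..hi}"
  shows "\<bar>h (a + u) - h a\<bar> \<le> M * \<bar>u\<bar>"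
proof -
  have "norm (h (a + u) - h a) \<le> M * norm (a + u - a)"
    by (rule field_differentiable_bound[where S = "{lo..hi}"]) (use assms in auto)
  then show ?thesis by simp
qed

text \<open>Bounds as in Taylor's theorem, but without the factorial in the denominator: then each one follows from the one
  of lower order, applied to the derivative, by the mean value inequality.\<close>

lemma taylor2:
  fixes h h1 h2 :: "real \<Rightarrow> real"
  assumes D1: "\<And>x. x \<in> {lo..hi} \<Longrightarrow> (h has_real_derivative h1 x) (at x within {lo..hi})"
    and D2: "\<And>x. x \<in> {lo..hi} \<Longrightarrow> (h1 has_real_derivative h2 x) (at x within {lo..hi})"
    and M: "\<And>x. x \<in> {lo..hi} \<Longrightarrow> \<bar>h2 x\<bar> \<le> M"
    and a: "a \<in> {lo..hi}" and u: "a + u \<in> {lo..hi}"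
  shows "\<bar>h (a + u) - h a - u * h1 a\<bar> \<le> M * u\<^sup>2"
proof -
  let ?I = "{min a (a + u)..max a (a + u)}"
  have sub: "?I \<subseteq> {lo..hi}" using a u by auto
  have M0: "0 \<le> M" using M[OF a] by linarith
  have b: "\<bar>h1 x - h1 a\<bar> \<le> M * \<bar>u\<bar>" if "x \<in> ?I" for x
  proof -
    have "\<bar>h1 (a + (x - a)) - h1 a\<bar> \<le> M * \<bar>x - a\<bar>"
      by (rule taylor1[where lo = lo and hi = hi, OF D2 M a]) (use that sub in auto)
    also have "\<dots> \<le> M * \<bar>u\<bar>" using that M0 by (intro mult_left_mono) auto
    finally show ?thesis by simp
  qed
  have "\<bar>(h (a + u) - (a + u) * h1 a) - (h a - a * h1 a)\<bar> \<le> (M * \<bar>u\<bar>) * \<bar>u\<bar>"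
  proof (rule taylor1[where lo = "min a (a + u)" and hi = "max a (a + u)" and h = "\<lambda>x. h x - x * h1 a" and ?h1.0 = "\<lambda>x. h1 x - h1 a"])
    fix x assume x: "x \<in> ?I"
    have "(h has_real_derivative h1 x) (at x within ?I)"
      using D1[of x] x sub by (meson DERIV_subset subsetD)
    then show "((\<lambda>x. h x - x * h1 a) has_real_derivative h1 x - h1 a) (at x within ?I)"
      by (auto intro!: derivative_eq_intros)
  qed (use b in auto)
  then show ?thesis by (simp add: algebra_simps power2_eq_square)
qed

lemma taylor3:
  fixes h h1 h2 h3 :: "real \<Rightarrow> real"
  assumes D1: "\<And>x. x \<in> {lo..hi} \<Longrightarrow> (h has_real_derivative h1 x) (at x within {lo..hi})"
    and D2: "\<And>x. x \<in> {lo..hi} \<Longrightarrow> (h1 has_real_derivative h2 x) (at x within {lo..hi})"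
    and D3: "\<And>x. x \<in> {lo..hi} \<Longrightarrow> (h2 has_real_derivative h3 x) (at x within {lo..hi})"
    and M: "\<And>x. x \<in> {lo..hi} \<Longrightarrow> \<bar>h3 x\<bar> \<le> M"
    and a: "a \<in> {lo..hi}" and u: "a + u \<in> {lo..hi}"
  shows "\<bar>h (a + u) - h a - u * h1 a - u\<^sup>2 / 2 * h2 a\<bar> \<le> M * \<bar>u\<bar> ^ 3"
proof -
  let ?I = "{min a (a + u)..max a (a + u)}"
  have sub: "?I \<subseteq> {lo..hi}" using a u by auto
  have M0: "0 \<le> M" using M[OF a] by linarith
  have b: "\<bar>h1 x - h1 a - (x - a) * h2 a\<bar> \<le> M * u\<^sup>2" if "x \<in> ?I" for x
  proof -
    have "\<bar>h1 (a + (x - a)) - h1 a - (x - a) * h2 a\<bar> \<le> M * (x - a)\<^sup>2"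
      by (rule taylor2[where lo = lo and hi = hi, OF D2 D3 M a]) (use that sub in auto)
    also have "\<dots> \<le> M * u\<^sup>2" using that M0 by (intro mult_left_mono) (auto simp flip: abs_le_square_iff)
    finally show ?thesis by simp
  qed
  let ?g = "\<lambda>x. h x - x * h1 a - (x - a)\<^sup>2 / 2 * h2 a"
  have "\<bar>?g (a + u) - ?g a\<bar> \<le> (M * u\<^sup>2) * \<bar>u\<bar>"
  proof (rule taylor1[where lo = "min a (a + u)" and hi = "max a (a + u)" and h = ?g and ?h1.0 = "\<lambda>x. h1 x - h1 a - (x - a) * h2 a"])
    fix x assume x: "x \<in> ?I"
    have "(h has_real_derivative h1 x) (at x within ?I)"
      using D1[of x] x sub by (meson DERIV_subset subsetD)
    then show "(?g has_real_derivative h1 x - h1 a - (x - a) * h2 a) (at x within ?I)"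
      by (auto intro!: derivative_eq_intros)
  qed (use b in auto)
  moreover have "?g (a + u) - ?g a = h (a + u) - h a - u * h1 a - u\<^sup>2 / 2 * h2 a"
    by (simp add: algebra_simps)
  moreover have "(M * u\<^sup>2) * \<bar>u\<bar> = M * \<bar>u\<bar> ^ 3" by (simp add: power3_eq_cube power2_eq_square)
  ultimately show ?thesis by simp
qed

text \<open>Taylor expansion in the first variable at height \<open>b + v\<close>, followed by expansions in the second
  variable of the value and of the first two derivatives in the first one. In this way only
  derivatives in one variable at a time enter.\<close>

lemma two_point_taylor:
  fixes F Fx Fy Fxx Fxy Fyy Fxxx Fxxy Fxyy Fyyy :: "real \<Rightarrow> real \<Rightarrow> real" and lo hi :: real
  defines "I \<equiv> {lo..hi}"
  assumes Dx: "\<And>x y. x \<in> I \<Longrightarrow> y \<in> I \<Longrightarrow> ((\<lambda>x. F x y) has_real_derivative Fx x y) (at x within I)"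
    and Dxx: "\<And>x y. x \<in> I \<Longrightarrow> y \<in> I \<Longrightarrow> ((\<lambda>x. Fx x y) has_real_derivative Fxx x y) (at x within I)"
    and Dxxx: "\<And>x y. x \<in> I \<Longrightarrow> y \<in> I \<Longrightarrow> ((\<lambda>x. Fxx x y) has_real_derivative Fxxx x y) (at x within I)"
    and Dy: "\<And>x y. x \<in> I \<Longrightarrow> y \<in> I \<Longrightarrow> ((\<lambda>y. F x y) has_real_derivative Fy x y) (at y within I)"
    and Dyy: "\<And>x y. x \<in> I \<Longrightarrow> y \<in> I \<Longrightarrow> ((\<lambda>y. Fy x y) has_real_derivative Fyy x y) (at y within I)"
    and Dyyy: "\<And>x y. x \<in> I \<Longrightarrow> y \<in> I \<Longrightarrow> ((\<lambda>y. Fyy x y) has_real_derivative Fyyy x y) (at y within I)"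
    and Dxy: "\<And>x y. x \<in> I \<Longrightarrow> y \<in> I \<Longrightarrow> ((\<lambda>y. Fx x y) has_real_derivative Fxy x y) (at y within I)"
    and Dxyy: "\<And>x y. x \<in> I \<Longrightarrow> y \<in> I \<Longrightarrow> ((\<lambda>y. Fxy x y) has_real_derivative Fxyy x y) (at y within I)"
    and Dxxy: "\<And>x y. x \<in> I \<Longrightarrow> y \<in> I \<Longrightarrow> ((\<lambda>y. Fxx x y) has_real_derivative Fxxy x y) (at y within I)"
    and M: "\<And>x y. x \<in> I \<Longrightarrow> y \<in> I \<Longrightarrow> \<bar>Fxxx x y\<bar> \<le> M" "\<And>x y. x \<in> I \<Longrightarrow> y \<in> I \<Longrightarrow> \<bar>Fyyy x y\<bar> \<le> M"
      "\<And>x y. x \<in> I \<Longrightarrow> y \<in> I \<Longrightarrow> \<bar>Fxyy x y\<bar> \<le> M" "\<And>x y. x \<in> I \<Longrightarrow> y \<in> I \<Longrightarrow> \<bar>Fxxy x y\<bar> \<le> M"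
    and a: "a \<in> I" "a + u \<in> I" and b: "b \<in> I" "b + v \<in> I"
  shows "\<bar>F (a + u) (b + v) - (F a b + u * Fx a b + v * Fy a b +
      u\<^sup>2 / 2 * Fxx a b + u * v * Fxy a b + v\<^sup>2 / 2 * Fyy a b)\<bar> \<le> M * (\<bar>u\<bar> + \<bar>v\<bar>) ^ 3"
proof -
  have M0: "0 \<le> M" using M(1)[OF a(1) b(1)] by linarith
  note I_def[simp]
  \<comment> \<open>The four expansions whose remainders are called \<open>e1\<close> to \<open>e4\<close> below.\<close>
  have 1: "\<bar>F (a + u) (b + v) - F a (b + v) - u * Fx a (b + v) - u\<^sup>2 / 2 * Fxx a (b + v)\<bar> \<le> M * \<bar>u\<bar> ^ 3"
    using a b by (intro taylor3[where lo = lo and hi = hi and h = "\<lambda>x. F x (b + v)" and ?h1.0 = "\<lambda>x. Fx x (b + v)" and ?h2.0 = "\<lambda>x. Fxx x (b + v)" and ?h3.0 = "\<lambda>x. Fxxx x (b + v)"]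
        Dx[unfolded I_def] Dxx[unfolded I_def] Dxxx[unfolded I_def] M[unfolded I_def]) (auto simp: I_def)
  have 2: "\<bar>F a (b + v) - F a b - v * Fy a b - v\<^sup>2 / 2 * Fyy a b\<bar> \<le> M * \<bar>v\<bar> ^ 3"
    using a b by (intro taylor3[where lo = lo and hi = hi and h = "F a" and ?h1.0 = "Fy a" and ?h2.0 = "Fyy a" and ?h3.0 = "Fyyy a"]
        Dy[unfolded I_def] Dyy[unfolded I_def] Dyyy[unfolded I_def] M[unfolded I_def]) (auto simp: I_def)
  have 3: "\<bar>Fx a (b + v) - Fx a b - v * Fxy a b\<bar> \<le> M * v\<^sup>2"
    using a b by (intro taylor2[where lo = lo and hi = hi and h = "Fx a" and ?h1.0 = "Fxy a" and ?h2.0 = "Fxyy a"]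
        Dxy[unfolded I_def] Dxyy[unfolded I_def] M[unfolded I_def]) (auto simp: I_def)
  have 4: "\<bar>Fxx a (b + v) - Fxx a b\<bar> \<le> M * \<bar>v\<bar>"
    using a b by (intro taylor1[where lo = lo and hi = hi and h = "Fxx a" and ?h1.0 = "Fxxy a"]
        Dxxy[unfolded I_def] M[unfolded I_def]) (auto simp: I_def)
  define e1 e2 e3 e4 where "e1 = F (a + u) (b + v) - F a (b + v) - u * Fx a (b + v) - u\<^sup>2 / 2 * Fxx a (b + v)"
    and "e2 = F a (b + v) - F a b - v * Fy a b - v\<^sup>2 / 2 * Fyy a b"
    and "e3 = Fx a (b + v) - Fx a b - v * Fxy a b" and "e4 = Fxx a (b + v) - Fxx a b"
  have "F (a + u) (b + v) - (F a b + u * Fx a b + v * Fy a b +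
      u\<^sup>2 / 2 * Fxx a b + u * v * Fxy a b + v\<^sup>2 / 2 * Fyy a b) = e1 + e2 + u * e3 + u\<^sup>2 / 2 * e4"
    unfolding e1_def e2_def e3_def e4_def by (simp add: field_simps)
  also have "\<bar>\<dots>\<bar> \<le> \<bar>e1\<bar> + \<bar>e2\<bar> + \<bar>u\<bar> * \<bar>e3\<bar> + u\<^sup>2 / 2 * \<bar>e4\<bar>"
  proof -
    have "\<bar>u * e3\<bar> = \<bar>u\<bar> * \<bar>e3\<bar>" "\<bar>u\<^sup>2 / 2 * e4\<bar> = u\<^sup>2 / 2 * \<bar>e4\<bar>" by (simp_all add: abs_mult)
    then show ?thesis by linarith
  qed
  also have "\<dots> \<le> M * \<bar>u\<bar> ^ 3 + M * \<bar>v\<bar> ^ 3 + \<bar>u\<bar> * (M * v\<^sup>2) + u\<^sup>2 / 2 * (M * \<bar>v\<bar>)"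
    using 1 2 3 4 unfolding e1_def e2_def e3_def e4_def
    by (intro add_mono mult_left_mono) auto
  also have "\<dots> \<le> M * (\<bar>u\<bar> + \<bar>v\<bar>) ^ 3"
  proof -
    define U V where "U = \<bar>u\<bar>" and "V = \<bar>v\<bar>"
    have nn: "0 \<le> U" "0 \<le> V" "u\<^sup>2 = U\<^sup>2" "v\<^sup>2 = V\<^sup>2" by (auto simp: U_def V_def)
    have "U ^ 3 + V ^ 3 + U * V\<^sup>2 + U\<^sup>2 / 2 * V \<le> (U + V) ^ 3"
      using nn by (simp add: power3_eq_cube power2_eq_square algebra_simps)
    from mult_left_mono[OF this M0] show ?thesis
      unfolding U_def[symmetric] V_def[symmetric] nn by (simp add: algebra_simps)
  qed
  finally show ?thesis .
qed

text \<open>For correlated signs \<open>\<xi>\<close>, \<open>\<zeta>\<close> the linear terms average to zero and \<open>\<xi> \<zeta>\<close> averages to \<open>\<rho>\<close>, so the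
  second-order term becomes half of the quadratic form in the last hypothesis.\<close>

lemma two_point_average:
  fixes F :: "real \<Rightarrow> real \<Rightarrow> real"
  assumes \<rho>: "\<bar>\<rho>\<bar> \<le> 1"
    and T: "\<And>\<xi> \<zeta>. \<xi> \<in> {-1, 1} \<Longrightarrow> \<zeta> \<in> {-1, 1} \<Longrightarrow>
      \<bar>F (a + \<xi> * u) (b + \<zeta> * v) - (F a b + \<xi> * u * Fx + \<zeta> * v * Fy +
        u\<^sup>2 / 2 * Fxx + \<xi> * u * (\<zeta> * v) * Fxy + v\<^sup>2 / 2 * Fyy)\<bar> \<le> E"
    and Q: "u\<^sup>2 * Fxx + 2 * \<rho> * u * v * Fxy + v\<^sup>2 * Fyy \<le> 0"
  shows "(1 + \<rho>) / 4 * (F (a + u) (b + v) + F (a - u) (b - v)) +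
      (1 - \<rho>) / 4 * (F (a + u) (b - v) + F (a - u) (b + v)) \<le> F a b + E"
proof -
  let ?q = "u\<^sup>2 / 2 * Fxx + v\<^sup>2 / 2 * Fyy"
  have A: "F (a + u) (b + v) + F (a - u) (b - v) \<le> 2 * (F a b + ?q + u * v * Fxy + E)"
    using T[of 1 1] T[of "-1" "-1"] by simp
  have B: "F (a + u) (b - v) + F (a - u) (b + v) \<le> 2 * (F a b + ?q - u * v * Fxy + E)"
    using T[of 1 "-1"] T[of "-1" 1] by simp
  have "(1 + \<rho>) / 4 * (F (a + u) (b + v) + F (a - u) (b - v)) +
      (1 - \<rho>) / 4 * (F (a + u) (b - v) + F (a - u) (b + v))
     \<le> (1 + \<rho>) / 4 * (2 * (F a b + ?q + u * v * Fxy + E)) + (1 - \<rho>) / 4 * (2 * (F a b + ?q - u * v * Fxy + E))"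
    using \<rho> by (intro add_mono mult_left_mono A B) auto
  also have "\<dots> = F a b + E + (u\<^sup>2 * Fxx + 2 * \<rho> * u * v * Fxy + v\<^sup>2 * Fyy) / 2"
    by (simp add: field_simps)
  also have "\<dots> \<le> F a b + E" using Q by simp
  finally show ?thesis .
qed

section \<open>Derivatives and tails of the normal distribution, and varying the correlation\<close>

lemma std_normal_cdf_diff:
  assumes "a \<le> b"
  shows "std_normal_cdf b - std_normal_cdf a = integral {a..b} std_normal_density"
proof -
  interpret N: real_distribution stdN by (rule real_dist_normal_dist)
  have si: "set_integrable lborel {a..b} std_normal_density"
    by (rule borel_integrable_atLeastAtMost') (auto intro!: continuous_intros simp: normal_density_def)
  have m0: "measure stdN {a} = 0" by (rule measure_std_normal_singleton)
  have "std_normal_cdf b - std_normal_cdf a = measure stdN {a<..b}"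
    using N.cdf_diff_eq[of a b] assms by (cases "a = b") (auto simp: std_normal_cdf_def)
  also have "\<dots> = measure stdN ({a<..b} \<union> {a})"
    using m0 by (subst N.finite_measure_Union) auto
  also have "{a<..b} \<union> {a} = {a..b}" using assms by auto
  also have "measure stdN {a..b} = (\<integral>x. indicator {a..b} x \<partial>stdN)" by simp
  also have "\<dots> = (\<integral>x. std_normal_density x * indicator {a..b} x \<partial>lborel)"
    by (subst integral_density) auto
  also have "\<dots> = (LINT x:{a..b}|lborel. std_normal_density x)"
    by (simp add: set_lebesgue_integral_def mult.commute)
  also have "\<dots> = integral {a..b} std_normal_density"
    by (rule set_borel_integral_eq_integral(2)[OF si])
  finally show ?thesis .
qed

lemma DERIV_std_normal_cdf: "DERIV std_normal_cdf x :> std_normal_density x"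
proof -
  let ?c = "x - 1" and ?d = "x + 1"
  have "((\<lambda>t. integral {?c..t} std_normal_density) has_real_derivative std_normal_density x) (at x within {?c..?d})"
    by (rule integral_has_real_derivative) (auto intro!: continuous_intros simp: normal_density_def)
  then have "((\<lambda>t. std_normal_cdf ?c + integral {?c..t} std_normal_density) has_real_derivative 0 + std_normal_density x) (at x within {?c..?d})"
    by (intro DERIV_add DERIV_const)
  then have "(std_normal_cdf has_real_derivative 0 + std_normal_density x) (at x within {?c..?d})"
    by (rule has_field_derivative_transform_within[where d = 1]) (auto simp: std_normal_cdf_diff[symmetric])
  then show ?thesis by (simp add: at_within_Icc_at)
qed

lemma DERIV_std_normal_cdf_comp [derivative_intros]:
  "(g has_real_derivative g') (at x within S) \<Longrightarrow>
    ((\<lambda>x. std_normal_cdf (g x)) has_real_derivative std_normal_density (g x) * g') (at x within S)"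
  by (rule DERIV_chain2[OF DERIV_std_normal_cdf])

lemma DERIV_std_normal_density: "DERIV std_normal_density x :> - x * std_normal_density x"
  unfolding normal_density_def
  by (auto intro!: derivative_eq_intros simp: field_simps)

lemma DERIV_std_normal_density_comp [derivative_intros]:
  "(g has_real_derivative g') (at x within S) \<Longrightarrow>
    ((\<lambda>x. std_normal_density (g x)) has_real_derivative - g x * std_normal_density (g x) * g') (at x within S)"
  by (rule DERIV_chain2[OF DERIV_std_normal_density])

lemma isCont_quant:
  assumes "0 < x" "x < 1"
  shows "isCont quant x"
proof -
  have "isCont quant (std_normal_cdf (quant x))"
    by (rule isCont_inverse_function[where d = 1])
      (auto simp: quant_cdf intro!: DERIV_isCont DERIV_std_normal_cdf)
  then show ?thesis using assms by (simp add: cdf_quant)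
qed

lemma std_normal_density_pos: "0 < std_normal_density x"
  by (simp add: normal_density_def)

lemma DERIV_quant:
  assumes "0 < x" "x < 1"
  shows "DERIV quant x :> inverse (std_normal_density (quant x))"
  by (rule DERIV_inverse_function[where f = std_normal_cdf and a = 0 and b = 1])
    (use assms std_normal_density_pos[of "quant x"] in \<open>auto simp: cdf_quant isCont_quant DERIV_std_normal_cdf\<close>)

lemma DERIV_quant_comp [derivative_intros]:
  "(g has_real_derivative g') (at x within S) \<Longrightarrow> 0 < g x \<Longrightarrow> g x < 1 \<Longrightarrow>
    ((\<lambda>x. quant (g x)) has_real_derivative inverse (std_normal_density (quant (g x))) * g') (at x within S)"
  by (rule DERIV_chain2[OF DERIV_quant])

text \<open>The difference quotient at \<open>x\<close> lies between \<open>m x\<close> and a value of \<open>m\<close> nearby.\<close>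

lemma DERIV_by_antitone_secants:
  fixes G m :: "real \<Rightarrow> real"
  assumes x: "a < x" "x < b" and m: "isCont m x"
    and lo: "\<And>p q. a < p \<Longrightarrow> p \<le> q \<Longrightarrow> q < b \<Longrightarrow> (q - p) * m q \<le> G q - G p"
    and hi: "\<And>p q. a < p \<Longrightarrow> p \<le> q \<Longrightarrow> q < b \<Longrightarrow> G q - G p \<le> (q - p) * m p"
  shows "DERIV G x :> m x"
proof -
  have "((\<lambda>y. (G y - G x) / (y - x) - m x) \<longlongrightarrow> 0) (at x)"
  proof (rule Lim_null_comparison)
    have "eventually (\<lambda>y. y \<in> {a<..<b}) (at x)"
      using x by (intro eventually_at_in_open') auto
    moreover have "eventually (\<lambda>y. y \<noteq> x) (at x)" by (simp add: eventually_at_filter)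
    ultimately show "eventually (\<lambda>y. norm ((G y - G x) / (y - x) - m x) \<le> \<bar>m y - m x\<bar>) (at x)"
    proof eventually_elim
      case (elim y)
      show ?case
      proof (cases "x < y")
        case True
        then have "m y \<le> (G y - G x) / (y - x)" "(G y - G x) / (y - x) \<le> m x"
          using lo[of x y] hi[of x y] x elim by (simp_all add: field_simps)
        then show ?thesis by simp
      next
        case False
        then have "y < x" using elim by auto
        then have "m x \<le> (G y - G x) / (y - x)" "(G y - G x) / (y - x) \<le> m y"
          using lo[of y x] hi[of y x] x elim by (simp_all add: field_simps)
        then show ?thesis by simp
      qed
    qed
    have "((\<lambda>y. \<bar>m y - m x\<bar>) \<longlongrightarrow> \<bar>m x - m x\<bar>) (at x)"
      using m by (intro tendsto_intros) (simp add: isCont_def)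
    then show "((\<lambda>y. \<bar>m y - m x\<bar>) \<longlongrightarrow> 0) (at x)" by simp
  qed
  then have "((\<lambda>y. (G y - G x) / (y - x)) \<longlongrightarrow> m x) (at x)" by (simp add: LIM_zero_iff)
  then show ?thesis by (simp add: has_field_derivative_iff)
qed

text \<open>A Chernoff bound: on \<open>A\<close> the standard normal density is at most \<open>exp (- z\<^sup>2 / 2)\<close> times the normal
  density centered at \<open>z\<close>, because \<open>u\<^sup>2 \<ge> z\<^sup>2 + (u - z)\<^sup>2\<close> there.\<close>

lemma measure_stdN_shift_le:
  assumes [measurable]: "A \<in> sets borel" and A: "\<And>u. u \<in> A \<Longrightarrow> z\<^sup>2 \<le> u * z"
  shows "measure stdN A \<le> exp (- z\<^sup>2 / 2)"
proof -
  have "measure stdN A = (\<integral>x. indicator A x \<partial>stdN)" by simp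
  also have "\<dots> = (\<integral>x. std_normal_density x * indicator A x \<partial>lborel)"
    by (subst integral_density) auto
  also have "\<dots> \<le> (\<integral>x. exp (- z\<^sup>2 / 2) * normal_density z 1 x \<partial>lborel)"
  proof (rule integral_mono)
    show "integrable lborel (\<lambda>x. std_normal_density x * indicator A x)"
      by (rule integrable_real_mult_indicator) (auto intro!: integrable_normal_density)
    show "integrable lborel (\<lambda>x. exp (- z\<^sup>2 / 2) * normal_density z 1 x)"
      by (auto intro!: integrable_normal_density)
    fix u
    show "std_normal_density u * indicator A u \<le> exp (- z\<^sup>2 / 2) * normal_density z 1 u"
    proof (cases "u \<in> A")
      case True
      have "- u\<^sup>2 / 2 \<le> - z\<^sup>2 / 2 + - (u - z)\<^sup>2 / 2"
        using A[OF True] by (simp add: power2_eq_square algebra_simps)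
      then have "exp (- u\<^sup>2 / 2) \<le> exp (- z\<^sup>2 / 2) * exp (- (u - z)\<^sup>2 / 2)"
        by (simp add: exp_add[symmetric])
      then show ?thesis using True by (simp add: normal_density_def divide_right_mono)
    qed simp
  qed
  also have "\<dots> = exp (- z\<^sup>2 / 2)" by (simp add: integral_normal_density)
  finally show ?thesis .
qed

text \<open>The two tails of the normal distribution beyond the quantile of \<open>x\<close> have mass at least \<open>d\<close>. Hence
  the density at the quantile is at least of order \<open>d\<close>: all constants of the two-point inequality will be
  polynomial in \<open>1 / d\<close>.\<close>

lemma quant_exp_bound:
  assumes "0 < d" "d \<le> x" "x \<le> 1 - d"
  shows "d \<le> exp (- (quant x)\<^sup>2 / 2)"
proof -
  interpret N: real_distribution stdN by (rule real_dist_normal_dist)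
  have x: "std_normal_cdf (quant x) = x" using assms by (intro cdf_quant) auto
  have c: "std_normal_cdf t = measure stdN {..t}" for t by (simp add: std_normal_cdf_def cdf_def)
  show ?thesis
  proof (cases "quant x \<le> 0")
    case True
    have "measure stdN {..quant x} \<le> exp (- (quant x)\<^sup>2 / 2)"
    proof (rule measure_stdN_shift_le)
      fix u assume "u \<in> {..quant x}"
      then show "(quant x)\<^sup>2 \<le> u * quant x"
        using True by (simp add: power2_eq_square mult_right_mono_neg)
    qed simp
    then show ?thesis using x c[of "quant x"] assms by simp
  next
    case False
    have "measure stdN {quant x<..} \<le> exp (- (quant x)\<^sup>2 / 2)"
    proof (rule measure_stdN_shift_le)
      fix u assume "u \<in> {quant x<..}"
      then show "(quant x)\<^sup>2 \<le> u * quant x"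
        using False by (simp add: power2_eq_square mult_right_mono)
    qed simp
    moreover have "measure stdN {quant x<..} = 1 - measure stdN {..quant x}"
    proof -
      have "- {..quant x} = {quant x<..}" by auto
      then show ?thesis using N.prob_compl[of "{..quant x}"] by (simp add: Compl_eq_Diff_UNIV)
    qed
    ultimately show ?thesis using x c[of "quant x"] assms by simp
  qed
qed

lemma inverse_density_quant_le:
  assumes "0 < d" "d \<le> x" "x \<le> 1 - d"
  shows "inverse (std_normal_density (quant x)) \<le> 3 / d"
proof -
  have "sqrt (2 * pi) \<le> sqrt 9" using pi_less_4 by (intro real_sqrt_le_mono) linarith
  also have "sqrt 9 = (3::real)" using real_sqrt_abs[of 3] by simp
  finally have 1: "sqrt (2 * pi) \<le> 3" .
  have "inverse (std_normal_density (quant x)) = sqrt (2 * pi) / exp (- (quant x)\<^sup>2 / 2)"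
    by (simp add: normal_density_def)
  also have "\<dots> \<le> 3 / d"
    using quant_exp_bound[OF assms] assms 1 by (intro frac_le) auto
  finally show ?thesis .
qed

lemma abs_quant_le:
  assumes "0 < d" "d \<le> x" "x \<le> 1 - d"
  shows "\<bar>quant x\<bar> \<le> 3 / d"
proof -
  have d1: "d \<le> 1" using assms by simp
  have "1 / exp (- (quant x)\<^sup>2 / 2) \<le> 1 / d"
    using quant_exp_bound[OF assms] assms by (intro divide_left_mono) auto
  then have "exp ((quant x)\<^sup>2 / 2) \<le> 1 / d" by (simp add: exp_minus inverse_eq_divide)
  then have "(quant x)\<^sup>2 / 2 \<le> 1 / d" using exp_ge_add_one_self[of "(quant x)\<^sup>2 / 2"] by linarith
  then have "(quant x)\<^sup>2 \<le> 2 / d" by simp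
  also have "\<dots> \<le> (3 / d)\<^sup>2" using assms d1 by (simp add: field_simps power2_eq_square)
  finally show ?thesis using assms abs_le_square_iff[of "quant x" "3 / d"] by auto
qed

lemma std_normal_density_bounds:
  "std_normal_density w \<le> 1 / 2" "\<bar>w\<bar> * std_normal_density w \<le> 1 / 2"
proof -
  have "sqrt 4 \<le> sqrt (2 * pi)" using pi_gt3 by (intro real_sqrt_le_mono) linarith
  moreover have "sqrt 4 = (2::real)" using real_sqrt_abs[of 2] by simp
  ultimately have s: "2 \<le> sqrt (2 * pi)" by simp
  have "exp (- w\<^sup>2 / 2) \<le> 1" by simp
  then show "std_normal_density w \<le> 1 / 2"
    unfolding normal_density_def using s frac_le[of 1 "exp (- w\<^sup>2 / 2)" 2 "sqrt (2 * pi)"] by simp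
  have "0 \<le> (\<bar>w\<bar> - 1)\<^sup>2" by simp
  then have "\<bar>w\<bar> \<le> 1 + w\<^sup>2 / 2" by (simp add: power2_eq_square algebra_simps)
  also have "\<dots> \<le> exp (w\<^sup>2 / 2)" by (rule exp_ge_add_one_self)
  finally have "\<bar>w\<bar> * exp (- w\<^sup>2 / 2) \<le> 1" by (simp add: exp_minus field_simps)
  then show "\<bar>w\<bar> * std_normal_density w \<le> 1 / 2"
    unfolding normal_density_def using s frac_le[of 1 "\<bar>w\<bar> * exp (- w\<^sup>2 / 2)" 2 "sqrt (2 * pi)"] by simp
qed

text \<open>Mean value inequality in the correlation. With \<open>w = (quant y - r u) / sqrt (1 - r\<^sup>2)\<close>, the derivative of
  \<open>w\<close> in \<open>r\<close> is \<open>- u / sqrt (1 - r\<^sup>2) + r w / (1 - r\<^sup>2)\<close>, and the factor \<open>w\<close> is absorbed by the density at \<open>w\<close>.\<close>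

lemma noisy_half_rho:
  assumes "0 \<le> \<rho>" "\<rho> \<le> \<rho>'" "\<rho>' < 1" "0 < y" "y < 1"
  shows "noisy_half \<rho>' y u \<le> noisy_half \<rho> y u + (\<rho>' - \<rho>) / (2 * (1 - \<rho>')) * (1 + \<bar>u\<bar>)"
proof -
  define f where "f = (\<lambda>r. std_normal_cdf ((quant y - r * u) / sqrt (1 - r\<^sup>2)))"
  define w where "w = (\<lambda>r. (quant y - r * u) / sqrt (1 - r\<^sup>2))"
  define f' where "f' = (\<lambda>r. std_normal_density (w r) * (- u / sqrt (1 - r\<^sup>2) + r * w r / (1 - r\<^sup>2)))"
  have pos: "1 - r\<^sup>2 > 0" "1 - \<rho>' \<le> 1 - r\<^sup>2" if "r \<in> {\<rho>..\<rho>'}" for r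
  proof -
    have "r\<^sup>2 \<le> r" using that assms by (simp add: power2_eq_square mult_left_le)
    then show "1 - r\<^sup>2 > 0" "1 - \<rho>' \<le> 1 - r\<^sup>2" using that assms by auto
  qed
  have D: "(f has_real_derivative f' r) (at r within {\<rho>..\<rho>'})" if "r \<in> {\<rho>..\<rho>'}" for r
  proof -
    have "((\<lambda>r. (quant y - r * u) / sqrt (1 - r\<^sup>2)) has_real_derivative - u / sqrt (1 - r\<^sup>2) + r * w r / (1 - r\<^sup>2)) (at r within {\<rho>..\<rho>'})"
    proof -
      define s where "s = sqrt (1 - r\<^sup>2)"
      have s: "0 < s" "1 - r\<^sup>2 = s * s" using pos[OF that] by (auto simp: s_def)
      have "((\<lambda>r. sqrt (1 - r\<^sup>2)) has_real_derivative - r / s) (at r within {\<rho>..\<rho>'})"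
        using pos[OF that] by (auto intro!: derivative_eq_intros simp: s_def field_simps)
      moreover have "((\<lambda>r. quant y - r * u) has_real_derivative - u) (at r within {\<rho>..\<rho>'})"
        by (auto intro!: derivative_eq_intros)
      ultimately have "((\<lambda>r. (quant y - r * u) / sqrt (1 - r\<^sup>2)) has_real_derivative
          ((- u) * s - (quant y - r * u) * (- r / s)) / (s * s)) (at r within {\<rho>..\<rho>'})"
        using s(1) unfolding s_def by (intro DERIV_divide; simp)
      also have "((- u) * s - (quant y - r * u) * (- r / s)) / (s * s) = - u / s + r * w r / (1 - r\<^sup>2)"
        using s(1) unfolding w_def s_def[symmetric] s(2) by (simp add: divide_simps)
      finally show ?thesis by (simp add: s_def)
    qed
    then show ?thesis unfolding f_def f'_def w_def
      by (intro DERIV_std_normal_cdf_comp)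
  qed
  have B: "\<bar>f' r\<bar> \<le> (1 + \<bar>u\<bar>) / (2 * (1 - \<rho>'))" if r: "r \<in> {\<rho>..\<rho>'}" for r
  proof -
    note p = pos[OF r]
    have r1: "\<bar>r\<bar> \<le> 1" using r assms by auto
    let ?n = "std_normal_density (w r)"
    have n0: "0 \<le> ?n" using std_normal_density_pos[of "w r"] by simp
    have sq: "1 - r\<^sup>2 \<le> sqrt (1 - r\<^sup>2)"
    proof (rule real_le_rsqrt)
      have "0 \<le> r\<^sup>2" by simp
      then show "(1 - r\<^sup>2)\<^sup>2 \<le> 1 - r\<^sup>2" using p(1) by (simp add: power2_eq_square mult_left_le)
    qed
    have "\<bar>f' r\<bar> \<le> ?n * (\<bar>u\<bar> / sqrt (1 - r\<^sup>2) + \<bar>r\<bar> * \<bar>w r\<bar> / (1 - r\<^sup>2))"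
    proof -
      have "0 < sqrt (1 - r\<^sup>2)" using p(1) by simp
      then have "\<bar>- u / sqrt (1 - r\<^sup>2)\<bar> = \<bar>u\<bar> / sqrt (1 - r\<^sup>2)" "\<bar>r * w r / (1 - r\<^sup>2)\<bar> = \<bar>r\<bar> * \<bar>w r\<bar> / (1 - r\<^sup>2)"
        using p(1) by (simp_all only: abs_divide abs_minus_cancel abs_mult abs_of_pos)
      then have "\<bar>- u / sqrt (1 - r\<^sup>2) + r * w r / (1 - r\<^sup>2)\<bar> \<le> \<bar>u\<bar> / sqrt (1 - r\<^sup>2) + \<bar>r\<bar> * \<bar>w r\<bar> / (1 - r\<^sup>2)"
        using abs_triangle_ineq[of "- u / sqrt (1 - r\<^sup>2)" "r * w r / (1 - r\<^sup>2)"] by linarith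
      then show ?thesis unfolding f'_def abs_mult using n0 by (simp only: abs_of_nonneg mult_left_mono)
    qed
    also have "\<dots> = ?n * \<bar>u\<bar> / sqrt (1 - r\<^sup>2) + \<bar>r\<bar> * (\<bar>w r\<bar> * ?n) / (1 - r\<^sup>2)"
      by (simp add: algebra_simps)
    also have "\<dots> \<le> (1 / 2) * \<bar>u\<bar> / (1 - r\<^sup>2) + 1 * (1 / 2) / (1 - r\<^sup>2)"
      using std_normal_density_bounds[of "w r"] p sq r1 n0
      by (intro add_mono frac_le mult_mono mult_right_mono) auto
    also have "\<dots> = (1 + \<bar>u\<bar>) / (2 * (1 - r\<^sup>2))" using p by (simp add: field_simps)
    also have "\<dots> \<le> (1 + \<bar>u\<bar>) / (2 * (1 - \<rho>'))" using p assms by (intro divide_left_mono mult_left_mono) auto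
    finally show ?thesis .
  qed
  have "\<bar>f (\<rho> + (\<rho>' - \<rho>)) - f \<rho>\<bar> \<le> (1 + \<bar>u\<bar>) / (2 * (1 - \<rho>')) * \<bar>\<rho>' - \<rho>\<bar>"
    by (rule taylor1[where lo = \<rho> and hi = \<rho>', OF D B]) (use assms in auto)
  then have "f \<rho>' - f \<rho> \<le> (1 + \<bar>u\<bar>) / (2 * (1 - \<rho>')) * (\<rho>' - \<rho>)" using assms by simp
  then show ?thesis using assms by (simp add: noisy_half_eq f_def mult_ac)
qed

text \<open>Raising the correlation is cheap. The bound has to be linear in \<open>\<rho>' - \<rho>\<close>: a weaker modulus of
  continuity would leave less room for noise, and for small \<open>\<rho>\<close> more coordinates would become
  influential than the claimed \<open>r\<close>.\<close>

lemma J_rho_le: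
  assumes "0 \<le> \<rho>" "\<rho> \<le> \<rho>'" "\<rho>' < 1" "0 < y" "y < 1"
  shows "J \<rho>' x y \<le> J \<rho> x y + (\<rho>' - \<rho>) / (1 - \<rho>')"
proof -
  interpret N: real_distribution stdN by (rule real_dist_normal_dist)
  let ?c = "(\<rho>' - \<rho>) / (2 * (1 - \<rho>'))"
  have c: "0 \<le> ?c" using assms by simp
  have i2: "integrable stdN (\<lambda>u. u\<^sup>2)" "(\<integral>u. u\<^sup>2 \<partial>stdN) = 1"
    using std_normal_distribution_even_moments[of 1] integrable_std_normal_distribution_moment[of 2] by simp_all
  have "J \<rho>' x y \<le> (\<integral>u. halfline_ind x u * noisy_half \<rho> y u + ?c * (3 / 2 + u\<^sup>2 / 2) \<partial>stdN)"
    unfolding J_eq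
  proof (rule integral_mono)
    fix u :: real
    have "\<bar>u\<bar> \<le> 1 / 2 + u\<^sup>2 / 2"
      using zero_le_power2[of "\<bar>u\<bar> - 1"] by (simp add: power2_eq_square algebra_simps)
    then have "?c * (1 + \<bar>u\<bar>) \<le> ?c * (3 / 2 + u\<^sup>2 / 2)" by (intro mult_left_mono c) simp
    then have le: "noisy_half \<rho>' y u \<le> noisy_half \<rho> y u + ?c * (3 / 2 + u\<^sup>2 / 2)"
      using noisy_half_rho[OF assms, of u] by linarith
    have "0 \<le> ?c * (3 / 2 + u\<^sup>2 / 2)" using c by (intro mult_nonneg_nonneg) auto
    then have "halfline_ind x u * (?c * (3 / 2 + u\<^sup>2 / 2)) \<le> ?c * (3 / 2 + u\<^sup>2 / 2)"
      using halfline_ind_range[of x u] by (rule_tac mult_left_le_one_le) auto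
    then show "halfline_ind x u * noisy_half \<rho>' y u \<le> halfline_ind x u * noisy_half \<rho> y u + ?c * (3 / 2 + u\<^sup>2 / 2)"
      using mult_left_mono[OF le halfline_ind_range(1)[of x u]] by (simp add: distrib_left)
  qed (use i2 in \<open>auto intro!: Bochner_Integration.integrable_add integrable_halfline_noisy\<close>)
  also have "\<dots> = J \<rho> x y + ?c * 2"
    using i2 N.prob_space[simplified] by (simp add: J_eq integrable_halfline_noisy)
  also have "?c * 2 = (\<rho>' - \<rho>) / (1 - \<rho>')" using assms by (simp add: field_simps)
  finally show ?thesis by simp
qed

section \<open>The two-point inequality for Gaussian quadrant probabilities\<close>

text \<open>With \<open>w = Jw \<rho> x y\<close>, and \<open>\<phi>\<close>, \<open>\<Phi>\<close> the standard normal density and distribution function, the partial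
  derivative of \<open>J\<close> in \<open>x\<close> is \<open>\<Phi>(w)\<close>, and the higher ones are explicit in \<open>w\<close>, \<open>\<phi>(w)\<close>, the quantiles and
  \<open>1 / \<phi>\<close> at the quantiles. The letters after \<open>J\<close> list the variables of differentiation; derivatives in \<open>y\<close> only are obtained by
  exchanging the arguments.\<close>

definition Jw :: "real \<Rightarrow> real \<Rightarrow> real \<Rightarrow> real" where
  "Jw \<rho> x y = (quant y - \<rho> * quant x) / sqrt (1 - \<rho>\<^sup>2)"

definition Jx :: "real \<Rightarrow> real \<Rightarrow> real \<Rightarrow> real" where
  "Jx \<rho> x y = std_normal_cdf (Jw \<rho> x y)"

definition Jxx :: "real \<Rightarrow> real \<Rightarrow> real \<Rightarrow> real" where
  "Jxx \<rho> x y = - (\<rho> / sqrt (1 - \<rho>\<^sup>2)) * std_normal_density (Jw \<rho> x y) * inverse (std_normal_density (quant x))"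

definition Jxy :: "real \<Rightarrow> real \<Rightarrow> real \<Rightarrow> real" where
  "Jxy \<rho> x y = std_normal_density (Jw \<rho> x y) / sqrt (1 - \<rho>\<^sup>2) * inverse (std_normal_density (quant y))"

definition Jxxx :: "real \<Rightarrow> real \<Rightarrow> real \<Rightarrow> real" where
  "Jxxx \<rho> x y = Jxx \<rho> x y * (\<rho> / sqrt (1 - \<rho>\<^sup>2) * Jw \<rho> x y + quant x) * inverse (std_normal_density (quant x))"

definition Jxxy :: "real \<Rightarrow> real \<Rightarrow> real \<Rightarrow> real" where
  "Jxxy \<rho> x y = Jxx \<rho> x y * (- Jw \<rho> x y / sqrt (1 - \<rho>\<^sup>2)) * inverse (std_normal_density (quant y))"

definition Jxyy :: "real \<Rightarrow> real \<Rightarrow> real \<Rightarrow> real" where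
  "Jxyy \<rho> x y = Jxy \<rho> x y * (- Jw \<rho> x y / sqrt (1 - \<rho>\<^sup>2) + quant y) * inverse (std_normal_density (quant y))"

lemma sqrt_one_minus_square_pos: "\<bar>\<rho>\<bar> < 1 \<Longrightarrow> 0 < sqrt (1 - \<rho>\<^sup>2)"
  by (simp add: abs_square_less_1)

context
  fixes \<rho> x y :: real
  assumes r: "0 \<le> \<rho>" "\<rho> < 1" and x: "0 < x" "x < 1" and y: "0 < y" "y < 1"
begin

lemma s_pos: "0 < sqrt (1 - \<rho>\<^sup>2)"
  using r by (intro sqrt_one_minus_square_pos) auto

lemma DERIV_Jw_x: "((\<lambda>x. Jw \<rho> x y) has_real_derivative - (\<rho> / sqrt (1 - \<rho>\<^sup>2)) * inverse (std_normal_density (quant x))) (at x within S)"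
  unfolding Jw_def using x s_pos by (auto intro!: derivative_eq_intros simp: divide_simps)

lemma DERIV_Jw_y: "((\<lambda>y. Jw \<rho> x y) has_real_derivative inverse (std_normal_density (quant y)) / sqrt (1 - \<rho>\<^sup>2)) (at y within S)"
  unfolding Jw_def using y s_pos by (auto intro!: derivative_eq_intros simp: divide_simps)

lemma DERIV_J_x: "((\<lambda>x. J \<rho> x y) has_real_derivative Jx \<rho> x y) (at x within S)"
proof -
  have eq: "noisy_half \<rho> y (quant x) = Jx \<rho> x y" for x
    using r y by (simp add: noisy_half_eq Jx_def Jw_def)
  have "DERIV (\<lambda>x. J \<rho> x y) x :> noisy_half \<rho> y (quant x)"
  proof (rule DERIV_by_antitone_secants[where a = 0 and b = 1])
    show "isCont (\<lambda>x. noisy_half \<rho> y (quant x)) x"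
      unfolding eq Jx_def
      by (rule DERIV_isCont) (rule DERIV_std_normal_cdf_comp[OF DERIV_Jw_x])
  qed (use x J_secant[OF r(1)] in auto)
  then show ?thesis unfolding eq by (rule has_field_derivative_at_within)
qed

lemma DERIV_Jx_x: "((\<lambda>x. Jx \<rho> x y) has_real_derivative Jxx \<rho> x y) (at x within S)"
  unfolding Jx_def
  by (rule DERIV_cong[OF DERIV_std_normal_cdf_comp[OF DERIV_Jw_x]]) (simp add: Jxx_def)

lemma DERIV_Jx_y: "((\<lambda>y. Jx \<rho> x y) has_real_derivative Jxy \<rho> x y) (at y within S)"
  unfolding Jx_def
  by (rule DERIV_cong[OF DERIV_std_normal_cdf_comp[OF DERIV_Jw_y]]) (simp add: Jxy_def)

lemma DERIV_inverse_density_quant: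
  assumes "0 < z" "z < 1"
  shows "((\<lambda>x. inverse (std_normal_density (quant x))) has_real_derivative
    quant z * (inverse (std_normal_density (quant z)))\<^sup>2) (at z within S)"
  using assms std_normal_density_pos[of "quant z"]
  by (auto intro!: derivative_eq_intros simp: field_simps power2_eq_square)

lemma DERIV_Jxx_x: "((\<lambda>x. Jxx \<rho> x y) has_real_derivative Jxxx \<rho> x y) (at x within S)"
  unfolding Jxx_def
  by (rule DERIV_cong[OF DERIV_mult[OF DERIV_cmult[OF DERIV_std_normal_density_comp[OF DERIV_Jw_x]] DERIV_inverse_density_quant[OF x]]])
    (simp only: Jxxx_def Jxx_def divide_inverse power2_eq_square algebra_simps mult_minus_left mult_minus_right minus_minus minus_add_distrib)

lemma DERIV_Jxx_y: "((\<lambda>y. Jxx \<rho> x y) has_real_derivative Jxxy \<rho> x y) (at y within S)"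
  unfolding Jxx_def
  by (rule DERIV_cong[OF DERIV_cmult_right[OF DERIV_cmult[OF DERIV_std_normal_density_comp[OF DERIV_Jw_y]]]])
    (simp add: Jxxy_def Jxx_def)

lemma DERIV_Jxy_y: "((\<lambda>y. Jxy \<rho> x y) has_real_derivative Jxyy \<rho> x y) (at y within S)"
  unfolding Jxy_def
  by (rule DERIV_cong[OF DERIV_mult[OF DERIV_cdivide[OF DERIV_std_normal_density_comp[OF DERIV_Jw_y]] DERIV_inverse_density_quant[OF y]]])
    (simp only: Jxyy_def Jxy_def divide_inverse power2_eq_square algebra_simps mult_minus_left mult_minus_right minus_minus minus_add_distrib)

text \<open>The heart of the Gaussian side. With \<open>p = \<phi>(w) \<phi>(quant x)\<close>, which is symmetric in \<open>x\<close> and \<open>y\<close>, the form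
  equals \<open>- (\<rho> p / sqrt (1 - \<rho>\<^sup>2)) (u / \<phi>(quant x) - v / \<phi>(quant y))\<^sup>2\<close>. This is the infinitesimal form
  of Borell's isoperimetric inequality.\<close>

lemma J_quadratic_form_nonpos:
  "u\<^sup>2 * Jxx \<rho> x y + 2 * \<rho> * u * v * Jxy \<rho> x y + v\<^sup>2 * Jxx \<rho> y x \<le> 0"
proof -
  define s where "s = sqrt (1 - \<rho>\<^sup>2)"
  have s: "0 < s" using s_pos by (simp add: s_def)
  define f g p where "f = std_normal_density (quant x)" and "g = std_normal_density (quant y)"
    and "p = std_normal_density (Jw \<rho> x y) * f"
  have pos: "0 < f" "0 < g" "0 < p" by (simp_all add: f_def g_def p_def std_normal_density_pos)
  have nd: "normal_density m s t = std_normal_density ((t - m) / s) / s" for m t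
    using s by (simp add: normal_density_def real_sqrt_mult power_divide)
  have "p = std_normal_density (Jw \<rho> y x) * g"
    using bivariate_density_sym[of \<rho> "quant x" "quant y"] r s
    by (simp add: nd s_def[symmetric] p_def f_def g_def Jw_def field_simps)
  then have n: "std_normal_density (Jw \<rho> x y) = p / f" "std_normal_density (Jw \<rho> y x) = p / g"
    using pos by (simp_all add: p_def eq_divide_eq)
  have "u\<^sup>2 * Jxx \<rho> x y + 2 * \<rho> * u * v * Jxy \<rho> x y + v\<^sup>2 * Jxx \<rho> y x = - (\<rho> * p / s * (u / f - v / g)\<^sup>2)"
    unfolding Jxx_def Jxy_def n s_def[symmetric] f_def[symmetric] g_def[symmetric]
    using pos s by (simp add: divide_simps) (simp add: power2_eq_square algebra_simps)
  also have "\<dots> \<le> 0" using r pos s by simp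
  finally show ?thesis .
qed

text \<open>Up to a factor bounded by \<open>1\<close>, each third derivative has the shape \<open>(1 / s) \<phi>(w) k (l w / s + q) m\<close> with
  \<open>s = sqrt (1 - \<rho>\<^sup>2)\<close> and \<open>\<bar>l\<bar> \<le> 1\<close>, where \<open>k\<close> and \<open>m\<close> are values of \<open>1 / \<phi>\<close> at quantiles and \<open>q\<close> is
  a quantile or zero; \<open>\<phi>(w)\<close> and \<open>w \<phi>(w)\<close> are
  bounded.\<close>

lemma third_derivative_bounds:
  assumes d: "0 < d" and xd: "d \<le> x" "x \<le> 1 - d" and yd: "d \<le> y" "y \<le> 1 - d"
  shows "\<bar>Jxxx \<rho> x y\<bar> \<le> (3 / d) ^ 3 / (1 - \<rho>)" "\<bar>Jxxy \<rho> x y\<bar> \<le> (3 / d) ^ 3 / (1 - \<rho>)"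
    "\<bar>Jxyy \<rho> x y\<bar> \<le> (3 / d) ^ 3 / (1 - \<rho>)"
proof -
  define s where "s = sqrt (1 - \<rho>\<^sup>2)"
  have s0: "0 < s" using s_pos by (simp add: s_def)
  define B where "B = 3 / d"
  have B: "1 \<le> B" using d xd by (simp add: B_def)
  define n w i j where "n = std_normal_density (Jw \<rho> x y)" and "w = Jw \<rho> x y"
    and "i = inverse (std_normal_density (quant x))" and "j = inverse (std_normal_density (quant y))"
  have ij: "0 \<le> i" "i \<le> B" "0 \<le> j" "j \<le> B" "\<bar>quant x\<bar> \<le> B" "\<bar>quant y\<bar> \<le> B"
    using inverse_density_quant_le[OF d xd] inverse_density_quant_le[OF d yd] abs_quant_le[OF d xd] abs_quant_le[OF d yd]
    by (simp_all add: i_def j_def B_def less_imp_le[OF std_normal_density_pos])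
  have n_def': "n = std_normal_density w" by (simp add: n_def w_def)
  have n: "0 \<le> n" "n \<le> 1 / 2" "\<bar>w\<bar> * n \<le> 1 / 2"
    using std_normal_density_bounds[of w] by (simp_all add: n_def w_def less_imp_le[OF std_normal_density_pos])
  have rr: "\<rho>\<^sup>2 \<le> \<rho>" using r by (simp add: power2_eq_square mult_left_le)
  have r2: "\<rho>\<^sup>2 < 1" using r by (simp add: abs_square_less_1)
  have s1: "s \<le> 1" by (simp add: s_def)
  have ss: "s * s = 1 - \<rho>\<^sup>2" using r2 by (simp add: s_def)
  define c where "c = 1 / (s * s)"
  have c: "1 \<le> c" "1 / s \<le> c" "1 / s * (1 / s) = c" "c \<le> 1 / (1 - \<rho>)"
  proof -
    have "s * s \<le> 1 * 1" using s0 s1 by (intro mult_mono) auto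
    then show "1 \<le> c" using s0 by (simp add: c_def)
    have "s * s \<le> s * 1" using s0 s1 by (intro mult_left_mono) auto
    then show "1 / s \<le> c" using s0 by (auto simp: c_def intro!: divide_left_mono)
    show "1 / s * (1 / s) = c" by (simp add: c_def)
    show "c \<le> 1 / (1 - \<rho>)" unfolding c_def ss using rr r by (intro divide_left_mono) auto
  qed
  have key: "\<bar>(1 / s) * n * k * (l * (1 / s) * w + q) * m\<bar> \<le> B ^ 3 / (1 - \<rho>)"
    if "0 \<le> k" "k \<le> B" "0 \<le> m" "m \<le> B" "\<bar>l\<bar> \<le> 1" "\<bar>q\<bar> \<le> B" for k l q m
  proof -
    have s': "0 \<le> 1 / s" using s0 by simp
    have 1: "\<bar>l * (1 / s) * (1 / s) * (n * w)\<bar> \<le> c / 2"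
    proof -
      have "\<bar>l * (1 / s) * (1 / s) * (n * w)\<bar> = \<bar>l\<bar> * (c * (\<bar>w\<bar> * n))"
        using n(1) s' by (simp add: c(3)[symmetric] abs_mult mult_ac)
      also have "\<dots> \<le> 1 * (c * (1 / 2))"
        using that n c by (intro mult_mono) auto
      finally show ?thesis by simp
    qed
    have 2: "\<bar>(1 / s) * n * q\<bar> \<le> c * B / 2"
    proof -
      have "\<bar>(1 / s) * n * q\<bar> = (1 / s) * n * \<bar>q\<bar>" using n(1) s' by (simp add: abs_mult)
      also have "\<dots> \<le> c * (1 / 2) * B" using that n c s' by (intro mult_mono) auto
      finally show ?thesis by simp
    qed
    have "\<bar>(1 / s) * n * k * (l * (1 / s) * w + q) * m\<bar> =
        (k * m) * \<bar>l * (1 / s) * (1 / s) * (n * w) + (1 / s) * n * q\<bar>"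
    proof -
      have "(1 / s) * n * k * (l * (1 / s) * w + q) * m =
        (k * m) * (l * (1 / s) * (1 / s) * (n * w) + (1 / s) * n * q)" by (simp add: algebra_simps)
      then show ?thesis using that by (simp add: abs_mult)
    qed
    also have "\<dots> \<le> (B * B) * (c / 2 + c * B / 2)"
      using that B by (intro mult_mono order_trans[OF abs_triangle_ineq] add_mono 1 2) auto
    also have "\<dots> \<le> (B * B) * (c * B)"
    proof (intro mult_left_mono)
      have "c * 1 \<le> c * B" using c B by (intro mult_left_mono) auto
      then show "c / 2 + c * B / 2 \<le> c * B" by simp
    qed (use B in auto)
    also have "\<dots> = B ^ 3 * c" by (simp add: power3_eq_cube)
    also have "\<dots> \<le> B ^ 3 * (1 / (1 - \<rho>))" using c B by (intro mult_left_mono) auto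
    finally show ?thesis by simp
  qed
  have r1: "\<bar>\<rho>\<bar> \<le> 1" using r by simp
  have "\<bar>Jxxx \<rho> x y\<bar> = \<bar>\<rho>\<bar> * \<bar>(1 / s) * n * i * (\<rho> * (1 / s) * w + quant x) * i\<bar>"
    unfolding Jxxx_def Jxx_def w_def[symmetric] n_def'[symmetric] i_def[symmetric] j_def[symmetric] s_def[symmetric]
    by (simp add: abs_mult mult_ac)
  also have "\<dots> \<le> 1 * (B ^ 3 / (1 - \<rho>))" using ij r1 by (intro mult_mono key) auto
  finally show "\<bar>Jxxx \<rho> x y\<bar> \<le> (3 / d) ^ 3 / (1 - \<rho>)" by (simp add: B_def)
  have "\<bar>Jxxy \<rho> x y\<bar> = \<bar>\<rho>\<bar> * \<bar>(1 / s) * n * i * ((- 1) * (1 / s) * w + 0) * j\<bar>"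
    unfolding Jxxy_def Jxx_def w_def[symmetric] n_def'[symmetric] i_def[symmetric] j_def[symmetric] s_def[symmetric]
    by (simp add: abs_mult mult_ac)
  also have "\<dots> \<le> 1 * (B ^ 3 / (1 - \<rho>))" using ij r1 B by (intro mult_mono key) auto
  finally show "\<bar>Jxxy \<rho> x y\<bar> \<le> (3 / d) ^ 3 / (1 - \<rho>)" by (simp add: B_def)
  have "\<bar>Jxyy \<rho> x y\<bar> = \<bar>(1 / s) * n * j * ((- 1) * (1 / s) * w + quant y) * j\<bar>"
    unfolding Jxyy_def Jxy_def w_def[symmetric] n_def'[symmetric] i_def[symmetric] j_def[symmetric] s_def[symmetric]
    by (simp add: abs_mult mult_ac)
  also have "\<dots> \<le> B ^ 3 / (1 - \<rho>)" using ij by (intro key) auto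
  finally show "\<bar>Jxyy \<rho> x y\<bar> \<le> (3 / d) ^ 3 / (1 - \<rho>)" by (simp add: B_def)
qed

end

text \<open>One step of the induction over coordinates: \<open>a\<close>, \<open>b\<close> are conditional means and \<open>u\<close>, \<open>v\<close> the increments
  caused by one pair of correlated signs. The cubic error makes the sum over coordinates small
  as soon as the increments are spread out.\<close>

lemma J_two_point:
  assumes r: "0 \<le> \<rho>" "\<rho> < 1" and d: "0 < d"
    and a: "d \<le> a - \<bar>u\<bar>" "a + \<bar>u\<bar> \<le> 1 - d" and b: "d \<le> b - \<bar>v\<bar>" "b + \<bar>v\<bar> \<le> 1 - d"
  shows "(1 + \<rho>) / 4 * (J \<rho> (a + u) (b + v) + J \<rho> (a - u) (b - v)) +
      (1 - \<rho>) / 4 * (J \<rho> (a + u) (b - v) + J \<rho> (a - u) (b + v))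
    \<le> J \<rho> a b + 108 / (d ^ 3 * (1 - \<rho>)) * (\<bar>u\<bar> ^ 3 + \<bar>v\<bar> ^ 3)"
proof -
  define M where "M = (3 / d) ^ 3 / (1 - \<rho>)"
  have M0: "0 \<le> M" using d r by (simp add: M_def)
  let ?I = "{d..1 - d}"
  have in01: "0 < x \<and> x < 1" if "x \<in> ?I" for x using that d by auto
  have r1: "\<bar>\<rho>\<bar> < 1" using r by simp
  have Dy: "((\<lambda>y. J \<rho> x y) has_real_derivative Jx \<rho> y x) (at y within ?I)" if "x \<in> ?I" "y \<in> ?I" for x y
    unfolding J_sym[OF r1, of x] using DERIV_J_x[OF r] in01 that by blast
  have Dx: "((\<lambda>x. J \<rho> x y) has_real_derivative Jx \<rho> x y) (at x within ?I)"
    and Dxx: "((\<lambda>x. Jx \<rho> x y) has_real_derivative Jxx \<rho> x y) (at x within ?I)"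
    and Dxxx: "((\<lambda>x. Jxx \<rho> x y) has_real_derivative Jxxx \<rho> x y) (at x within ?I)"
    and Dyy: "((\<lambda>y. Jx \<rho> y x) has_real_derivative Jxx \<rho> y x) (at y within ?I)"
    and Dyyy: "((\<lambda>y. Jxx \<rho> y x) has_real_derivative Jxxx \<rho> y x) (at y within ?I)"
    and Dxy: "((\<lambda>y. Jx \<rho> x y) has_real_derivative Jxy \<rho> x y) (at y within ?I)"
    and Dxyy: "((\<lambda>y. Jxy \<rho> x y) has_real_derivative Jxyy \<rho> x y) (at y within ?I)"
    and Dxxy: "((\<lambda>y. Jxx \<rho> x y) has_real_derivative Jxxy \<rho> x y) (at y within ?I)"
    and M: "\<bar>Jxxx \<rho> x y\<bar> \<le> M" "\<bar>Jxxx \<rho> y x\<bar> \<le> M" "\<bar>Jxyy \<rho> x y\<bar> \<le> M" "\<bar>Jxxy \<rho> x y\<bar> \<le> M"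
    if "x \<in> ?I" "y \<in> ?I" for x y
    using in01[OF that(1)] in01[OF that(2)] that r d unfolding M_def
    by (auto intro: DERIV_J_x DERIV_Jx_x DERIV_Jx_y DERIV_Jxx_x DERIV_Jxx_y DERIV_Jxy_y
        intro!: third_derivative_bounds)
  have T: "\<bar>J \<rho> (a + \<xi> * u) (b + \<zeta> * v) - (J \<rho> a b + \<xi> * u * Jx \<rho> a b + \<zeta> * v * Jx \<rho> b a +
        u\<^sup>2 / 2 * Jxx \<rho> a b + \<xi> * u * (\<zeta> * v) * Jxy \<rho> a b + v\<^sup>2 / 2 * Jxx \<rho> b a)\<bar> \<le> M * (\<bar>u\<bar> + \<bar>v\<bar>) ^ 3"
    if "\<xi> \<in> {-1, 1}" "\<zeta> \<in> {-1, 1}" for \<xi> \<zeta> :: real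
  proof -
    have "\<bar>J \<rho> (a + \<xi> * u) (b + \<zeta> * v) - (J \<rho> a b + \<xi> * u * Jx \<rho> a b + \<zeta> * v * Jx \<rho> b a +
        (\<xi> * u)\<^sup>2 / 2 * Jxx \<rho> a b + \<xi> * u * (\<zeta> * v) * Jxy \<rho> a b + (\<zeta> * v)\<^sup>2 / 2 * Jxx \<rho> b a)\<bar>
      \<le> M * (\<bar>\<xi> * u\<bar> + \<bar>\<zeta> * v\<bar>) ^ 3"
    proof (rule two_point_taylor[where lo = d and hi = "1 - d" and F = "J \<rho>" and Fx = "Jx \<rho>" and Fy = "\<lambda>x y. Jx \<rho> y x"
          and Fxx = "Jxx \<rho>" and Fyy = "\<lambda>x y. Jxx \<rho> y x" and Fxy = "Jxy \<rho>" and Fxxx = "Jxxx \<rho>" and Fyyy = "\<lambda>x y. Jxxx \<rho> y x"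
          and Fxxy = "Jxxy \<rho>" and Fxyy = "Jxyy \<rho>"])
      show "a \<in> ?I" "a + \<xi> * u \<in> ?I" "b \<in> ?I" "b + \<zeta> * v \<in> ?I" using that a b by (auto split: abs_split)
    qed (fact Dy Dx Dxx Dxxx Dyy Dyyy Dxy Dxyy Dxxy M)+
    moreover have "(\<xi> * u)\<^sup>2 = u\<^sup>2" "(\<zeta> * v)\<^sup>2 = v\<^sup>2" "\<bar>\<xi> * u\<bar> = \<bar>u\<bar>" "\<bar>\<zeta> * v\<bar> = \<bar>v\<bar>" using that by auto
    ultimately show ?thesis by simp
  qed
  have "(1 + \<rho>) / 4 * (J \<rho> (a + u) (b + v) + J \<rho> (a - u) (b - v)) +
      (1 - \<rho>) / 4 * (J \<rho> (a + u) (b - v) + J \<rho> (a - u) (b + v)) \<le> J \<rho> a b + M * (\<bar>u\<bar> + \<bar>v\<bar>) ^ 3"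
    using r a b d
    by (intro two_point_average[OF _ T] J_quadratic_form_nonpos) auto
  also have "M * (\<bar>u\<bar> + \<bar>v\<bar>) ^ 3 \<le> M * (4 * (\<bar>u\<bar> ^ 3 + \<bar>v\<bar> ^ 3))"
  proof (intro mult_left_mono M0)
    define U V where "U = \<bar>u\<bar>" and "V = \<bar>v\<bar>"
    have "0 \<le> 3 * ((U + V) * (U - V)\<^sup>2)" by (auto simp: U_def V_def)
    also have "\<dots> = 4 * (U ^ 3 + V ^ 3) - (U + V) ^ 3"
      by (simp add: power2_eq_square power3_eq_cube algebra_simps)
    finally show "(\<bar>u\<bar> + \<bar>v\<bar>) ^ 3 \<le> 4 * (\<bar>u\<bar> ^ 3 + \<bar>v\<bar> ^ 3)" by (simp add: U_def V_def)
  qed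
  also have "M * (4 * (\<bar>u\<bar> ^ 3 + \<bar>v\<bar> ^ 3)) = 108 / (d ^ 3 * (1 - \<rho>)) * (\<bar>u\<bar> ^ 3 + \<bar>v\<bar> ^ 3)"
    by (simp add: M_def power_divide)
  finally show ?thesis by simp
qed

lemma J_concave:
  assumes r: "0 \<le> \<rho>" "\<rho> < 1" and a: "0 < a" "a < 1" and b: "0 < b - \<bar>v\<bar>" "b + \<bar>v\<bar> < 1"
  shows "(J \<rho> a (b + v) + J \<rho> a (b - v)) / 2 \<le> J \<rho> a b"
proof -
  have r1: "\<bar>\<rho>\<bar> < 1" using r by simp
  have nh: "J \<rho> q a - J \<rho> p a \<le> (q - p) * noisy_half \<rho> a (quant p)" "(q - p) * noisy_half \<rho> a (quant q) \<le> J \<rho> q a - J \<rho> p a"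
    if "0 < p" "p \<le> q" "q < 1" for p q
    using J_secant[OF r(1) that] by auto
  define V where "V = \<bar>v\<bar>"
  have "J \<rho> (b + V) a - J \<rho> b a \<le> V * noisy_half \<rho> a (quant b)"
    using nh(1)[of b "b + V"] b by (simp add: V_def)
  moreover have "V * noisy_half \<rho> a (quant b) \<le> J \<rho> b a - J \<rho> (b - V) a"
    using nh(2)[of "b - V" b] b by (simp add: V_def)
  ultimately have "(J \<rho> (b + V) a + J \<rho> (b - V) a) / 2 \<le> J \<rho> b a" by simp
  then show ?thesis unfolding J_sym[OF r1, of a] by (auto simp: V_def abs_if split: if_splits)
qed

section \<open>Averaging over coordinates\<close>

text \<open>Functions on a finite product space are averaged one coordinate at a time. Points are total functions on
  \<open>nat\<close> with values in a finite type, \<open>bool\<close> for the cube and \<open>bool \<times> bool\<close> for pairs of points, so that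
  averaging is an operator without side conditions, and conditional expectations given the other coordinates are
  again functions on the whole space.\<close>

definition avg_at :: "('b::finite \<Rightarrow> real) \<Rightarrow> nat \<Rightarrow> ((nat \<Rightarrow> 'b) \<Rightarrow> real) \<Rightarrow> (nat \<Rightarrow> 'b) \<Rightarrow> real" where
  "avg_at w i H z = (\<Sum>b\<in>UNIV. w b * H (z(i := b)))"

lemma avg_at_commute: "avg_at w i (avg_at w j H) = avg_at w j (avg_at w i H)"
proof (cases "i = j")
  case False
  have "(\<Sum>b\<in>UNIV. w b * (\<Sum>c\<in>UNIV. w c * H (z(i := b, j := c)))) =
      (\<Sum>c\<in>UNIV. w c * (\<Sum>b\<in>UNIV. w b * H (z(j := c, i := b))))" for z
  proof -
    have "(\<Sum>b\<in>UNIV. w b * (\<Sum>c\<in>UNIV. w c * H (z(i := b, j := c)))) =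
        (\<Sum>b\<in>UNIV. \<Sum>c\<in>UNIV. w b * (w c * H (z(i := b, j := c))))" by (simp add: sum_distrib_left)
    also have "\<dots> = (\<Sum>c\<in>UNIV. \<Sum>b\<in>UNIV. w b * (w c * H (z(i := b, j := c))))" by (rule sum.swap)
    also have "\<dots> = (\<Sum>c\<in>UNIV. w c * (\<Sum>b\<in>UNIV. w b * H (z(j := c, i := b))))"
      using False by (simp add: sum_distrib_left fun_upd_twist mult_ac)
    finally show ?thesis .
  qed
  then show ?thesis by (simp add: avg_at_def fun_eq_iff)
qed simp

interpretation avg_at: comp_fun_commute "avg_at w"
  by standard (simp add: fun_eq_iff avg_at_commute)

definition average :: "('b::finite \<Rightarrow> real) \<Rightarrow> nat set \<Rightarrow> ((nat \<Rightarrow> 'b) \<Rightarrow> real) \<Rightarrow> (nat \<Rightarrow> 'b) \<Rightarrow> real" where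
  "average w A H = Finite_Set.fold (avg_at w) H A"

lemma average_empty [simp]: "average w {} H = H"
  by (simp add: average_def)

lemma average_insert:
  "finite A \<Longrightarrow> i \<notin> A \<Longrightarrow> average w (insert i A) H = avg_at w i (average w A H)"
  by (simp add: average_def)

lemma average_insert':
  "finite A \<Longrightarrow> i \<notin> A \<Longrightarrow> average w (insert i A) H = average w A (avg_at w i H)"
  unfolding average_def by (subst avg_at.fold_insert2) auto

lemma average_union:
  assumes "finite A" "finite B" "A \<inter> B = {}"
  shows "average w (A \<union> B) H = average w A (average w B H)"
  using assms by (induction A) (simp_all add: average_insert)

lemma average_cong:
  assumes "finite A" "\<And>z'. (\<And>i. i \<notin> A \<Longrightarrow> z' i = z i) \<Longrightarrow> H z' = H' z'"
  shows "average w A H z = average w A H' z"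
  using assms
proof (induction A arbitrary: z rule: finite_induct)
  case empty
  then show ?case by simp
next
  case (insert i A)
  have "average w A H (z(i := b)) = average w A H' (z(i := b))" for b
  proof (rule insert.IH)
    fix z' assume z': "\<And>j. j \<notin> A \<Longrightarrow> z' j = (z(i := b)) j"
    show "H z' = H' z'"
    proof (rule insert.prems)
      fix j assume "j \<notin> insert i A"
      then show "z' j = z j" using z'[of j] by auto
    qed
  qed
  then show ?case using insert.hyps by (simp add: average_insert avg_at_def)
qed

lemma average_upd:
  assumes "finite A" "i \<notin> A"
  shows "average w A H (z(i := b)) = average w A (\<lambda>z. H (z(i := b))) z"
  using assms
  by (induction A arbitrary: z rule: finite_induct)
    (auto simp: average_insert avg_at_def fun_upd_twist[of i])

lemma average_add:
  "finite A \<Longrightarrow> average w A (\<lambda>z. H z + K z) z = average w A H z + average w A K z"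
  by (induction A arbitrary: z rule: finite_induct)
    (simp_all add: average_insert avg_at_def distrib_left sum.distrib)

lemma average_cmult:
  "finite A \<Longrightarrow> average w A (\<lambda>z. c * H z) z = c * average w A H z"
  by (induction A arbitrary: z rule: finite_induct)
    (simp_all add: average_insert avg_at_def sum_distrib_left mult_ac)

lemma average_sum:
  assumes "finite A" "finite I"
  shows "average w A (\<lambda>z. \<Sum>i\<in>I. H i z) z = (\<Sum>i\<in>I. average w A (H i) z)"
  using assms(2,1)
proof (induction I rule: finite_induct)
  case empty
  then show ?case using average_cmult[of A w 0 "\<lambda>_. 0"] by simp
qed (simp add: average_add)

definition weights :: "('b::finite \<Rightarrow> real) \<Rightarrow> bool" where
  "weights w \<longleftrightarrow> (\<forall>b. 0 \<le> w b) \<and> sum w UNIV = 1"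

lemma average_const:
  assumes "weights w" "finite A"
  shows "average w A (\<lambda>_. c) z = c"
  using assms(2,1)
  by (induction A arbitrary: z rule: finite_induct)
    (simp_all add: average_insert avg_at_def weights_def flip: sum_distrib_right)

lemma avg_at_mono:
  "weights w \<Longrightarrow> (\<And>z. H z \<le> K z) \<Longrightarrow> avg_at w i H z \<le> avg_at w i K z"
  by (auto simp: avg_at_def weights_def intro!: sum_mono mult_left_mono)

lemma average_mono:
  assumes "weights w" "finite A" "\<And>z. H z \<le> K z"
  shows "average w A H z \<le> average w A K z"
  using assms(2)
  by (induction A arbitrary: z rule: finite_induct)
    (auto simp: average_insert assms intro!: avg_at_mono)

lemma average_range:
  assumes "weights w" "finite A" "\<And>z. H z \<in> {lo..hi}"
  shows "average w A H z \<in> {lo..hi}"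
proof -
  have "average w A (\<lambda>_. lo) z \<le> average w A H z" "average w A H z \<le> average w A (\<lambda>_. hi) z"
    using assms by (auto intro!: average_mono)
  then show ?thesis using assms by (simp add: average_const)
qed

definition sign_of :: "bool \<Rightarrow> real" where "sign_of b = (if b then 1 else -1)"

lemma sign_of_simps [simp]: "sign_of True = 1" "sign_of False = -1" "sign_of b * sign_of b = 1" "(sign_of b)\<^sup>2 = 1"
  by (auto simp: sign_of_def power2_eq_square)

definition fair :: "bool \<Rightarrow> real" where "fair = (\<lambda>_. 1 / 2)"

definition corr :: "real \<Rightarrow> bool \<times> bool \<Rightarrow> real" where
  "corr \<rho> p = (1 + \<rho> * sign_of (fst p) * sign_of (snd p)) / 4"

lemma UNIV_bool_pair: "(UNIV :: (bool \<times> bool) set) = {(True, True), (True, False), (False, True), (False, False)}"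
  by auto

lemma weights_fair: "weights fair"
  by (simp add: weights_def fair_def UNIV_bool)

lemma weights_corr: "\<bar>\<rho>\<bar> \<le> 1 \<Longrightarrow> weights (corr \<rho>)"
  by (auto simp: weights_def corr_def UNIV_bool_pair sign_of_def field_simps)

lemma avg_at_fair: "avg_at fair i H x = (H (x(i := True)) + H (x(i := False))) / 2"
  by (simp add: avg_at_def fair_def UNIV_bool field_simps)

lemma avg_at_corr:
  "avg_at (corr \<rho>) i H z =
    (1 + \<rho>) / 4 * (H (z(i := (True, True))) + H (z(i := (False, False)))) +
    (1 - \<rho>) / 4 * (H (z(i := (True, False))) + H (z(i := (False, True))))"
  by (simp add: avg_at_def corr_def UNIV_bool_pair field_simps)

definition halfdiff :: "nat \<Rightarrow> ((nat \<Rightarrow> bool) \<Rightarrow> real) \<Rightarrow> (nat \<Rightarrow> bool) \<Rightarrow> real" where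
  "halfdiff i h x = (h (x(i := True)) - h (x(i := False))) / 2"

lemma avg_at_corr_fst: "avg_at (corr \<rho>) i (\<lambda>z. h (fst \<circ> z)) z = avg_at fair i h (fst \<circ> z)"
  by (simp add: avg_at_corr avg_at_fair fun_upd_comp field_simps)

lemma avg_at_corr_snd: "avg_at (corr \<rho>) i (\<lambda>z. h (snd \<circ> z)) z = avg_at fair i h (snd \<circ> z)"
  by (simp add: avg_at_corr avg_at_fair fun_upd_comp field_simps)

lemma average_corr_fst:
  "finite A \<Longrightarrow> average (corr \<rho>) A (\<lambda>z. h (fst \<circ> z)) z = average fair A h (fst \<circ> z)"
  by (induction A arbitrary: h z rule: finite_induct)
    (simp_all add: average_insert' avg_at_corr_fst[abs_def])

lemma average_corr_snd:
  "finite A \<Longrightarrow> average (corr \<rho>) A (\<lambda>z. h (snd \<circ> z)) z = average fair A h (snd \<circ> z)"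
  by (induction A arbitrary: h z rule: finite_induct)
    (simp_all add: average_insert' avg_at_corr_snd[abs_def])

lemma average_jensen:
  fixes \<phi> :: "real \<Rightarrow> real"
  assumes "finite A" "\<And>x. h x \<in> {lo..hi}"
    and "\<And>a b. a \<in> {lo..hi} \<Longrightarrow> b \<in> {lo..hi} \<Longrightarrow> \<phi> ((a + b) / 2) \<le> (\<phi> a + \<phi> b) / 2"
  shows "\<phi> (average fair A h x) \<le> average fair A (\<lambda>x. \<phi> (h x)) x"
  using assms(1)
proof (induction A arbitrary: x rule: finite_induct)
  case (insert i A)
  have r: "average fair A h y \<in> {lo..hi}" for y
    by (rule average_range) (use insert.hyps assms weights_fair in auto)
  have "\<phi> (avg_at fair i (average fair A h) x) \<le>
      (\<phi> (average fair A h (x(i := True))) + \<phi> (average fair A h (x(i := False)))) / 2"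
    unfolding avg_at_fair by (rule assms(3)[OF r r])
  also have "\<dots> \<le> (average fair A (\<lambda>x. \<phi> (h x)) (x(i := True)) + average fair A (\<lambda>x. \<phi> (h x)) (x(i := False))) / 2"
    by (intro divide_right_mono add_mono insert.IH) simp
  finally show ?case using insert.hyps by (simp add: average_insert avg_at_fair)
qed simp

lemma halfdiff_average:
  assumes "finite A" "i \<notin> A"
  shows "halfdiff i (average fair A h) x = average fair A (halfdiff i h) x"
proof -
  have "average fair A (halfdiff i h) x =
      average fair A (\<lambda>x. (1/2) * h (x(i := True)) + (- 1/2) * h (x(i := False))) x"
    unfolding halfdiff_def by (rule average_cong[OF assms(1)]) (simp add: field_simps)
  also have "\<dots> = halfdiff i (average fair A h) x"
    unfolding halfdiff_def average_add[OF assms(1)] average_cmult[OF assms(1)] average_upd[OF assms]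
    by (simp add: field_simps)
  finally show ?thesis ..
qed

text \<open>The tensorization argument of De, Mossel and Neeman. A two-point inequality for \<open>\<Psi>\<close> with cubic error passes to
  any number of coordinates: averaging over one more coordinate applies it to the
  conditional means of \<open>F\<close> and \<open>G\<close>, and the increments of these means are averages of the increments of \<open>F\<close> and
  \<open>G\<close>, so by convexity their cubes are controlled. The coordinates outside \<open>A\<close> stay fixed, which is what
  allows conditioning on the influential ones.\<close>

lemma two_point_tensorizes:
  fixes \<Psi> :: "real \<Rightarrow> real \<Rightarrow> real"
  assumes \<rho>: "\<bar>\<rho>\<bar> \<le> 1" and A: "finite A"
    and F: "\<And>x. F x \<in> {lo..hi}" and G: "\<And>x. G x \<in> {lo..hi}" and M: "0 \<le> M"
    and step: "\<And>a u b v. lo \<le> a - \<bar>u\<bar> \<Longrightarrow> a + \<bar>u\<bar> \<le> hi \<Longrightarrow> lo \<le> b - \<bar>v\<bar> \<Longrightarrow> b + \<bar>v\<bar> \<le> hi \<Longrightarrow>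
      (1 + \<rho>) / 4 * (\<Psi> (a + u) (b + v) + \<Psi> (a - u) (b - v)) +
      (1 - \<rho>) / 4 * (\<Psi> (a + u) (b - v) + \<Psi> (a - u) (b + v)) \<le> \<Psi> a b + M * (\<bar>u\<bar> ^ 3 + \<bar>v\<bar> ^ 3)"
  shows "average (corr \<rho>) A (\<lambda>z. \<Psi> (F (fst \<circ> z)) (G (snd \<circ> z))) z \<le>
    \<Psi> (average fair A F (fst \<circ> z)) (average fair A G (snd \<circ> z)) +
    M * (\<Sum>i\<in>A. average fair A (\<lambda>x. \<bar>halfdiff i F x\<bar> ^ 3) (fst \<circ> z) +
              average fair A (\<lambda>x. \<bar>halfdiff i G x\<bar> ^ 3) (snd \<circ> z))"
  using A
proof (induction A arbitrary: z rule: finite_induct)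
  case empty
  then show ?case by simp
next
  case (insert i A)
  note w = weights_corr[OF \<rho>]
  define FA GA where "FA = average fair A F" and "GA = average fair A G"
  define err where "err = (\<lambda>B (z::nat \<Rightarrow> bool \<times> bool). \<Sum>j\<in>A. average fair B (\<lambda>x. \<bar>halfdiff j F x\<bar> ^ 3) (fst \<circ> z) +
              average fair B (\<lambda>x. \<bar>halfdiff j G x\<bar> ^ 3) (snd \<circ> z))"
  have rF: "FA x \<in> {lo..hi}" and rG: "GA x \<in> {lo..hi}" for x
    unfolding FA_def GA_def using F G insert.hyps by (auto intro!: average_range weights_fair simp del: atLeastAtMost_iff)
  have cube_mono: "\<bar>halfdiff i (average fair A K) x\<bar> ^ 3 \<le> average fair (insert i A) (\<lambda>x. \<bar>halfdiff i K x\<bar> ^ 3) x"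
    if K: "\<And>x. K x \<in> {lo..hi}" for K x
  proof -
    define B where "B = (hi - lo) / 2"
    have "\<bar>halfdiff i (average fair A K) x\<bar> ^ 3 = \<bar>average fair A (halfdiff i K) x\<bar> ^ 3"
      using insert.hyps by (simp add: halfdiff_average)
    also have "\<dots> \<le> average fair A (\<lambda>x. \<bar>halfdiff i K x\<bar> ^ 3) x"
    proof (rule average_jensen[where lo = "- B" and hi = B and \<phi> = "\<lambda>t. \<bar>t\<bar> ^ 3"])
      fix y show "halfdiff i K y \<in> {- B..B}"
        using K[of "y(i := True)"] K[of "y(i := False)"] by (auto simp: halfdiff_def B_def field_simps)
    next
      fix a b :: real
      define U V where "U = \<bar>a\<bar>" and "V = \<bar>b\<bar>"
      have UV: "0 \<le> U" "0 \<le> V" by (auto simp: U_def V_def)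
      have "\<bar>(a + b) / 2\<bar> ^ 3 \<le> ((U + V) / 2) ^ 3" by (intro power_mono) (auto simp: U_def V_def)
      also have "\<dots> \<le> (U ^ 3 + V ^ 3) / 2"
      proof -
        have "0 \<le> 3 * ((U + V) * (U - V)\<^sup>2)" using UV by auto
        also have "\<dots> = 4 * (U ^ 3 + V ^ 3) - (U + V) ^ 3"
          by (simp add: power2_eq_square power3_eq_cube algebra_simps)
        finally show ?thesis by (simp add: power_divide)
      qed
      finally show "\<bar>(a + b) / 2\<bar> ^ 3 \<le> (\<bar>a\<bar> ^ 3 + \<bar>b\<bar> ^ 3) / 2" by (simp add: U_def V_def)
    qed (use insert.hyps in auto)
    also have "\<dots> = average fair (insert i A) (\<lambda>x. \<bar>halfdiff i K x\<bar> ^ 3) x"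
    proof -
      have "avg_at fair i (\<lambda>x. \<bar>halfdiff i K x\<bar> ^ 3) = (\<lambda>x. \<bar>halfdiff i K x\<bar> ^ 3)"
        by (simp add: fun_eq_iff avg_at_fair halfdiff_def)
      then show ?thesis using insert.hyps by (simp add: average_insert')
    qed
    finally show ?thesis .
  qed
  have one: "avg_at (corr \<rho>) i (\<lambda>z. \<Psi> (FA (fst \<circ> z)) (GA (snd \<circ> z))) z \<le>
      \<Psi> (avg_at fair i FA (fst \<circ> z)) (avg_at fair i GA (snd \<circ> z)) +
      M * (\<bar>halfdiff i FA (fst \<circ> z)\<bar> ^ 3 + \<bar>halfdiff i GA (snd \<circ> z)\<bar> ^ 3)"
  proof -
    let ?x = "fst \<circ> z" and ?y = "snd \<circ> z"
    let ?a = "avg_at fair i FA ?x" and ?u = "halfdiff i FA ?x"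
    let ?b = "avg_at fair i GA ?y" and ?v = "halfdiff i GA ?y"
    have e: "FA (?x(i := True)) = ?a + ?u" "FA (?x(i := False)) = ?a - ?u"
        "GA (?y(i := True)) = ?b + ?v" "GA (?y(i := False)) = ?b - ?v"
      by (simp_all add: avg_at_fair halfdiff_def field_simps)
    have "avg_at (corr \<rho>) i (\<lambda>z. \<Psi> (FA (fst \<circ> z)) (GA (snd \<circ> z))) z =
      (1 + \<rho>) / 4 * (\<Psi> (?a + ?u) (?b + ?v) + \<Psi> (?a - ?u) (?b - ?v)) +
      (1 - \<rho>) / 4 * (\<Psi> (?a + ?u) (?b - ?v) + \<Psi> (?a - ?u) (?b + ?v))"
      unfolding avg_at_corr fun_upd_comp fst_conv snd_conv e ..
    also have "\<dots> \<le> \<Psi> ?a ?b + M * (\<bar>?u\<bar> ^ 3 + \<bar>?v\<bar> ^ 3)"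
    proof (rule step)
      show "lo \<le> ?a - \<bar>?u\<bar>" "?a + \<bar>?u\<bar> \<le> hi" "lo \<le> ?b - \<bar>?v\<bar>" "?b + \<bar>?v\<bar> \<le> hi"
        using rF[of "?x(i := True)"] rF[of "?x(i := False)"] rG[of "?y(i := True)"] rG[of "?y(i := False)"]
        unfolding e by (auto simp: abs_if)
    qed
    finally show ?thesis .
  qed
  have "average (corr \<rho>) (insert i A) (\<lambda>z. \<Psi> (F (fst \<circ> z)) (G (snd \<circ> z))) z \<le>
      avg_at (corr \<rho>) i (\<lambda>z. \<Psi> (FA (fst \<circ> z)) (GA (snd \<circ> z)) + M * err A z) z"
    unfolding FA_def GA_def err_def average_insert[OF insert.hyps]
    by (rule avg_at_mono[OF w insert.IH])
  also have "\<dots> = avg_at (corr \<rho>) i (\<lambda>z. \<Psi> (FA (fst \<circ> z)) (GA (snd \<circ> z))) z + M * avg_at (corr \<rho>) i (err A) z"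
    using average_add[of "{i}" "corr \<rho>" "\<lambda>z. \<Psi> (FA (fst \<circ> z)) (GA (snd \<circ> z))" "\<lambda>z. M * err A z" z]
      average_cmult[of "{i}" "corr \<rho>" M "err A" z]
    by (simp add: average_insert)
  also have "avg_at (corr \<rho>) i (err A) z = err (insert i A) z"
  proof -
    have "avg_at (corr \<rho>) i (err A) z = average (corr \<rho>) {i} (err A) z" by (simp add: average_insert)
    also have "\<dots> = (\<Sum>j\<in>A. average (corr \<rho>) {i} (\<lambda>z. average fair A (\<lambda>x. \<bar>halfdiff j F x\<bar> ^ 3) (fst \<circ> z)) z +
              average (corr \<rho>) {i} (\<lambda>z. average fair A (\<lambda>x. \<bar>halfdiff j G x\<bar> ^ 3) (snd \<circ> z)) z)"
      unfolding err_def using insert.hyps by (simp add: average_sum average_add)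
    also have "\<dots> = err (insert i A) z"
      unfolding err_def using insert.hyps
      by (simp add: avg_at_corr_fst avg_at_corr_snd average_insert)
    finally show ?thesis .
  qed
  finally have "average (corr \<rho>) (insert i A) (\<lambda>z. \<Psi> (F (fst \<circ> z)) (G (snd \<circ> z))) z \<le>
      \<Psi> (avg_at fair i FA (fst \<circ> z)) (avg_at fair i GA (snd \<circ> z)) +
      M * (\<bar>halfdiff i FA (fst \<circ> z)\<bar> ^ 3 + \<bar>halfdiff i GA (snd \<circ> z)\<bar> ^ 3) + M * err (insert i A) z"
    using one by linarith
  also have "\<dots> \<le> \<Psi> (avg_at fair i FA (fst \<circ> z)) (avg_at fair i GA (snd \<circ> z)) +
      M * (average fair (insert i A) (\<lambda>x. \<bar>halfdiff i F x\<bar> ^ 3) (fst \<circ> z) +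
           average fair (insert i A) (\<lambda>x. \<bar>halfdiff i G x\<bar> ^ 3) (snd \<circ> z)) + M * err (insert i A) z"
    unfolding FA_def GA_def using M by (intro add_mono order_refl mult_left_mono cube_mono F G)
  also have "\<dots> = \<Psi> (average fair (insert i A) F (fst \<circ> z)) (average fair (insert i A) G (snd \<circ> z)) +
    M * (\<Sum>j\<in>insert i A. average fair (insert i A) (\<lambda>x. \<bar>halfdiff j F x\<bar> ^ 3) (fst \<circ> z) +
              average fair (insert i A) (\<lambda>x. \<bar>halfdiff j G x\<bar> ^ 3) (snd \<circ> z))"
    unfolding FA_def GA_def err_def using insert.hyps by (simp add: average_insert distrib_left)
  finally show ?case .
qed

section \<open>Walsh expansions, hypercontractivity and noisy influences\<close>

definition walsh :: "nat set \<Rightarrow> (nat set \<Rightarrow> real) \<Rightarrow> (nat \<Rightarrow> bool) \<Rightarrow> real" where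
  "walsh N c x = (\<Sum>A\<in>Pow N. c A * (\<Prod>i\<in>A. sign_of (x i)))"

lemma sum_Pow_insert:
  assumes "finite N" "i \<notin> N"
  shows "(\<Sum>A\<in>Pow (insert i N). h A) = (\<Sum>A\<in>Pow N. h A) + (\<Sum>A\<in>Pow N. h (insert i A) :: real)"
proof -
  have "inj_on (insert i) (Pow N)" using assms(2) by (auto simp: inj_on_def)
  then have "(\<Sum>A\<in>insert i ` Pow N. h A) = (\<Sum>A\<in>Pow N. h (insert i A))"
    by (simp add: sum.reindex)
  moreover have "Pow N \<inter> insert i ` Pow N = {}" using assms(2) by auto
  ultimately show ?thesis using assms(1) by (simp add: Pow_insert sum.union_disjoint)
qed

lemma card_insert_Pow: "finite N \<Longrightarrow> i \<notin> N \<Longrightarrow> A \<in> Pow N \<Longrightarrow> card (insert i A) = Suc (card A)"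
  by (metis PowD card_insert_disjoint finite_subset subsetD)

lemma walsh_empty [simp]: "walsh {} c x = c {}"
  by (simp add: walsh_def)

lemma walsh_insert:
  assumes "finite N" "i \<notin> N"
  shows "walsh (insert i N) c x = walsh N c x + sign_of (x i) * walsh N (\<lambda>A. c (insert i A)) x"
proof -
  have "(\<Sum>A\<in>Pow N. c (insert i A) * (\<Prod>j\<in>insert i A. sign_of (x j))) = sign_of (x i) * walsh N (\<lambda>A. c (insert i A)) x"
    unfolding walsh_def sum_distrib_left
  proof (rule sum.cong)
    fix A assume "A \<in> Pow N"
    then have "finite A" "i \<notin> A" using assms finite_subset by auto
    then show "c (insert i A) * (\<Prod>j\<in>insert i A. sign_of (x j)) = sign_of (x i) * (c (insert i A) * (\<Prod>j\<in>A. sign_of (x j)))" by simp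
  qed simp
  then show ?thesis unfolding walsh_def[of "insert i N"] walsh_def[of N c]
    by (simp add: sum_Pow_insert[OF assms])
qed

lemma walsh_upd: "i \<notin> N \<Longrightarrow> walsh N c (x(i := b)) = walsh N c x"
  unfolding walsh_def by (intro sum.cong arg_cong2[where f = "(*)"] prod.cong refl) auto

lemma walsh_add: "walsh N (\<lambda>A. c A + e A) x = walsh N c x + walsh N e x"
  by (simp add: walsh_def distrib_right sum.distrib)

lemma walsh_cmult: "walsh N (\<lambda>A. k * c A) x = k * walsh N c x"
  by (simp add: walsh_def sum_distrib_left mult_ac)

text \<open>Splitting off one coordinate writes \<open>F\<close> as its average plus the sign times its half difference.\<close>

lemma walsh_expansion:
  assumes "finite N" "\<And>x y. (\<And>i. i \<in> N \<Longrightarrow> x i = y i) \<Longrightarrow> F x = F y"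
  shows "\<exists>c. F = walsh N c"
  using assms
proof (induction N arbitrary: F rule: finite_induct)
  case (empty F)
  have "F x = F undefined" for x by (rule empty.prems) simp
  then have "F = walsh {} (\<lambda>_. F undefined)" by (simp add: fun_eq_iff)
  then show ?case by blast
next
  case (insert i N F)
  have dep: "F (x(i := b)) = F (y(i := b))" if "\<And>j. j \<in> N \<Longrightarrow> x j = y j" for x y b
    by (rule insert.prems) (use that in auto)
  have "\<exists>c. avg_at fair i F = walsh N c"
  proof (rule insert.IH)
    fix x y :: "nat \<Rightarrow> bool"
    assume "\<And>j. j \<in> N \<Longrightarrow> x j = y j"
    from dep[OF this] show "avg_at fair i F x = avg_at fair i F y" by (simp only: avg_at_fair)
  qed
  moreover have "\<exists>c. halfdiff i F = walsh N c"
  proof (rule insert.IH)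
    fix x y :: "nat \<Rightarrow> bool"
    assume "\<And>j. j \<in> N \<Longrightarrow> x j = y j"
    from dep[OF this] show "halfdiff i F x = halfdiff i F y" by (simp only: halfdiff_def)
  qed
  ultimately obtain ca cb where ca: "avg_at fair i F = walsh N ca" and cb: "halfdiff i F = walsh N cb" by blast
  define c where "c = (\<lambda>A. if i \<in> A then cb (A - {i}) else ca A)"
  have 1: "walsh N c x = walsh N ca x" for x
    unfolding walsh_def c_def using insert.hyps by (intro sum.cong) auto
  have 2: "walsh N (\<lambda>A. c (insert i A)) x = walsh N cb x" for x
    unfolding walsh_def
  proof (rule sum.cong)
    fix A assume "A \<in> Pow N"
    then have "insert i A - {i} = A" using insert.hyps by auto
    then show "c (insert i A) * (\<Prod>j\<in>A. sign_of (x j)) = cb A * (\<Prod>j\<in>A. sign_of (x j))" by (simp add: c_def)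
  qed simp
  have "F x = walsh (insert i N) c x" for x
  proof -
    have "F x = F (x(i := x i))" by simp
    also have "\<dots> = avg_at fair i F x + sign_of (x i) * halfdiff i F x"
      by (cases "x i") (simp_all add: avg_at_fair halfdiff_def field_simps del: fun_upd_triv)
    also have "\<dots> = walsh (insert i N) c x"
      using insert.hyps by (simp add: walsh_insert 1 2 ca cb)
    finally show ?thesis .
  qed
  then show ?case by blast
qed

lemma walsh_split:
  assumes "finite N" "i \<in> N"
  shows "walsh N c x = walsh (N - {i}) c x + sign_of (x i) * walsh (N - {i}) (\<lambda>A. c (insert i A)) x"
proof -
  have "insert i (N - {i}) = N" using assms(2) by auto
  with walsh_insert[of "N - {i}" i c x] assms(1) show ?thesis by simp
qed

lemma avg_at_walsh:
  assumes "finite N" "i \<in> N"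
  shows "avg_at fair i (walsh N c) = walsh (N - {i}) c"
  by (simp add: fun_eq_iff avg_at_fair walsh_split[OF assms] walsh_upd)

lemma halfdiff_walsh:
  assumes "finite N" "i \<in> N"
  shows "halfdiff i (walsh N c) x = walsh (N - {i}) (\<lambda>A. c (insert i A)) x"
  by (simp add: halfdiff_def walsh_split[OF assms] walsh_upd)

lemma average_walsh:
  assumes "finite N" "T \<subseteq> N"
  shows "average fair T (walsh N c) = walsh (N - T) c"
proof -
  have "finite T" using assms finite_subset by auto
  then show ?thesis using assms(2)
  proof (induction T rule: finite_induct)
    case (insert i T)
    have "N - insert i T = N - T - {i}" by auto
    then show ?case using insert assms(1) by (simp add: average_insert avg_at_walsh)
  qed simp
qed

lemma walsh_insert_fun:
  assumes "finite N" "i \<notin> N"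
  shows "walsh (insert i N) c = (\<lambda>x. walsh N c x + sign_of (x i) * walsh N (\<lambda>A. c (insert i A)) x)"
  by (simp add: fun_eq_iff walsh_insert[OF assms])

lemma parseval:
  assumes "finite N"
  shows "average fair N (\<lambda>x. (walsh N c x)\<^sup>2) x = (\<Sum>A\<in>Pow N. (c A)\<^sup>2)"
  using assms
proof (induction N arbitrary: c x rule: finite_induct)
  case (insert i N)
  have "avg_at fair i (\<lambda>x. (walsh (insert i N) c x)\<^sup>2) = (\<lambda>x. (walsh N c x)\<^sup>2 + (walsh N (\<lambda>A. c (insert i A)) x)\<^sup>2)"
    using insert.hyps by (simp add: fun_eq_iff avg_at_fair walsh_insert_fun walsh_upd power2_eq_square field_simps)
  then show ?case
    using insert.hyps by (simp add: average_insert' average_add insert.IH sum_Pow_insert)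
qed simp

lemma correlated_parseval:
  assumes "finite N"
  shows "average (corr \<rho>) N (\<lambda>z. walsh N c (fst \<circ> z) * walsh N e (snd \<circ> z)) z =
    (\<Sum>A\<in>Pow N. \<rho> ^ card A * (c A * e A))"
  using assms
proof (induction N arbitrary: c e z rule: finite_induct)
  case (insert i N)
  let ?c = "\<lambda>A. c (insert i A)" and ?e = "\<lambda>A. e (insert i A)"
  have "avg_at (corr \<rho>) i (\<lambda>z. walsh (insert i N) c (fst \<circ> z) * walsh (insert i N) e (snd \<circ> z)) =
      (\<lambda>z. walsh N c (fst \<circ> z) * walsh N e (snd \<circ> z) + \<rho> * (walsh N ?c (fst \<circ> z) * walsh N ?e (snd \<circ> z)))"
    using insert.hyps by (simp add: fun_eq_iff avg_at_corr fun_upd_comp walsh_insert walsh_upd field_simps)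
  then have "average (corr \<rho>) (insert i N) (\<lambda>z. walsh (insert i N) c (fst \<circ> z) * walsh (insert i N) e (snd \<circ> z)) z =
      (\<Sum>A\<in>Pow N. \<rho> ^ card A * (c A * e A)) + \<rho> * (\<Sum>A\<in>Pow N. \<rho> ^ card A * (?c A * ?e A))"
    using insert.hyps by (simp add: average_insert' average_add average_cmult insert.IH)
  also have "\<rho> * (\<Sum>A\<in>Pow N. \<rho> ^ card A * (?c A * ?e A)) = (\<Sum>A\<in>Pow N. \<rho> ^ card (insert i A) * (?c A * ?e A))"
    using insert.hyps by (simp add: sum_distrib_left card_insert_Pow mult_ac)
  finally show ?case using insert.hyps by (simp add: sum_Pow_insert)
qed simp

text \<open>Hypercontractivity from the fourth to the second moment, with the factor \<open>3\<close> per degree that makes it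
  dimension free. If \<open>f = a + x b\<close> with a fresh sign \<open>x\<close>, then \<open>f ^ 4\<close> averages to
  \<open>a ^ 4 + 6 a\<^sup>2 b\<^sup>2 + b ^ 4\<close>, where by Cauchy-Schwarz the mixed term is at most the geometric mean of the
  two bounds known by induction.\<close>

lemma bonami_fourth_moment:
  assumes "finite N"
  shows "average fair N (\<lambda>x. (walsh N c x) ^ 4) x \<le> (\<Sum>A\<in>Pow N. 3 ^ card A * (c A)\<^sup>2)\<^sup>2"
  using assms
proof (induction N arbitrary: c x rule: finite_induct)
  case (insert i N)
  let ?c = "\<lambda>A. c (insert i A)"
  define a b where "a = walsh N c" and "b = walsh N ?c"
  define P R where "P = (\<Sum>A\<in>Pow N. 3 ^ card A * (c A)\<^sup>2)" and "R = (\<Sum>A\<in>Pow N. 3 ^ card A * (?c A)\<^sup>2)"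
  have PR: "0 \<le> P" "0 \<le> R" by (auto simp: P_def R_def intro!: sum_nonneg)
  have a4: "average fair N (\<lambda>x. a x ^ 4) x \<le> P\<^sup>2" and b4: "average fair N (\<lambda>x. b x ^ 4) x \<le> R\<^sup>2"
    unfolding a_def b_def P_def R_def by (rule insert.IH)+
  have zero: "walsh N k = (\<lambda>_. 0)" if "(\<Sum>A\<in>Pow N. 3 ^ card A * (k A)\<^sup>2) = 0" for k
  proof -
    have "\<forall>A\<in>Pow N. 3 ^ card A * (k A)\<^sup>2 = 0"
      using that insert.hyps by (subst (asm) sum_nonneg_eq_0_iff) auto
    then show ?thesis by (auto simp: walsh_def fun_eq_iff)
  qed
  have ab: "average fair N (\<lambda>x. (a x)\<^sup>2 * (b x)\<^sup>2) x \<le> P * R"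
  proof (cases "P = 0 \<or> R = 0")
    case True
    then have "(\<lambda>x. (a x)\<^sup>2 * (b x)\<^sup>2) = (\<lambda>_. 0)"
      using zero[of c] zero[of ?c] by (auto simp: a_def b_def P_def R_def)
    then show ?thesis using PR insert.hyps by (simp add: average_const weights_fair)
  next
    case False
    then have pos: "0 < P" "0 < R" using PR by auto
    \<comment> \<open>Cauchy-Schwarz in weighted form, with the weights for which the final bound is \<open>P R\<close>.\<close>
    have "average fair N (\<lambda>x. (a x)\<^sup>2 * (b x)\<^sup>2) x \<le>
        average fair N (\<lambda>x. R / (2 * P) * a x ^ 4 + P / (2 * R) * b x ^ 4) x"
    proof (intro average_mono weights_fair insert.hyps)
      fix x
      define u v where "u = (a x)\<^sup>2" and "v = (b x)\<^sup>2"
      have "0 \<le> (R * u - P * v)\<^sup>2" by simp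
      then have "2 * (P * R * (u * v)) \<le> R\<^sup>2 * u\<^sup>2 + P\<^sup>2 * v\<^sup>2" by (simp add: power2_eq_square algebra_simps)
      then have "u * v \<le> R / (2 * P) * u\<^sup>2 + P / (2 * R) * v\<^sup>2"
        using pos by (simp add: field_simps power2_eq_square)
      then show "(a x)\<^sup>2 * (b x)\<^sup>2 \<le> R / (2 * P) * a x ^ 4 + P / (2 * R) * b x ^ 4"
        by (simp add: u_def v_def power_mult[symmetric])
    qed
    also have "\<dots> = R / (2 * P) * average fair N (\<lambda>x. a x ^ 4) x + P / (2 * R) * average fair N (\<lambda>x. b x ^ 4) x"
      using insert.hyps by (simp only: average_add average_cmult)
    also have "\<dots> \<le> R / (2 * P) * P\<^sup>2 + P / (2 * R) * R\<^sup>2"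
      using pos by (intro add_mono mult_left_mono a4 b4) auto
    also have "\<dots> = P * R" using pos by (simp add: power2_eq_square)
    finally show ?thesis .
  qed
  have "avg_at fair i (\<lambda>x. (walsh (insert i N) c x) ^ 4) = (\<lambda>x. a x ^ 4 + (6 * ((a x)\<^sup>2 * (b x)\<^sup>2) + b x ^ 4))"
    using insert.hyps
    by (simp add: fun_eq_iff avg_at_fair walsh_insert_fun walsh_upd a_def b_def power4_eq_xxxx power2_eq_square algebra_simps)
  then have "average fair (insert i N) (\<lambda>x. (walsh (insert i N) c x) ^ 4) x =
      average fair N (\<lambda>x. a x ^ 4) x + (6 * average fair N (\<lambda>x. (a x)\<^sup>2 * (b x)\<^sup>2) x + average fair N (\<lambda>x. b x ^ 4) x)"
    using insert.hyps by (simp add: average_insert' average_add average_cmult)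
  also have "\<dots> \<le> P\<^sup>2 + (6 * (P * R) + R\<^sup>2)"
    using a4 ab b4 by linarith
  also have "\<dots> \<le> (P + 3 * R)\<^sup>2" using PR by (simp add: power2_eq_square algebra_simps)
  also have "P + 3 * R = (\<Sum>A\<in>Pow (insert i N). 3 ^ card A * (c A)\<^sup>2)"
    using insert.hyps by (simp add: sum_Pow_insert P_def R_def card_insert_Pow sum_distrib_left mult_ac)
  finally show ?case .
qed simp

text \<open>Damping the coefficients by \<open>s ^ card A\<close> is the noise operator. On the value at one point, each coordinate acts as a
  convex combination of the two restrictions, so pointwise bounds survive.\<close>

lemma noise_range:
  assumes "finite N" "0 \<le> s" "s \<le> 1" "\<And>x. walsh N c x \<in> {lo..hi}"
  shows "walsh N (\<lambda>A. s ^ card A * c A) x \<in> {lo..hi}"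
  using assms(1,4)
proof (induction N arbitrary: c x rule: finite_induct)
  case (insert i N)
  define e where "e = (\<lambda>A. c A + sign_of (x i) * s * c (insert i A))"
  have "walsh (insert i N) (\<lambda>A. s ^ card A * c A) x =
      walsh N (\<lambda>A. s ^ card A * c A) x + sign_of (x i) * walsh N (\<lambda>A. s ^ card (insert i A) * c (insert i A)) x"
    using insert.hyps by (simp add: walsh_insert)
  also have "walsh N (\<lambda>A. s ^ card (insert i A) * c (insert i A)) x = walsh N (\<lambda>A. s * (s ^ card A * c (insert i A))) x"
    unfolding walsh_def using insert.hyps by (intro sum.cong) (simp_all add: card_insert_Pow)
  also have "walsh N (\<lambda>A. s ^ card A * c A) x + sign_of (x i) * walsh N (\<lambda>A. s * (s ^ card A * c (insert i A))) x =
      walsh N (\<lambda>A. s ^ card A * e A) x"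
    unfolding walsh_cmult[symmetric] walsh_add[symmetric] e_def by (simp add: algebra_simps)
  also have "\<dots> \<in> {lo..hi}"
  proof (rule insert.IH)
    fix y
    define p where "p = (1 + sign_of (x i) * s) / 2"
    have p: "0 \<le> p" "0 \<le> 1 - p" using assms(2,3) by (auto simp: p_def sign_of_def)
    have "walsh N e y = walsh N c y + sign_of (x i) * s * walsh N (\<lambda>A. c (insert i A)) y"
      unfolding e_def walsh_cmult[symmetric] walsh_add[symmetric] ..
    also have "\<dots> = p * walsh (insert i N) c (y(i := True)) + (1 - p) * walsh (insert i N) c (y(i := False))"
      using insert.hyps by (simp add: walsh_insert walsh_upd p_def field_simps)
    finally have eq: "walsh N e y = \<dots>" .
    have "p * lo + (1 - p) * lo \<le> walsh N e y" "walsh N e y \<le> p * hi + (1 - p) * hi"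
      unfolding eq using insert.prems[unfolded atLeastAtMost_iff] p
      by (intro add_mono mult_left_mono; blast)+
    then show "walsh N e y \<in> {lo..hi}" by (simp add: algebra_simps)
  qed
  finally show ?case .
qed simp

text \<open>Each set \<open>A\<close> is counted once for each of its elements.\<close>

lemma sum_influences:
  fixes h :: "nat set \<Rightarrow> real"
  assumes "finite N"
  shows "(\<Sum>i\<in>N. \<Sum>A\<in>Pow (N - {i}). h (insert i A)) = (\<Sum>A\<in>Pow N. real (card A) * h A)"
  using assms
proof (induction N arbitrary: h rule: finite_induct)
  case (insert j N)
  have "(\<Sum>i\<in>N. \<Sum>A\<in>Pow (insert j N - {i}). h (insert i A)) =
      (\<Sum>i\<in>N. (\<Sum>A\<in>Pow (N - {i}). h (insert i A)) + (\<Sum>A\<in>Pow (N - {i}). h (insert j (insert i A))))"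
  proof (rule sum.cong)
    fix i assume i: "i \<in> N"
    then have "insert j N - {i} = insert j (N - {i})" using insert.hyps by auto
    then show "(\<Sum>A\<in>Pow (insert j N - {i}). h (insert i A)) =
      (\<Sum>A\<in>Pow (N - {i}). h (insert i A)) + (\<Sum>A\<in>Pow (N - {i}). h (insert j (insert i A)))"
      using insert.hyps by (simp add: sum_Pow_insert insert_commute)
  qed simp
  also have "\<dots> = (\<Sum>A\<in>Pow N. real (card A) * h A) + (\<Sum>A\<in>Pow N. real (card A) * h (insert j A))"
    unfolding sum.distrib insert.IH[of h] insert.IH[of "\<lambda>A. h (insert j A)"] ..
  finally have 1: "(\<Sum>i\<in>N. \<Sum>A\<in>Pow (insert j N - {i}). h (insert i A)) =
      (\<Sum>A\<in>Pow N. real (card A) * h A) + (\<Sum>A\<in>Pow N. real (card A) * h (insert j A))" .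
  have 2: "(\<Sum>A\<in>Pow N. real (card (insert j A)) * h (insert j A)) =
      (\<Sum>A\<in>Pow N. real (card A) * h (insert j A)) + (\<Sum>A\<in>Pow N. h (insert j A))"
    using insert.hyps by (simp add: card_insert_Pow sum.distrib[symmetric] distrib_right add.commute)
  have "insert j N - {j} = N" using insert.hyps by auto
  then show ?case using insert.hyps 1 2 by (simp add: sum_Pow_insert)
qed simp

lemma mult_power_le:
  fixes q :: real
  assumes "0 \<le> q" "q < 1"
  shows "real k * q ^ k \<le> 1 / (1 - q)"
proof -
  have "real k * q ^ k * (1 - q) \<le> 1 - q ^ k"
  proof (induction k)
    case (Suc k)
    have "q ^ Suc k \<le> 1" using assms by (intro power_le_one) auto
    then have "0 \<le> (1 - q) * (1 - q ^ Suc k)" using assms by simp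
    moreover have "q * (real k * q ^ k * (1 - q)) \<le> q * (1 - q ^ k)"
      using Suc assms by (intro mult_left_mono) auto
    ultimately show ?case by (simp add: algebra_simps)
  qed simp
  also have "\<dots> \<le> 1" using assms by simp
  finally show ?thesis using assms by (simp add: field_simps)
qed

text \<open>For splitting a function into a low-degree part \<open>a\<close> and a high-degree part \<open>b\<close>: the fourth moment is
  available for \<open>a\<close> only, while for \<open>b\<close> the boundedness of the sum reduces the cube to a square.\<close>

lemma cube_le_squares:
  fixes a b l :: real
  assumes "\<bar>a + b\<bar> \<le> 1" "0 < l"
  shows "\<bar>a + b\<bar> ^ 3 \<le> 4 * l * a\<^sup>2 + 4 / l * a ^ 4 + 4 * b\<^sup>2"
proof (cases "\<bar>b\<bar> \<le> \<bar>a\<bar>")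
  case True
  have "0 \<le> (l - \<bar>a\<bar>)\<^sup>2" by simp
  then have "2 * \<bar>a\<bar> \<le> l + a\<^sup>2 / l" using assms(2) by (simp add: power2_eq_square field_simps)
  then have "4 * a\<^sup>2 * (2 * \<bar>a\<bar>) \<le> 4 * a\<^sup>2 * (l + a\<^sup>2 / l)" by (intro mult_left_mono) auto
  moreover have "\<bar>a + b\<bar> ^ 3 \<le> (2 * \<bar>a\<bar>) ^ 3" using True by (intro power_mono) auto
  moreover have "(2 * \<bar>a\<bar>) ^ 3 = 4 * a\<^sup>2 * (2 * \<bar>a\<bar>)" by (simp add: power3_eq_cube power2_eq_square)
  moreover have "4 * a\<^sup>2 * (l + a\<^sup>2 / l) = 4 * l * a\<^sup>2 + 4 / l * a ^ 4"
    by (simp add: power4_eq_xxxx power2_eq_square algebra_simps)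
  ultimately show ?thesis by (smt (verit) zero_le_power2)
next
  case False
  have "\<bar>a + b\<bar> ^ 3 \<le> \<bar>a + b\<bar>\<^sup>2" using assms(1) by (intro power_decreasing) auto
  also have "\<dots> \<le> (2 * \<bar>b\<bar>)\<^sup>2" using False by (intro power_mono) auto
  also have "\<dots> = 4 * b\<^sup>2" by (simp add: power2_eq_square)
  also have "\<dots> \<le> 4 * l * a\<^sup>2 + 4 / l * a ^ 4 + 4 * b\<^sup>2" using assms(2) by simp
  finally show ?thesis .
qed

text \<open>A bounded function of small second moment has a third moment much smaller than that, up to its weight
  on degrees at least \<open>d\<close>. The low-degree part is controlled by hypercontractivity.\<close>

lemma third_moment_bound:
  fixes \<tau> :: real
  assumes "finite N" "\<And>x. \<bar>walsh N e x\<bar> \<le> 1" "0 < \<tau>" "(\<Sum>A\<in>Pow N. (e A)\<^sup>2) \<le> \<tau>"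
  shows "average fair N (\<lambda>x. \<bar>walsh N e x\<bar> ^ 3) x \<le>
    8 * 3 ^ d * sqrt \<tau> * (\<Sum>A\<in>Pow N. (e A)\<^sup>2) + 4 * (\<Sum>A\<in>Pow N. if d \<le> card A then (e A)\<^sup>2 else 0)"
proof -
  define I where "I = (\<Sum>A\<in>Pow N. (e A)\<^sup>2)"
  \<comment> \<open>The weight \<open>l\<close> equalizes the bounds for the second and the fourth moment of the low-degree part.\<close>
  define l where "l = 3 ^ d * sqrt \<tau>"
  have l: "0 < l" using assms(3) by (simp add: l_def)
  have I: "0 \<le> I" "I \<le> \<tau>" using assms(4) by (auto simp: I_def intro!: sum_nonneg)
  define ea eb where "ea = (\<lambda>A. if d \<le> card A then 0 else e A)" and "eb = (\<lambda>A. if d \<le> card A then e A else 0)"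
  have e: "walsh N e x = walsh N ea x + walsh N eb x" for x
    unfolding walsh_add[symmetric] by (simp add: ea_def eb_def walsh_def) (intro sum.cong, auto)
  have "average fair N (\<lambda>x. \<bar>walsh N e x\<bar> ^ 3) x \<le>
      average fair N (\<lambda>x. 4 * l * (walsh N ea x)\<^sup>2 + 4 / l * (walsh N ea x) ^ 4 + 4 * (walsh N eb x)\<^sup>2) x"
    using assms(2) unfolding e by (intro average_mono weights_fair assms(1) cube_le_squares l)
  also have "\<dots> = 4 * l * (\<Sum>A\<in>Pow N. (ea A)\<^sup>2) + 4 / l * average fair N (\<lambda>x. (walsh N ea x) ^ 4) x + 4 * (\<Sum>A\<in>Pow N. (eb A)\<^sup>2)"
    using assms(1) by (simp only: average_add average_cmult parseval)
  also have "\<dots> \<le> 4 * l * I + 4 / l * (3 ^ d * I)\<^sup>2 + 4 * (\<Sum>A\<in>Pow N. (eb A)\<^sup>2)"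
  proof -
    have 1: "(\<Sum>A\<in>Pow N. (ea A)\<^sup>2) \<le> I" unfolding I_def by (intro sum_mono) (auto simp: ea_def)
    have "average fair N (\<lambda>x. (walsh N ea x) ^ 4) x \<le> (\<Sum>A\<in>Pow N. 3 ^ card A * (ea A)\<^sup>2)\<^sup>2"
      by (rule bonami_fourth_moment[OF assms(1)])
    also have "\<dots> \<le> (3 ^ d * I)\<^sup>2"
    proof (rule power_mono)
      show "(\<Sum>A\<in>Pow N. 3 ^ card A * (ea A)\<^sup>2) \<le> 3 ^ d * I"
        unfolding I_def sum_distrib_left
      proof (rule sum_mono)
        fix A :: "nat set"
        have "(3::real) ^ card A \<le> 3 ^ d" if "card A < d" using that by (intro power_increasing) auto
        then show "3 ^ card A * (ea A)\<^sup>2 \<le> 3 ^ d * (e A)\<^sup>2"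
          by (auto simp: ea_def not_le intro!: mult_right_mono)
      qed
    qed (auto intro!: sum_nonneg)
    finally show ?thesis using 1 l by (intro add_mono mult_left_mono) auto
  qed
  also have "4 / l * (3 ^ d * I)\<^sup>2 \<le> 4 * l * I"
  proof -
    have "(3 ^ d * I)\<^sup>2 = (3 ^ d)\<^sup>2 * I * I" by (simp add: power2_eq_square)
    also have "\<dots> \<le> (3 ^ d)\<^sup>2 * I * \<tau>" using I by (intro mult_left_mono) auto
    also have "\<dots> = l * l * I" using assms(3) by (simp add: l_def power2_eq_square)
    finally show ?thesis using l by (simp add: field_simps)
  qed
  also have "4 * l * I + 4 * l * I + 4 * (\<Sum>A\<in>Pow N. (eb A)\<^sup>2) =
      8 * 3 ^ d * sqrt \<tau> * I + 4 * (\<Sum>A\<in>Pow N. if d \<le> card A then (e A)\<^sup>2 else 0)"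
    unfolding eb_def l_def by (simp add: if_distrib[of "\<lambda>x. x\<^sup>2"] cong: if_cong)
  finally show ?thesis by (simp add: I_def)
qed

text \<open>The influence of coordinate \<open>i\<close>, that is, the second moment of the half difference in direction \<open>i\<close>, written in
  terms of the coefficients.\<close>

definition walsh_infl :: "nat set \<Rightarrow> (nat set \<Rightarrow> real) \<Rightarrow> nat \<Rightarrow> real" where
  "walsh_infl N c i = (\<Sum>A\<in>Pow (N - {i}). (c (insert i A))\<^sup>2)"

text \<open>Noise bounds the total influence independently of the dimension, because \<open>k q ^ k \<le> 1 / (1 - q)\<close> for
  every \<open>k\<close>.\<close>

lemma noisy_total_influence:
  fixes s :: real
  assumes "finite N" "0 \<le> s" "s < 1" "(\<Sum>A\<in>Pow N. (c A)\<^sup>2) \<le> 1"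
  shows "(\<Sum>i\<in>N. walsh_infl N (\<lambda>A. s ^ card A * c A) i) \<le> 1 / (1 - s\<^sup>2)"
proof -
  have s2: "0 \<le> s\<^sup>2" "s\<^sup>2 < 1" using assms(2,3) by (auto simp: abs_square_less_1)
  have "(\<Sum>i\<in>N. walsh_infl N (\<lambda>A. s ^ card A * c A) i) = (\<Sum>A\<in>Pow N. real (card A) * (s ^ card A * c A)\<^sup>2)"
    unfolding walsh_infl_def by (rule sum_influences[OF assms(1)])
  also have "\<dots> \<le> (\<Sum>A\<in>Pow N. 1 / (1 - s\<^sup>2) * (c A)\<^sup>2)"
  proof (rule sum_mono)
    fix A :: "nat set"
    have "real (card A) * (s ^ card A * c A)\<^sup>2 = (real (card A) * (s\<^sup>2) ^ card A) * (c A)\<^sup>2"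
      by (simp add: power_mult_distrib power_mult[symmetric] mult.commute)
    also have "\<dots> \<le> 1 / (1 - s\<^sup>2) * (c A)\<^sup>2" by (intro mult_right_mono mult_power_le s2) auto
    finally show "real (card A) * (s ^ card A * c A)\<^sup>2 \<le> 1 / (1 - s\<^sup>2) * (c A)\<^sup>2" .
  qed
  also have "\<dots> = 1 / (1 - s\<^sup>2) * (\<Sum>A\<in>Pow N. (c A)\<^sup>2)" by (simp add: sum_distrib_left)
  also have "\<dots> \<le> 1 / (1 - s\<^sup>2) * 1" using assms(4) s2 by (intro mult_left_mono) auto
  finally show ?thesis by simp
qed

lemma noisy_tail:
  fixes s :: real and N :: "nat set"
  assumes "finite N" "0 \<le> s" "s < 1" "(\<Sum>A\<in>Pow N. (c A)\<^sup>2) \<le> 1"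
  shows "(\<Sum>i\<in>N. \<Sum>A\<in>Pow (N - {i}). if d \<le> card A then (s ^ card (insert i A) * c (insert i A))\<^sup>2 else 0) \<le> s ^ d / (1 - s)"
proof -
  define h where "h = (\<lambda>A. if d < card A then (s ^ card A * c A)\<^sup>2 else 0)"
  have "(\<Sum>i\<in>N. \<Sum>A\<in>Pow (N - {i}). if d \<le> card A then (s ^ card (insert i A) * c (insert i A))\<^sup>2 else 0) =
      (\<Sum>i\<in>N. \<Sum>A\<in>Pow (N - {i}). h (insert i A))"
    using assms(1) by (intro sum.cong refl) (auto simp: h_def card_insert_Pow[of "N - {_}"] less_Suc_eq_le)
  also have "\<dots> = (\<Sum>A\<in>Pow N. real (card A) * h A)" by (rule sum_influences[OF assms(1)])
  also have "\<dots> \<le> (\<Sum>A\<in>Pow N. s ^ d / (1 - s) * (c A)\<^sup>2)"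
  proof (rule sum_mono)
    fix A :: "nat set"
    show "real (card A) * h A \<le> s ^ d / (1 - s) * (c A)\<^sup>2"
    proof (cases "d < card A")
      case True
      have "real (card A) * h A = (s ^ card A) * (real (card A) * s ^ card A) * (c A)\<^sup>2"
        using True by (simp add: h_def power_mult_distrib power2_eq_square)
      also have "\<dots> \<le> s ^ d * (1 / (1 - s)) * (c A)\<^sup>2"
        using True assms(2,3) by (intro mult_right_mono mult_mono mult_power_le power_decreasing) auto
      finally show ?thesis by simp
    qed (use assms in \<open>simp add: h_def\<close>)
  qed
  also have "\<dots> = s ^ d / (1 - s) * (\<Sum>A\<in>Pow N. (c A)\<^sup>2)" by (simp add: sum_distrib_left)
  also have "\<dots> \<le> s ^ d / (1 - s) * 1" using assms by (intro mult_left_mono) auto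
  finally show ?thesis by simp
qed

text \<open>The error of the tensorization over coordinates of small influence. The truncation degree \<open>d\<close> is a free
  parameter that balances the loss \<open>3 ^ d\<close> of hypercontractivity against the tail \<open>s ^ d\<close> left by the noise.\<close>

lemma total_third_moment:
  fixes s :: real
  assumes N: "finite N" and s: "0 \<le> s" "s < 1" and c: "(\<Sum>A\<in>Pow N. (c A)\<^sup>2) \<le> 1"
    and h: "\<And>x i. \<bar>halfdiff i (walsh N (\<lambda>A. s ^ card A * c A)) x\<bar> \<le> 1"
    and T: "T \<subseteq> N" "\<And>i. i \<in> T \<Longrightarrow> walsh_infl N (\<lambda>A. s ^ card A * c A) i \<le> \<tau>" and \<tau>: "0 < \<tau>"
  shows "(\<Sum>i\<in>T. average fair N (\<lambda>x. \<bar>halfdiff i (walsh N (\<lambda>A. s ^ card A * c A)) x\<bar> ^ 3) x) \<le>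
    8 * 3 ^ d * sqrt \<tau> / (1 - s\<^sup>2) + 4 * s ^ d / (1 - s)"
proof -
  define e where "e = (\<lambda>A. s ^ card A * c A)"
  define tl where "tl = (\<lambda>i. \<Sum>A\<in>Pow (N - {i}). if d \<le> card A then (e (insert i A))\<^sup>2 else 0)"
  have each: "average fair N (\<lambda>x. \<bar>halfdiff i (walsh N e) x\<bar> ^ 3) x \<le>
      8 * 3 ^ d * sqrt \<tau> * walsh_infl N e i + 4 * tl i" if i: "i \<in> T" for i
  proof -
    have iN: "i \<in> N" using i T by auto
    have eq: "halfdiff i (walsh N e) = walsh (N - {i}) (\<lambda>A. e (insert i A))"
      by (simp add: fun_eq_iff halfdiff_walsh[OF N iN])
    let ?g = "\<lambda>x. \<bar>walsh (N - {i}) (\<lambda>A. e (insert i A)) x\<bar> ^ 3"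
    have "average fair N ?g x = average fair (insert i (N - {i})) ?g x"
      using iN by (simp add: insert_absorb)
    also have "\<dots> = average fair (N - {i}) (avg_at fair i ?g) x"
      using N by (subst average_insert') auto
    also have "avg_at fair i ?g = ?g" by (simp add: fun_eq_iff avg_at_fair walsh_upd)
    also have "average fair (N - {i}) ?g x \<le> 8 * 3 ^ d * sqrt \<tau> * walsh_infl N e i + 4 * tl i"
      unfolding walsh_infl_def tl_def
      by (rule third_moment_bound) (use N h[of i] T(2)[OF i] \<tau> eq in \<open>auto simp: walsh_infl_def e_def\<close>)
    finally show ?thesis unfolding eq .
  qed
  have nn: "0 \<le> walsh_infl N e i" "0 \<le> tl i" for i by (auto simp: walsh_infl_def tl_def intro!: sum_nonneg)
  have "(\<Sum>i\<in>T. average fair N (\<lambda>x. \<bar>halfdiff i (walsh N e) x\<bar> ^ 3) x) \<le>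
      (\<Sum>i\<in>T. 8 * 3 ^ d * sqrt \<tau> * walsh_infl N e i + 4 * tl i)"
    by (rule sum_mono) (rule each)
  also have "\<dots> \<le> (\<Sum>i\<in>N. 8 * 3 ^ d * sqrt \<tau> * walsh_infl N e i + 4 * tl i)"
    using T N nn \<tau> by (intro sum_mono2) auto
  also have "\<dots> = 8 * 3 ^ d * sqrt \<tau> * (\<Sum>i\<in>N. walsh_infl N e i) + 4 * (\<Sum>i\<in>N. tl i)"
    by (simp add: sum.distrib sum_distrib_left)
  also have "\<dots> \<le> 8 * 3 ^ d * sqrt \<tau> * (1 / (1 - s\<^sup>2)) + 4 * (s ^ d / (1 - s))"
    unfolding e_def tl_def using N s c \<tau>
    by (intro add_mono mult_left_mono noisy_total_influence noisy_tail) auto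
  finally show ?thesis by (simp add: e_def)
qed

lemma card_influential:
  fixes s :: real
  assumes "finite N" "0 \<le> s" "s < 1" "(\<Sum>A\<in>Pow N. (c A)\<^sup>2) \<le> 1" "0 < \<tau>"
  shows "real (card {i\<in>N. \<tau> < walsh_infl N (\<lambda>A. s ^ card A * c A) i}) \<le> 1 / ((1 - s\<^sup>2) * \<tau>)"
proof -
  define e where "e = (\<lambda>A. s ^ card A * c A)"
  have "real (card {i\<in>N. \<tau> < walsh_infl N e i}) * \<tau> = (\<Sum>i\<in>{i\<in>N. \<tau> < walsh_infl N e i}. \<tau>)" by simp
  also have "\<dots> \<le> (\<Sum>i\<in>{i\<in>N. \<tau> < walsh_infl N e i}. walsh_infl N e i)" by (intro sum_mono) auto
  also have "\<dots> \<le> (\<Sum>i\<in>N. walsh_infl N e i)"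
    using assms(1) by (intro sum_mono2) (auto simp: walsh_infl_def intro!: sum_nonneg)
  also have "\<dots> \<le> 1 / (1 - s\<^sup>2)" unfolding e_def by (rule noisy_total_influence[OF assms(1-4)])
  finally have "real (card {i\<in>N. \<tau> < walsh_infl N e i}) \<le> 1 / (1 - s\<^sup>2) / \<tau>"
    using assms(5) by (simp only: pos_le_divide_eq)
  then show ?thesis by (simp add: e_def)
qed

section \<open>Resilient functions on the cube\<close>

text \<open>Expectations over product laws are iterated averages. The embedding \<open>e\<close> translates from the finite type of the
  coordinates to the values that the product law takes.\<close>

lemma expectation_Pi_pmf:
  fixes p :: "'c pmf" and e :: "'b::finite \<Rightarrow> 'c" and G :: "(nat \<Rightarrow> 'c) \<Rightarrow> real"
  assumes e: "inj e" "set_pmf p \<subseteq> range e" "\<And>b. pmf p (e b) = w b" and A: "finite A"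
  shows "measure_pmf.expectation (Pi_pmf A d (\<lambda>_. p)) G =
    average w A (\<lambda>z. G (\<lambda>i. if i \<in> A then e (z i) else d)) z"
  using A
proof (induction A arbitrary: G z rule: finite_induct)
  case (empty G z)
  then show ?case by simp
next
  case (insert x A G z)
  have fin: "finite (set_pmf p)" using e(2) finite_subset[OF e(2)] by simp
  have fin_Pi: "finite (set_pmf (Pi_pmf A d (\<lambda>_. p)))"
    using insert.hyps fin by (simp add: set_Pi_pmf finite_PiE_dflt)
  have "measure_pmf.expectation (Pi_pmf (insert x A) d (\<lambda>_. p)) G =
      measure_pmf.expectation (p \<bind> (\<lambda>y. map_pmf (\<lambda>f. f(x := y)) (Pi_pmf A d (\<lambda>_. p)))) G"
    using insert.hyps by (simp add: Pi_pmf_insert' map_pmf_def)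
  also have "\<dots> = (\<Sum>y\<in>range e. pmf p y *\<^sub>R measure_pmf.expectation (map_pmf (\<lambda>f. f(x := y)) (Pi_pmf A d (\<lambda>_. p))) G)"
    using e(2) fin_Pi by (intro pmf_expectation_bind) auto
  also have "\<dots> = (\<Sum>b\<in>UNIV. w b * measure_pmf.expectation (Pi_pmf A d (\<lambda>_. p)) (\<lambda>f. G (f(x := e b))))"
    using e by (simp add: sum.reindex)
  also have "\<dots> = (\<Sum>b\<in>UNIV. w b * average w A (\<lambda>z. G ((\<lambda>i. if i \<in> A then e (z i) else d)(x := e b))) z)"
    unfolding insert.IH[of _ z] ..
  also have "\<dots> = (\<Sum>b\<in>UNIV. w b * average w A (\<lambda>z. G (\<lambda>i. if i \<in> insert x A then e (z i) else d)) (z(x := b)))"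
  proof (rule sum.cong[OF refl])
    fix b
    have "(\<lambda>i. if i \<in> A then e (y i) else d)(x := e b) = (\<lambda>i. if i \<in> insert x A then e ((y(x := b)) i) else d)" for y
      using insert.hyps by auto
    then show "w b * average w A (\<lambda>z. G ((\<lambda>i. if i \<in> A then e (z i) else d)(x := e b))) z =
        w b * average w A (\<lambda>z. G (\<lambda>i. if i \<in> insert x A then e (z i) else d)) (z(x := b))"
      by (simp only: average_upd[OF insert.hyps])
  qed
  also have "\<dots> = average w (insert x A) (\<lambda>z. G (\<lambda>i. if i \<in> insert x A then e (z i) else d)) z"
    unfolding average_insert[OF insert.hyps] avg_at_def ..
  finally show ?case .
qed

definition vertex :: "nat \<Rightarrow> (nat \<Rightarrow> bool) \<Rightarrow> nat \<Rightarrow> real" where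
  "vertex n x = (\<lambda>i\<in>{..<n}. sign_of (x i))"

lemma sign_of_range: "sign_of b \<in> {-1, 1}" by (simp add: sign_of_def)

lemma vertex_in_cube: "vertex n x \<in> cube {..<n}"
  using sign_of_range by (auto simp: vertex_def cube_def)

lemma inj_sign_of: "inj sign_of"
  by (auto simp: inj_def sign_of_def split: if_splits)

lemma range_sign_of: "range sign_of = {-1, 1}"
  by (auto simp: sign_of_def image_def)

lemma PiE_dflt_signs: "PiE_dflt A undefined (\<lambda>_. {-1, 1}) = cube A"
  by (auto simp: PiE_dflt_def cube_def PiE_def extensional_def Pi_def)

lemma Pi_pmf_signs: "finite A \<Longrightarrow> Pi_pmf A undefined (\<lambda>_. pmf_of_set {-1, 1}) = pmf_of_set (cube A)"
  using Pi_pmf_of_set[of A "\<lambda>_. {-1, 1 :: real}" undefined] by (simp add: PiE_dflt_signs)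

lemma expectation_cube:
  assumes "finite A"
  shows "measure_pmf.expectation (pmf_of_set (cube A)) G =
    average fair A (\<lambda>x. G (\<lambda>i. if i \<in> A then sign_of (x i) else undefined)) x"
  unfolding Pi_pmf_signs[OF assms, symmetric]
  by (rule expectation_Pi_pmf) (use assms inj_sign_of sign_of_range in \<open>auto simp: range_sign_of fair_def\<close>)

lemma cube_mean_eq: "cube_mean n f = average fair {..<n} (\<lambda>x. f (vertex n x)) x"
  unfolding cube_mean_def unif_cube_def
  by (subst expectation_cube[where x = x]) (simp_all add: vertex_def restrict_def)

lemma noisy_inner_eq:
  assumes "\<bar>\<rho>\<bar> \<le> 1"
  shows "noisy_inner n \<rho> f g =
    average (corr \<rho>) {..<n} (\<lambda>z. f (vertex n (fst \<circ> z)) * g (vertex n (snd \<circ> z))) z"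
proof -
  let ?e = "\<lambda>p. (sign_of (fst p), sign_of (snd p))"
  have "noisy_inner n \<rho> f g =
      average (corr \<rho>) {..<n} (\<lambda>z. f (\<lambda>i\<in>{..<n}. fst (if i \<in> {..<n} then ?e (z i) else undefined)) *
        g (\<lambda>i\<in>{..<n}. snd (if i \<in> {..<n} then ?e (z i) else undefined))) z"
    unfolding noisy_inner_def
  proof (rule expectation_Pi_pmf)
    show "inj ?e" using inj_sign_of by (auto simp: inj_def prod_eq_iff)
    show "set_pmf (corr_pair \<rho>) \<subseteq> range ?e"
    proof
      fix q assume "q \<in> set_pmf (corr_pair \<rho>)"
      then have "q \<in> range sign_of \<times> range sign_of" using set_corr_pair[of \<rho>] by (auto simp: range_sign_of)
      then show "q \<in> range ?e" by (auto simp: image_def)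
    qed
    show "pmf (corr_pair \<rho>) (?e b) = corr \<rho> b" for b
      using assms sign_of_range by (subst pmf_corr_pair) (auto simp: corr_def)
  qed simp
  also have "\<dots> = average (corr \<rho>) {..<n} (\<lambda>z. f (vertex n (fst \<circ> z)) * g (vertex n (snd \<circ> z))) z"
  proof -
    have "(\<lambda>i\<in>{..<n}. fst (if i \<in> {..<n} then ?e (z i) else undefined)) = vertex n (fst \<circ> z)"
      "(\<lambda>i\<in>{..<n}. snd (if i \<in> {..<n} then ?e (z i) else undefined)) = vertex n (snd \<circ> z)" for z
      by (auto simp: vertex_def restrict_def)
    then show ?thesis by simp
  qed
  finally show ?thesis .
qed

lemma cond_unif_cube:
  assumes "S \<subseteq> {..<n}" "y \<in> cube S"
  shows "cond_pmf (unif_cube n) {x. restrict x S = y} = pmf_of_set {x \<in> cube {..<n}. restrict x S = y}"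
proof (rule pmf_eqI)
  fix x
  let ?s = "{x. restrict x S = y}"
  have ne: "set_pmf (unif_cube n) \<inter> ?s \<noteq> {}" by (rule unif_cube_cond_nonempty[OF assms])
  have eq: "{x \<in> cube {..<n}. restrict x S = y} = cube {..<n} \<inter> ?s" by auto
  have ne': "cube {..<n} \<inter> ?s \<noteq> {}" using ne by simp
  have "0 < card (cube {..<n})" "0 < card (cube {..<n} \<inter> ?s)" using ne' by (auto simp: card_gt_0_iff)
  then show "pmf (cond_pmf (unif_cube n) ?s) x = pmf (pmf_of_set {x \<in> cube {..<n}. restrict x S = y}) x"
    unfolding eq pmf_cond[OF ne] using ne'
    by (simp add: unif_cube_def measure_pmf_of_set indicator_def)
qed

text \<open>Resilience in operator form: averaging over all coordinates outside a small set \<open>S\<close> nearly produces the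
  mean, whatever the values on \<open>S\<close> are.\<close>

lemma resilient_restriction:
  assumes res: "resilient n r \<alpha> f" and S: "S \<subseteq> {..<n}" "real (card S) \<le> r"
  shows "\<bar>average fair ({..<n} - S) (\<lambda>x. f (vertex n x)) x - cube_mean n f\<bar> \<le> \<alpha>"
proof -
  define T where "T = {..<n} - S"
  define y where "y = (\<lambda>i\<in>S. sign_of (x i))"
  define \<phi> where "\<phi> = (\<lambda>w i. if i \<in> S then y i else (w :: nat \<Rightarrow> real) i)"
  have fT: "finite T" by (simp add: T_def)
  have y: "y \<in> cube S" using sign_of_range by (auto simp: y_def cube_def)
  have y1: "y i \<in> {-1, 1}" if "i \<in> S" for i using that sign_of_range by (simp add: y_def)
  have im: "\<phi> ` cube T = {u \<in> cube {..<n}. restrict u S = y}"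
  proof (intro equalityI subsetI)
    fix u assume "u \<in> \<phi> ` cube T"
    then obtain w where w: "w \<in> cube T" "u = \<phi> w" by auto
    have "restrict u S = y" by (auto simp: w \<phi>_def y_def restrict_def)
    moreover have "u \<in> cube {..<n}"
      unfolding cube_def
    proof (rule PiE_I)
      fix i assume "i \<in> {..<n}"
      then show "u i \<in> {-1, 1}" using w y1 by (cases "i \<in> S") (auto simp: \<phi>_def cube_def T_def)
    next
      fix i assume "i \<notin> {..<n}"
      then show "u i = undefined" using w S by (auto simp: \<phi>_def cube_def T_def PiE_def extensional_def)
    qed
    ultimately show "u \<in> {u \<in> cube {..<n}. restrict u S = y}" by simp
  next
    fix u assume u: "u \<in> {u \<in> cube {..<n}. restrict u S = y}"
    have "restrict u T \<in> cube T" using u by (auto simp: cube_def T_def)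
    moreover have "\<phi> (restrict u T) = u"
    proof
      fix i
      have "u i = y i" if "i \<in> S" using u that by (metis (mono_tags, lifting) mem_Collect_eq restrict_apply')
      moreover have "u i = undefined" if "i \<notin> {..<n}" using u that by (auto simp: cube_def PiE_def extensional_def)
      ultimately show "\<phi> (restrict u T) i = u i" by (auto simp: \<phi>_def T_def restrict_def)
    qed
    ultimately show "u \<in> \<phi> ` cube T" by (metis imageI)
  qed
  have inj: "inj_on \<phi> (cube T)"
  proof (rule inj_onI)
    fix w w' assume w: "w \<in> cube T" "w' \<in> cube T" "\<phi> w = \<phi> w'"
    show "w = w'"
    proof
      fix i
      show "w i = w' i"
      proof (cases "i \<in> S")
        case True
        then show ?thesis using w by (auto simp: cube_def T_def PiE_def extensional_def)
      next
        case False
        then show ?thesis using fun_cong[OF w(3), of i] by (simp add: \<phi>_def)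
      qed
    qed
  qed
  have "measure_pmf.expectation (cond_pmf (unif_cube n) {x. restrict x S = y}) f =
      measure_pmf.expectation (map_pmf \<phi> (pmf_of_set (cube T))) f"
    using inj fT by (simp add: cond_unif_cube[OF S(1) y] im[symmetric] map_pmf_of_set_inj del: integral_map_pmf)
  also have "\<dots> = measure_pmf.expectation (pmf_of_set (cube T)) (\<lambda>w. f (\<phi> w))" by simp
  also have "\<dots> = average fair T (\<lambda>x'. f (\<phi> (\<lambda>i. if i \<in> T then sign_of (x' i) else undefined))) x"
    by (rule expectation_cube[OF fT])
  also have "\<dots> = average fair T (\<lambda>x. f (vertex n x)) x"
  proof (rule average_cong[OF fT])
    fix x' assume x': "\<And>i. i \<notin> T \<Longrightarrow> x' i = x i"
    have "\<phi> (\<lambda>i. if i \<in> T then sign_of (x' i) else undefined) = vertex n x'"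
      using x' S by (auto simp: \<phi>_def vertex_def y_def T_def fun_eq_iff)
    then show "f (\<phi> (\<lambda>i. if i \<in> T then sign_of (x' i) else undefined)) = f (vertex n x')" by simp
  qed
  finally have "average fair T (\<lambda>x. f (vertex n x)) x =
      measure_pmf.expectation (cond_pmf (unif_cube n) {x. restrict x S = y}) f" ..
  then show ?thesis using res S y unfolding resilient_def T_def by auto
qed

lemma average_fair_affine:
  assumes "finite A"
  shows "average fair A (\<lambda>x. a + b * h x) x = a + b * average fair A h x"
  using assms by (simp add: average_add average_cmult average_const weights_fair)

text \<open>Parseval, and \<open>t\<^sup>2 \<le> t\<close> on the unit interval.\<close>

lemma walsh_sq_sum_le:
  assumes "finite N" "\<And>x. walsh N c x \<in> {0..1}"
  shows "(\<Sum>A\<in>Pow N. (c A)\<^sup>2) \<le> c {}"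
proof -
  have "(\<Sum>A\<in>Pow N. (c A)\<^sup>2) = average fair N (\<lambda>x. (walsh N c x)\<^sup>2) undefined"
    by (rule parseval[OF assms(1), symmetric])
  also have "\<dots> \<le> average fair N (walsh N c) undefined"
    using assms(2) by (intro average_mono weights_fair assms(1)) (auto simp: power2_eq_square mult_left_le)
  also have "\<dots> = c {}" using assms(1) by (simp add: average_walsh)
  finally show ?thesis .
qed

lemma walsh_mean_range:
  assumes "finite N" "\<And>x. walsh N c x \<in> {0..1}"
  shows "c {} \<in> {0..1}"
proof -
  have "average fair N (walsh N c) undefined \<in> {0..1}"
    by (rule average_range) (use assms weights_fair in auto)
  then show ?thesis using assms(1) by (simp add: average_walsh)
qed

text \<open>The core estimate, for the smoothed functions \<open>h\<close> and \<open>k\<close>. They are first moved into \<open>[\<delta>, 1 - \<delta>]\<close>, where \<open>J\<close>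
  has bounded third derivatives, and their product is bounded by \<open>J\<close>. The set \<open>S\<close> contains the
  coordinates that are influential for either function. Averaging over its complement \<open>T\<close> is done by tensorization, with
  a small error since all influences in \<open>T\<close> are small. What remains is a function on \<open>S\<close>: there the first argument of
  \<open>J\<close> is nearly constant by resilience, and for a constant first argument concavity in the second one allows
  averaging over \<open>S\<close>. So \<open>k\<close> may depend on the coordinates in \<open>S\<close> in an arbitrary way.\<close>

lemma smoothed_bound:
  fixes c e :: "nat set \<Rightarrow> real" and N :: "nat set"
  assumes N: "finite N" and r: "0 \<le> \<rho>" "\<rho> < 1" and s: "0 \<le> s" "s < 1"
    and d: "0 < \<delta>" "\<delta> < 1 / 2" and \<tau>: "0 < \<tau>"
    and c: "\<And>x. walsh N c x \<in> {0..1}" and e: "\<And>x. walsh N e x \<in> {0..1}"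
  defines "h \<equiv> walsh N (\<lambda>A. s ^ card A * c A)" and "k \<equiv> walsh N (\<lambda>A. s ^ card A * e A)"
    and "S \<equiv> {i\<in>N. \<tau> < walsh_infl N (\<lambda>A. s ^ card A * c A) i} \<union> {i\<in>N. \<tau> < walsh_infl N (\<lambda>A. s ^ card A * e A) i}"
  assumes res: "\<And>x. \<bar>average fair (N - S) (walsh N c) x - c {}\<bar> \<le> \<alpha>"
  shows "average (corr \<rho>) N (\<lambda>z. h (fst \<circ> z) * k (snd \<circ> z)) z \<le>
    J \<rho> (\<delta> + (1 - 2 * \<delta>) * c {}) (\<delta> + (1 - 2 * \<delta>) * e {}) + 2 * \<delta> + \<alpha> +
    1728 / (\<delta> ^ 3 * (1 - \<rho>)) * (3 ^ m * sqrt \<tau> / (1 - s\<^sup>2) + s ^ m / (1 - s))"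
proof -
  define T where "T = N - S"
  have S: "S \<subseteq> N" "finite S" and T: "T \<subseteq> N" "finite T" and ST: "N = S \<union> T" "S \<inter> T = {}" "N - T = S"
    using N by (auto simp: S_def T_def)
  have r1: "\<bar>\<rho>\<bar> < 1" "\<bar>\<rho>\<bar> \<le> 1" using r by auto
  note w = weights_corr[OF r1(2)]
  \<comment> \<open>Rescaling into the interval where \<open>J\<close> is smooth.\<close>
  define sc where "sc = (\<lambda>t. \<delta> + (1 - 2 * \<delta>) * t)"
  have sc_range: "sc t \<in> {\<delta>..1 - \<delta>}" if "t \<in> {0..1}" for t
  proof -
    have "(1 - 2 * \<delta>) * t \<le> (1 - 2 * \<delta>) * 1" "0 \<le> (1 - 2 * \<delta>) * t"
      using that d by (auto intro!: mult_left_mono)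
    then show ?thesis by (auto simp: sc_def)
  qed
  have sc01: "sc t \<in> {0..1}" if "t \<in> {0..1}" for t using sc_range[OF that] d by auto
  have sc_near: "t - sc t \<le> \<delta>" if "t \<in> {0..1}" for t
  proof -
    have "\<delta> * (2 * t - 1) \<le> \<delta> * 1" using that d by (intro mult_left_mono) auto
    then show ?thesis by (simp add: sc_def algebra_simps)
  qed
  have h: "h x \<in> {0..1}" and k: "k x \<in> {0..1}" for x
    unfolding h_def k_def using s c e N by (auto intro!: noise_range simp del: atLeastAtMost_iff)
  define F G where "F = (\<lambda>x. sc (h x))" and "G = (\<lambda>x. sc (k x))"
  have F: "F x \<in> {\<delta>..1 - \<delta>}" and G: "G x \<in> {\<delta>..1 - \<delta>}" for x
    unfolding F_def G_def using h k by (auto intro!: sc_range simp del: atLeastAtMost_iff)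
  define M where "M = 108 / (\<delta> ^ 3 * (1 - \<rho>))"
  have M: "0 \<le> M" using d r by (simp add: M_def)
  define FT GT where "FT = average fair T F" and "GT = average fair T G"
  have GT: "GT x \<in> {\<delta>..1 - \<delta>}" for x
    unfolding GT_def using G T by (auto intro!: average_range weights_fair simp del: atLeastAtMost_iff)
  have FT: "FT x \<in> {\<delta>..1 - \<delta>}" for x
    unfolding FT_def using F T by (auto intro!: average_range weights_fair simp del: atLeastAtMost_iff)
  define err where "err = (\<lambda>B x y. \<Sum>i\<in>T. average fair B (\<lambda>x. \<bar>halfdiff i F x\<bar> ^ 3) x +
      average fair B (\<lambda>x. \<bar>halfdiff i G x\<bar> ^ 3) y)"

  have pointwise: "h (fst \<circ> z) * k (snd \<circ> z) \<le> J \<rho> (F (fst \<circ> z)) (G (snd \<circ> z)) + 2 * \<delta>" for z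
  proof -
    let ?h = "h (fst \<circ> z)" and ?k = "k (snd \<circ> z)"
    have "?h * ?k - sc ?h * sc ?k = ?h * (?k - sc ?k) + sc ?k * (?h - sc ?h)" by (simp add: algebra_simps)
    also have "\<dots> \<le> 1 * \<delta> + 1 * \<delta>"
      using h[of "fst \<circ> z"] k[of "snd \<circ> z"] sc01[OF k[of "snd \<circ> z"]] sc_near[OF h[of "fst \<circ> z"]] sc_near[OF k[of "snd \<circ> z"]] d
      by (intro add_mono order_trans[OF mult_left_mono[where b = \<delta>] mult_right_mono]) auto
    finally have "?h * ?k \<le> sc ?h * sc ?k + 2 * \<delta>" by simp
    also have "sc ?h * sc ?k \<le> J \<rho> (sc ?h) (sc ?k)"
      using sc01[OF h[of "fst \<circ> z"]] sc01[OF k[of "snd \<circ> z"]] r by (intro J_ge_prod) auto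
    finally show ?thesis by (simp add: F_def G_def)
  qed
  have "average (corr \<rho>) N (\<lambda>z. h (fst \<circ> z) * k (snd \<circ> z)) z \<le>
      average (corr \<rho>) N (\<lambda>z. J \<rho> (F (fst \<circ> z)) (G (snd \<circ> z)) + 2 * \<delta>) z"
    by (intro average_mono w N pointwise)
  also have "\<dots> = average (corr \<rho>) N (\<lambda>z. J \<rho> (F (fst \<circ> z)) (G (snd \<circ> z))) z + 2 * \<delta>"
    using N by (simp add: average_add average_const w)
  also have "average (corr \<rho>) N (\<lambda>z. J \<rho> (F (fst \<circ> z)) (G (snd \<circ> z))) z =
      average (corr \<rho>) S (average (corr \<rho>) T (\<lambda>z. J \<rho> (F (fst \<circ> z)) (G (snd \<circ> z)))) z"
    unfolding ST(1) using S T ST by (simp add: average_union)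
  also have "average (corr \<rho>) S (average (corr \<rho>) T (\<lambda>z. J \<rho> (F (fst \<circ> z)) (G (snd \<circ> z)))) z \<le>
      average (corr \<rho>) S (\<lambda>z. J \<rho> (FT (fst \<circ> z)) (GT (snd \<circ> z)) + M * err T (fst \<circ> z) (snd \<circ> z)) z"
  proof (intro average_mono w S)
    fix z
    show "average (corr \<rho>) T (\<lambda>z. J \<rho> (F (fst \<circ> z)) (G (snd \<circ> z))) z \<le> J \<rho> (FT (fst \<circ> z)) (GT (snd \<circ> z)) + M * err T (fst \<circ> z) (snd \<circ> z)"
      unfolding FT_def GT_def err_def
    proof (rule two_point_tensorizes[OF r1(2) T(2) F G M])
      fix a u b v :: real
      assume "\<delta> \<le> a - \<bar>u\<bar>" "a + \<bar>u\<bar> \<le> 1 - \<delta>" "\<delta> \<le> b - \<bar>v\<bar>" "b + \<bar>v\<bar> \<le> 1 - \<delta>"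
      then show "(1 + \<rho>) / 4 * (J \<rho> (a + u) (b + v) + J \<rho> (a - u) (b - v)) +
        (1 - \<rho>) / 4 * (J \<rho> (a + u) (b - v) + J \<rho> (a - u) (b + v)) \<le> J \<rho> a b + M * (\<bar>u\<bar> ^ 3 + \<bar>v\<bar> ^ 3)"
        unfolding M_def by (rule J_two_point[OF r d(1)])
    qed
  qed
  also have "\<dots> = average (corr \<rho>) S (\<lambda>z. J \<rho> (FT (fst \<circ> z)) (GT (snd \<circ> z))) z +
      M * average (corr \<rho>) S (\<lambda>z. err T (fst \<circ> z) (snd \<circ> z)) z"
    using S by (simp add: average_add average_cmult)
  also have "average (corr \<rho>) S (\<lambda>z. err T (fst \<circ> z) (snd \<circ> z)) z = err N (fst \<circ> z) (snd \<circ> z)"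
    unfolding err_def ST(1) using S T ST
    by (simp add: average_sum average_add average_corr_fst average_corr_snd average_union)
  also have "average (corr \<rho>) S (\<lambda>z. J \<rho> (FT (fst \<circ> z)) (GT (snd \<circ> z))) z \<le> J \<rho> (sc (c {})) (sc (e {})) + \<alpha>"
  proof -
    have c01: "c {} \<in> {0..1}" by (rule walsh_mean_range[OF N c])
    \<comment> \<open>Averaging over \<open>T\<close> commutes with the noise operator, which preserves the resilience bound.\<close>
    have near: "\<bar>FT x - sc (c {})\<bar> \<le> \<alpha>" for x
    proof -
      have "walsh S c y \<in> {c {} - \<alpha>..c {} + \<alpha>}" for y
        using res[of y] average_walsh[OF N T(1), of c] ST(3) by (auto simp: T_def[symmetric] abs_le_iff)
      then have "walsh S (\<lambda>A. s ^ card A * c A) x \<in> {c {} - \<alpha>..c {} + \<alpha>}"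
        using s S by (intro noise_range) auto
      then have a: "\<bar>walsh S (\<lambda>A. s ^ card A * c A) x - c {}\<bar> \<le> \<alpha>" by auto
      have "FT x = sc (walsh S (\<lambda>A. s ^ card A * c A) x)"
        unfolding FT_def F_def sc_def h_def using T
        by (simp add: average_fair_affine average_walsh[OF N T(1)] ST(3))
      then have "FT x - sc (c {}) = (1 - 2 * \<delta>) * (walsh S (\<lambda>A. s ^ card A * c A) x - c {})"
        by (simp add: sc_def algebra_simps)
      then have "\<bar>FT x - sc (c {})\<bar> = (1 - 2 * \<delta>) * \<bar>walsh S (\<lambda>A. s ^ card A * c A) x - c {}\<bar>"
        using d by (simp add: abs_mult)
      also have "\<dots> \<le> 1 * \<alpha>" using a d by (intro mult_mono) auto
      finally show ?thesis by simp
    qed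
    have "average (corr \<rho>) S (\<lambda>z. J \<rho> (FT (fst \<circ> z)) (GT (snd \<circ> z))) z \<le>
        average (corr \<rho>) S (\<lambda>z. J \<rho> (sc (c {})) (GT (snd \<circ> z)) + \<alpha>) z"
    proof (intro average_mono w S)
      fix z :: "nat \<Rightarrow> bool \<times> bool"
      have "\<bar>J \<rho> (FT (fst \<circ> z)) (GT (snd \<circ> z)) - J \<rho> (sc (c {})) (GT (snd \<circ> z))\<bar> \<le> \<bar>FT (fst \<circ> z) - sc (c {})\<bar>"
        using FT[of "fst \<circ> z"] sc01[OF c01] d by (intro J_lipschitz_left) auto
      then show "J \<rho> (FT (fst \<circ> z)) (GT (snd \<circ> z)) \<le> J \<rho> (sc (c {})) (GT (snd \<circ> z)) + \<alpha>"
        using near[of "fst \<circ> z"] by linarith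
    qed
    also have "\<dots> = average fair S (\<lambda>y. J \<rho> (sc (c {})) (GT y)) (snd \<circ> z) + \<alpha>"
      using S average_corr_snd[of S \<rho> "\<lambda>y. J \<rho> (sc (c {})) (GT y)"]
      by (simp add: average_add average_const w)
    also have "average fair S (\<lambda>y. J \<rho> (sc (c {})) (GT y)) (snd \<circ> z) \<le> J \<rho> (sc (c {})) (average fair S GT (snd \<circ> z))"
    proof -
      have "- J \<rho> (sc (c {})) (average fair S GT (snd \<circ> z)) \<le> average fair S (\<lambda>y. - J \<rho> (sc (c {})) (GT y)) (snd \<circ> z)"
      proof (rule average_jensen[where \<phi> = "\<lambda>t. - J \<rho> (sc (c {})) t", OF S(2) GT])
        fix a b assume ab: "a \<in> {\<delta>..1 - \<delta>}" "b \<in> {\<delta>..1 - \<delta>}"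
        have "(J \<rho> (sc (c {})) ((a + b) / 2 + (a - b) / 2) + J \<rho> (sc (c {})) ((a + b) / 2 - (a - b) / 2)) / 2 \<le> J \<rho> (sc (c {})) ((a + b) / 2)"
        proof (rule J_concave)
          have "0 < a" "a < 1" "0 < b" "b < 1" using ab d by auto
          then show "0 < (a + b) / 2 - \<bar>(a - b) / 2\<bar>" "(a + b) / 2 + \<bar>(a - b) / 2\<bar> < 1"
            by (auto simp: abs_if field_simps)
          show "0 < sc (c {})" "sc (c {}) < 1" using sc_range[OF c01] d by auto
        qed (use r in auto)
        moreover have "(a + b) / 2 + (a - b) / 2 = a" "(a + b) / 2 - (a - b) / 2 = b" by (auto simp: field_simps)
        ultimately show "- J \<rho> (sc (c {})) ((a + b) / 2) \<le> (- J \<rho> (sc (c {})) a + - J \<rho> (sc (c {})) b) / 2" by simp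
      qed
      then show ?thesis
        using S(2) average_cmult[of S fair "-1" "\<lambda>y. J \<rho> (sc (c {})) (GT y)" "snd \<circ> z"] by simp
    qed
    also have "average fair S GT (snd \<circ> z) = sc (e {})"
    proof -
      have "average fair S GT = average fair N G"
        unfolding GT_def ST(1) using S T ST by (simp add: average_union)
      moreover have "average fair N G (snd \<circ> z) = sc (e {})"
        unfolding G_def sc_def k_def using N by (simp add: average_fair_affine average_walsh)
      ultimately show ?thesis by simp
    qed
    finally show ?thesis by this simp_all
  qed
  \<comment> \<open>The rescaling only shrinks half differences, so the influences of \<open>h\<close> and \<open>k\<close> decide.\<close>
  also have "M * err N (fst \<circ> z) (snd \<circ> z) \<le> M * (2 * (8 * 3 ^ m * sqrt \<tau> / (1 - s\<^sup>2) + 4 * s ^ m / (1 - s)))"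
  proof (rule mult_left_mono[OF _ M])
    have bound: "(\<Sum>i\<in>T. average fair N (\<lambda>x. \<bar>halfdiff i (\<lambda>x. sc (walsh N (\<lambda>A. s ^ card A * q A) x)) x\<bar> ^ 3) x) \<le>
        8 * 3 ^ m * sqrt \<tau> / (1 - s\<^sup>2) + 4 * s ^ m / (1 - s)"
      if q: "\<And>x. walsh N q x \<in> {0..1}" and infl: "\<And>i. i \<in> T \<Longrightarrow> walsh_infl N (\<lambda>A. s ^ card A * q A) i \<le> \<tau>" for q x
    proof -
      let ?g = "walsh N (\<lambda>A. s ^ card A * q A)"
      have g: "?g y \<in> {0..1}" for y using s q N by (intro noise_range) auto
      have "(\<Sum>i\<in>T. average fair N (\<lambda>x. \<bar>halfdiff i (\<lambda>x. sc (?g x)) x\<bar> ^ 3) x) \<le>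
          (\<Sum>i\<in>T. average fair N (\<lambda>x. \<bar>halfdiff i ?g x\<bar> ^ 3) x)"
      proof (intro sum_mono average_mono weights_fair N power_mono)
        fix i y
        have "halfdiff i (\<lambda>x. sc (?g x)) y = (1 - 2 * \<delta>) * halfdiff i ?g y"
          by (simp add: halfdiff_def sc_def field_simps)
        then show "\<bar>halfdiff i (\<lambda>x. sc (?g x)) y\<bar> \<le> \<bar>halfdiff i ?g y\<bar>"
          using d by (simp add: abs_mult mult_left_le_one_le)
      qed simp
      also have "\<dots> \<le> 8 * 3 ^ m * sqrt \<tau> / (1 - s\<^sup>2) + 4 * s ^ m / (1 - s)"
      proof (rule total_third_moment[OF N s _ _ T(1) infl \<tau>])
        show "(\<Sum>A\<in>Pow N. (q A)\<^sup>2) \<le> 1"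
          using walsh_sq_sum_le[OF N q] walsh_mean_range[OF N q] by auto
        fix y i
        show "\<bar>halfdiff i ?g y\<bar> \<le> 1"
          using g[of "y(i := True)"] g[of "y(i := False)"] by (auto simp: halfdiff_def abs_le_iff)
      qed
      finally show ?thesis .
    qed
    have "err N (fst \<circ> z) (snd \<circ> z) =
        (\<Sum>i\<in>T. average fair N (\<lambda>x. \<bar>halfdiff i F x\<bar> ^ 3) (fst \<circ> z)) +
        (\<Sum>i\<in>T. average fair N (\<lambda>x. \<bar>halfdiff i G x\<bar> ^ 3) (snd \<circ> z))"
      by (simp add: err_def sum.distrib)
    also have "\<dots> \<le> (8 * 3 ^ m * sqrt \<tau> / (1 - s\<^sup>2) + 4 * s ^ m / (1 - s)) + (8 * 3 ^ m * sqrt \<tau> / (1 - s\<^sup>2) + 4 * s ^ m / (1 - s))"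
      unfolding F_def G_def h_def k_def
      by (intro add_mono bound c e) (auto simp: T_def S_def)
    finally show "err N (fst \<circ> z) (snd \<circ> z) \<le> 2 * (8 * 3 ^ m * sqrt \<tau> / (1 - s\<^sup>2) + 4 * s ^ m / (1 - s))"
      by (simp only: mult_2)
  qed
  also have "M * (2 * (8 * 3 ^ m * sqrt \<tau> / (1 - s\<^sup>2) + 4 * s ^ m / (1 - s))) \<le>
      M * (16 * (3 ^ m * sqrt \<tau> / (1 - s\<^sup>2) + s ^ m / (1 - s)))"
  proof (rule mult_left_mono[OF _ M])
    have "0 \<le> s ^ m / (1 - s)" using s by simp
    then show "2 * (8 * 3 ^ m * sqrt \<tau> / (1 - s\<^sup>2) + 4 * s ^ m / (1 - s)) \<le> 16 * (3 ^ m * sqrt \<tau> / (1 - s\<^sup>2) + s ^ m / (1 - s))"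
      by (simp add: distrib_left)
  qed
  also have "M * (16 * (3 ^ m * sqrt \<tau> / (1 - s\<^sup>2) + s ^ m / (1 - s))) =
      1728 / (\<delta> ^ 3 * (1 - \<rho>)) * (3 ^ m * sqrt \<tau> / (1 - s\<^sup>2) + s ^ m / (1 - s))"
    by (simp add: M_def)
  finally have "average (corr \<rho>) N (\<lambda>z. h (fst \<circ> z) * k (snd \<circ> z)) z \<le>
      J \<rho> (sc (c {})) (sc (e {})) + \<alpha> +
      1728 / (\<delta> ^ 3 * (1 - \<rho>)) * (3 ^ m * sqrt \<tau> / (1 - s\<^sup>2) + s ^ m / (1 - s)) + 2 * \<delta>"
    by this simp_all
  then show ?thesis unfolding sc_def by (simp only: add_ac)
qed

lemma vertex_cong: "(\<And>i. i \<in> {..<n} \<Longrightarrow> x i = y i) \<Longrightarrow> vertex n x = vertex n y"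
  by (auto simp: vertex_def restrict_def fun_eq_iff)

lemma cube_walsh_expansion: "\<exists>c. (\<lambda>x. f (vertex n x)) = walsh {..<n} c"
  by (rule walsh_expansion) (auto intro!: arg_cong[where f = f] vertex_cong)

lemma noisy_inner_walsh:
  assumes "\<bar>\<rho>\<bar> \<le> 1" "(\<lambda>x. f (vertex n x)) = walsh {..<n} c" "(\<lambda>x. g (vertex n x)) = walsh {..<n} e"
  shows "noisy_inner n \<rho> f g = (\<Sum>A\<in>Pow {..<n}. \<rho> ^ card A * (c A * e A))"
proof -
  have "noisy_inner n \<rho> f g = average (corr \<rho>) {..<n} (\<lambda>z. walsh {..<n} c (fst \<circ> z) * walsh {..<n} e (snd \<circ> z)) undefined"
    unfolding noisy_inner_eq[OF assms(1), of n f g undefined] assms(2,3)[symmetric] ..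
  then show ?thesis by (simp only: correlated_parseval finite_lessThan)
qed

lemma cube_mean_walsh:
  assumes "(\<lambda>x. f (vertex n x)) = walsh {..<n} c"
  shows "cube_mean n f = c {}"
  unfolding cube_mean_eq[of n f undefined] assms by (simp add: average_walsh)

text \<open>Each nonempty set contributes at most \<open>\<rho>\<close> times the product of two coefficients, and the variance of a
  function with values in the unit interval is at most \<open>1 / 4\<close>. Combined with \<open>x y \<le> J \<rho> x y\<close> this settles
  small correlations.\<close>

lemma noisy_inner_le_product:
  assumes r: "0 \<le> \<rho>" "\<rho> < 1" and f: "\<forall>x\<in>cube {..<n}. f x \<in> {0..1}" and g: "\<forall>x\<in>cube {..<n}. g x \<in> {0..1}"
  shows "noisy_inner n \<rho> f g \<le> cube_mean n f * cube_mean n g + \<rho> / 4"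
proof -
  let ?N = "{..<n}"
  obtain c e where c: "(\<lambda>x. f (vertex n x)) = walsh ?N c" and e: "(\<lambda>x. g (vertex n x)) = walsh ?N e"
    using cube_walsh_expansion by metis
  have var: "(\<Sum>A\<in>Pow ?N - {{}}. (q A)\<^sup>2) \<le> 1 / 4" if q: "(\<lambda>x. p (vertex n x)) = walsh ?N q" and p: "\<forall>x\<in>cube {..<n}. p x \<in> {0..1}" for p q
  proof -
    have "walsh ?N q x \<in> {0..1}" for x unfolding q[symmetric] using p vertex_in_cube by blast
    from walsh_sq_sum_le[OF _ this] have "(\<Sum>A\<in>Pow ?N. (q A)\<^sup>2) \<le> q {}" by simp
    then have "(q {})\<^sup>2 + (\<Sum>A\<in>Pow ?N - {{}}. (q A)\<^sup>2) \<le> q {}"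
      by (subst (asm) sum.remove[of _ "{}"]) auto
    moreover have "q {} - (q {})\<^sup>2 \<le> 1 / 4"
      using zero_le_power2[of "q {} - 1 / 2"] by (simp add: power2_eq_square algebra_simps)
    ultimately show ?thesis by linarith
  qed
  have "noisy_inner n \<rho> f g = c {} * e {} + (\<Sum>A\<in>Pow ?N - {{}}. \<rho> ^ card A * (c A * e A))"
    using r by (subst noisy_inner_walsh[OF _ c e], simp) (subst sum.remove[of _ "{}"], auto)
  also have "(\<Sum>A\<in>Pow ?N - {{}}. \<rho> ^ card A * (c A * e A)) \<le> (\<Sum>A\<in>Pow ?N - {{}}. \<rho> * (((c A)\<^sup>2 + (e A)\<^sup>2) / 2))"
  proof (rule sum_mono)
    fix A assume "A \<in> Pow ?N - {{}}"
    then have "finite A" "A \<noteq> {}" using finite_subset by auto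
    then have "1 \<le> card A" by (simp add: Suc_le_eq card_gt_0_iff)
    then have p: "\<rho> ^ card A \<le> \<rho> ^ 1" using r by (intro power_decreasing) auto
    have "c A * e A \<le> ((c A)\<^sup>2 + (e A)\<^sup>2) / 2"
      using zero_le_power2[of "c A - e A"] by (simp add: power2_eq_square algebra_simps)
    then have "\<rho> ^ card A * (c A * e A) \<le> \<rho> ^ card A * (((c A)\<^sup>2 + (e A)\<^sup>2) / 2)"
      using r by (intro mult_left_mono) auto
    also have "\<dots> \<le> \<rho> * (((c A)\<^sup>2 + (e A)\<^sup>2) / 2)" using p by (intro mult_right_mono) auto
    finally show "\<rho> ^ card A * (c A * e A) \<le> \<rho> * (((c A)\<^sup>2 + (e A)\<^sup>2) / 2)" .
  qed
  also have "\<dots> = \<rho> * (((\<Sum>A\<in>Pow ?N - {{}}. (c A)\<^sup>2) + (\<Sum>A\<in>Pow ?N - {{}}. (e A)\<^sup>2)) / 2)"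
    by (simp add: sum_distrib_left[symmetric] sum_divide_distrib[symmetric] sum.distrib)
  also have "\<dots> \<le> \<rho> * ((1 / 4 + 1 / 4) / 2)"
    using var[OF c f] var[OF e g] r by (intro mult_left_mono divide_right_mono add_mono) auto
  finally show ?thesis by (simp add: cube_mean_walsh[OF c] cube_mean_walsh[OF e])
qed

text \<open>Writing \<open>\<rho> = \<rho>' s\<^sup>2\<close> moves a factor \<open>s\<close> of noise onto each function without changing the noisy inner product:
  correlation \<open>\<rho>\<close> for \<open>f\<close>, \<open>g\<close> is correlation \<open>\<rho>'\<close> for the smoothed functions. The price is that
  \<open>J\<close> is obtained at \<open>\<rho>'\<close> instead of \<open>\<rho>\<close>.\<close>

lemma noisy_inner_le_gauss:
  assumes r: "0 \<le> \<rho>" "\<rho> \<le> \<rho>'" "\<rho>' < 1" and s: "0 \<le> s" "s < 1" "\<rho> = \<rho>' * s\<^sup>2"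
    and d: "0 < \<delta>" "\<delta> < 1 / 2" and \<tau>: "0 < \<tau>"
    and res: "resilient n R \<alpha> f" and R: "2 / ((1 - s\<^sup>2) * \<tau>) \<le> R"
    and f: "\<forall>x\<in>cube {..<n}. f x \<in> {0..1}" and g: "\<forall>x\<in>cube {..<n}. g x \<in> {0..1}"
  shows "noisy_inner n \<rho> f g \<le> J \<rho> (cube_mean n f) (cube_mean n g) +
    (4 * \<delta> + \<alpha> + (\<rho>' - \<rho>) / (1 - \<rho>') +
     1728 / (\<delta> ^ 3 * (1 - \<rho>')) * (3 ^ m * sqrt \<tau> / (1 - s\<^sup>2) + s ^ m / (1 - s)))"
proof -
  let ?N = "{..<n}"
  obtain c e where c: "(\<lambda>x. f (vertex n x)) = walsh ?N c" and e: "(\<lambda>x. g (vertex n x)) = walsh ?N e"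
    using cube_walsh_expansion by metis
  have c01: "walsh ?N c x \<in> {0..1}" for x unfolding c[symmetric] using f vertex_in_cube by blast
  have e01: "walsh ?N e x \<in> {0..1}" for x unfolding e[symmetric] using g vertex_in_cube by blast
  have cm: "cube_mean n f = c {}" "cube_mean n g = e {}" by (rule cube_mean_walsh[OF c] cube_mean_walsh[OF e])+
  have m01: "c {} \<in> {0..1}" "e {} \<in> {0..1}"
    using walsh_mean_range[OF _ c01] walsh_mean_range[OF _ e01] by blast+
  define h k where "h = walsh ?N (\<lambda>A. s ^ card A * c A)" and "k = walsh ?N (\<lambda>A. s ^ card A * e A)"
  define S where "S = {i\<in>?N. \<tau> < walsh_infl ?N (\<lambda>A. s ^ card A * c A) i} \<union> {i\<in>?N. \<tau> < walsh_infl ?N (\<lambda>A. s ^ card A * e A) i}"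
  have cardS: "real (card S) \<le> R"
  proof -
    have c2: "(\<Sum>A\<in>Pow ?N. (c A)\<^sup>2) \<le> 1" "(\<Sum>A\<in>Pow ?N. (e A)\<^sup>2) \<le> 1"
      using walsh_sq_sum_le[OF _ c01] walsh_sq_sum_le[OF _ e01] m01 by auto
    have "real (card S) \<le> real (card {i\<in>?N. \<tau> < walsh_infl ?N (\<lambda>A. s ^ card A * c A) i}) +
        real (card {i\<in>?N. \<tau> < walsh_infl ?N (\<lambda>A. s ^ card A * e A) i})"
      unfolding S_def of_nat_add[symmetric] of_nat_le_iff by (rule card_Un_le)
    also have "\<dots> \<le> 1 / ((1 - s\<^sup>2) * \<tau>) + 1 / ((1 - s\<^sup>2) * \<tau>)"
      using c2 s \<tau> by (intro add_mono card_influential) auto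
    finally show ?thesis using R by (simp add: mult.commute)
  qed
  have Ssub: "S \<subseteq> ?N" by (auto simp: S_def)
  have "noisy_inner n \<rho> f g = (\<Sum>A\<in>Pow ?N. \<rho> ^ card A * (c A * e A))"
    using r by (intro noisy_inner_walsh c e) auto
  also have "\<dots> = (\<Sum>A\<in>Pow ?N. \<rho>' ^ card A * ((s ^ card A * c A) * (s ^ card A * e A)))"
    unfolding s(3) by (simp add: power_mult_distrib power2_eq_square mult_ac)
  also have "\<dots> = average (corr \<rho>') ?N (\<lambda>z. h (fst \<circ> z) * k (snd \<circ> z)) undefined"
    unfolding h_def k_def by (rule correlated_parseval[symmetric]) simp
  also have "\<dots> \<le> J \<rho>' (\<delta> + (1 - 2 * \<delta>) * c {}) (\<delta> + (1 - 2 * \<delta>) * e {}) + 2 * \<delta> + \<alpha> +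
    1728 / (\<delta> ^ 3 * (1 - \<rho>')) * (3 ^ m * sqrt \<tau> / (1 - s\<^sup>2) + s ^ m / (1 - s))"
    unfolding h_def k_def
  proof (rule smoothed_bound[OF _ _ r(3) s(1,2) d \<tau> c01 e01])
    fix x
    show "\<bar>average fair (?N - ({i\<in>?N. \<tau> < walsh_infl ?N (\<lambda>A. s ^ card A * c A) i} \<union> {i\<in>?N. \<tau> < walsh_infl ?N (\<lambda>A. s ^ card A * e A) i})) (walsh ?N c) x - c {}\<bar> \<le> \<alpha>"
      using resilient_restriction[OF res Ssub cardS, of x] by (simp add: c cm S_def)
  qed (use r in auto)
  also have "J \<rho>' (\<delta> + (1 - 2 * \<delta>) * c {}) (\<delta> + (1 - 2 * \<delta>) * e {}) \<le>
      J \<rho> (c {}) (e {}) + 2 * \<delta> + (\<rho>' - \<rho>) / (1 - \<rho>')"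
  proof -
    define a b where "a = \<delta> + (1 - 2 * \<delta>) * c {}" and "b = \<delta> + (1 - 2 * \<delta>) * e {}"
    have sc: "\<delta> \<le> \<delta> + (1 - 2 * \<delta>) * t" "\<delta> + (1 - 2 * \<delta>) * t \<le> 1 - \<delta>" "\<bar>\<delta> + (1 - 2 * \<delta>) * t - t\<bar> \<le> \<delta>" if "t \<in> {0..1}" for t
    proof -
      have "(1 - 2 * \<delta>) * t \<le> (1 - 2 * \<delta>) * 1" "0 \<le> (1 - 2 * \<delta>) * t"
        using that d by (auto intro!: mult_left_mono)
      then show "\<delta> \<le> \<delta> + (1 - 2 * \<delta>) * t" "\<delta> + (1 - 2 * \<delta>) * t \<le> 1 - \<delta>" by auto
      have "\<delta> + (1 - 2 * \<delta>) * t - t = \<delta> * (1 - 2 * t)" by (simp add: algebra_simps)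
      moreover have "\<bar>\<delta> * (1 - 2 * t)\<bar> \<le> \<delta> * 1" unfolding abs_mult using that d by (intro mult_mono) auto
      ultimately show "\<bar>\<delta> + (1 - 2 * \<delta>) * t - t\<bar> \<le> \<delta>" by simp
    qed
    have ab: "\<delta> \<le> a" "a \<le> 1 - \<delta>" "\<delta> \<le> b" "b \<le> 1 - \<delta>" "\<bar>a - c {}\<bar> \<le> \<delta>" "\<bar>b - e {}\<bar> \<le> \<delta>"
      unfolding a_def b_def using sc[OF m01(1)] sc[OF m01(2)] by auto
    have "J \<rho>' a b \<le> J \<rho> a b + (\<rho>' - \<rho>) / (1 - \<rho>')"
      using r ab d by (intro J_rho_le) auto
    moreover have "\<bar>J \<rho> a b - J \<rho> (c {}) b\<bar> \<le> \<bar>a - c {}\<bar>"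
      using ab d m01 by (intro J_lipschitz_left) auto
    moreover have "\<bar>J \<rho> (c {}) b - J \<rho> (c {}) (e {})\<bar> \<le> \<bar>b - e {}\<bar>"
      using ab d m01 r by (intro J_lipschitz_right) auto
    ultimately show ?thesis using ab unfolding a_def[symmetric] b_def[symmetric] by linarith
  qed
  finally show ?thesis unfolding cm by simp
qed

section \<open>Choice of the parameters\<close>

text \<open>The \<open>\<tau>\<close> of the theorem, used as the threshold above which a noisy influence counts as large. The constant
  is the one required by the comparison with \<open>W / \<kappa>\<close> in the lemma below.\<close>

definition influence_threshold :: "real \<Rightarrow> real \<Rightarrow> real" where
  "influence_threshold e r = e powr (5000 * (ln (1 / e) * ln (1 / (1 - r)) / ((1 - r) * e)))"

text \<open>The choice of parameters when \<open>4 \<epsilon> < \<rho>\<close>. Raising the correlation by \<open>\<epsilon> (1 - \<rho>) / 8\<close> costs at most \<open>\<epsilon> / 4\<close> in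
  \<open>J\<close> and leaves noise of rate \<open>\<kappa> = 1 - s\<^sup>2\<close> of order \<open>\<epsilon> (1 - \<rho>) / \<rho>\<close>. All polynomial factors in the error are
  collected in \<open>exp (- W)\<close>, with \<open>W\<close> of order \<open>ln (1 / \<epsilon>) + ln (1 / (1 - \<rho>))\<close>. The tail needs the truncation degree
  \<open>m\<close> to be of order \<open>W / \<kappa>\<close>, and \<open>3 ^ m sqrt \<tau> \<le> exp (- W)\<close> then needs \<open>ln (1 / \<tau>)\<close> of at least
  the same order, which the given \<open>\<tau>\<close> has because \<open>\<rho> \<le> ln (1 / (1 - \<rho>))\<close> and \<open>1 \<le> ln (1 / \<epsilon>)\<close>.\<close>

lemma parameters:
  fixes \<epsilon> \<rho> :: real
  assumes eps: "0 < \<epsilon>" and main: "4 * \<epsilon> < \<rho>" and rho: "\<rho> < 1"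
  defines "\<tau> \<equiv> influence_threshold \<epsilon> \<rho>" and "\<rho>' \<equiv> \<rho> + \<epsilon> * (1 - \<rho>) / 8"
  defines "s \<equiv> sqrt (\<rho> / \<rho>')"
  shows "0 < \<tau>" "\<rho> \<le> \<rho>'" "\<rho>' < 1" "0 \<le> s" "s < 1" "\<rho> = \<rho>' * s\<^sup>2"
    "2 / ((1 - s\<^sup>2) * \<tau>) \<le> 18 * (1 / (\<epsilon>\<^sup>2 * (1 - \<rho>) * \<tau>))"
    "(\<rho>' - \<rho>) / (1 - \<rho>') \<le> \<epsilon> / 4"
    "\<exists>m. 1728 / ((\<epsilon> / 16) ^ 3 * (1 - \<rho>')) * (3 ^ m * sqrt \<tau> / (1 - s\<^sup>2) + s ^ m / (1 - s)) \<le> \<epsilon> / 4"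
proof -
  have e4: "\<epsilon> < 1 / 4" and r0: "0 < \<rho>" "0 < 1 - \<rho>" using main rho eps by auto
  show \<tau>: "0 < \<tau>" using eps by (simp add: \<tau>_def influence_threshold_def)
  have gap: "0 < \<epsilon> * (1 - \<rho>)" using eps r0 by simp
  show rr: "\<rho> \<le> \<rho>'" using gap by (simp add: \<rho>'_def)
  have rp: "0 < \<rho>'" using rr r0 by simp
  have one: "1 - \<rho>' = (1 - \<rho>) * (1 - \<epsilon> / 8)" by (simp add: \<rho>'_def field_simps)
  have half: "(1 - \<rho>) / 2 \<le> 1 - \<rho>'"
    unfolding one using e4 r0 mult_left_mono[of "1 / 2" "1 - \<epsilon> / 8" "1 - \<rho>"] by simp
  then show r1: "\<rho>' < 1" using r0 by simp
  have s2: "s\<^sup>2 = \<rho> / \<rho>'" unfolding s_def using r0 rp by simp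
  show s0: "0 \<le> s" using r0 rp by (simp add: s_def)
  define \<kappa> where "\<kappa> = 1 - s\<^sup>2"
  have \<kappa>: "\<kappa> = \<epsilon> * (1 - \<rho>) / (8 * \<rho>')"
    unfolding \<kappa>_def s2 using rp by (simp add: \<rho>'_def field_simps)
  have \<kappa>0: "0 < \<kappa>" unfolding \<kappa> using gap rp by simp
  have \<kappa>1: "\<kappa> \<le> 1" by (simp add: \<kappa>_def)
  show s1: "s < 1" using \<kappa>0 s0 by (simp add: \<kappa>_def abs_square_less_1)
  show "\<rho> = \<rho>' * s\<^sup>2" using rp by (simp add: s2)
  have inv\<kappa>: "1 / \<kappa> \<le> 9 * \<rho> / (\<epsilon> * (1 - \<rho>))"
  proof -
    have "\<epsilon> * (1 - \<rho>) \<le> \<epsilon> * 1" using eps r0 by (intro mult_left_mono) auto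
    then have "8 * \<rho>' \<le> 9 * \<rho>" using main r0 by (simp add: \<rho>'_def)
    then have "8 * \<rho>' / (\<epsilon> * (1 - \<rho>)) \<le> 9 * \<rho> / (\<epsilon> * (1 - \<rho>))" using gap by (intro divide_right_mono) auto
    then show ?thesis by (simp add: \<kappa>)
  qed
  show "2 / ((1 - s\<^sup>2) * \<tau>) \<le> 18 * (1 / (\<epsilon>\<^sup>2 * (1 - \<rho>) * \<tau>))"
  proof -
    have "2 / ((1 - s\<^sup>2) * \<tau>) = 2 * (1 / \<kappa>) / \<tau>" by (simp add: \<kappa>_def)
    also have "\<dots> \<le> 2 * (9 * \<rho> / (\<epsilon> * (1 - \<rho>))) / \<tau>"
      using inv\<kappa> \<tau> by (intro divide_right_mono mult_left_mono) auto
    also have "\<dots> = 18 * (\<rho> * \<epsilon>) * (1 / (\<epsilon>\<^sup>2 * (1 - \<rho>) * \<tau>))"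
      using eps by (simp add: power2_eq_square)
    also have "\<dots> \<le> 18 * 1 * (1 / (\<epsilon>\<^sup>2 * (1 - \<rho>) * \<tau>))"
      using e4 r0 eps rho \<tau> by (intro mult_right_mono mult_left_mono mult_le_one) auto
    finally show ?thesis by simp
  qed
  show "(\<rho>' - \<rho>) / (1 - \<rho>') \<le> \<epsilon> / 4"
  proof -
    have "(\<rho>' - \<rho>) / (1 - \<rho>') \<le> (\<epsilon> * (1 - \<rho>) / 8) / ((1 - \<rho>) / 2)"
      using half r0 gap by (intro frac_le) (auto simp: \<rho>'_def)
    also have "\<dots> = \<epsilon> / 4" using r0 by (simp add: divide_simps)
    finally show ?thesis .
  qed
  define L1 L2 where "L1 = ln (1 / \<epsilon>)" and "L2 = ln (1 / (1 - \<rho>))"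
  have L1e: "\<epsilon> = exp (- L1)" and L2e: "1 - \<rho> = exp (- L2)" using eps r0 by (simp_all add: L1_def L2_def ln_div)
  have L1: "1 \<le> L1"
  proof -
    have "3 \<le> 1 / \<epsilon>" using e4 eps by (simp add: field_simps)
    then have "exp 1 \<le> 1 / \<epsilon>" using exp_le by linarith
    then show ?thesis unfolding L1_def using eps by (simp add: ln_ge_iff)
  qed
  have L2: "\<rho> \<le> L2"
    using ln_le_minus_one[of "1 - \<rho>"] r0 by (simp add: L2_def ln_div)
  \<comment> \<open>\<open>exp (- W)\<close> cancels the powers of \<open>\<epsilon>\<close> and \<open>1 - \<rho>\<close> in the error, and its factor \<open>2 ^ -31\<close> the constant, which is at most \<open>2 ^ 29\<close>.\<close>
  define W where "W = 5 * L1 + 2 * L2 + 31 * ln 2"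
  have ln2: "0 \<le> ln (2::real)" "ln 2 \<le> (1::real)" using ln_le_minus_one[of 2] by auto
  have W1: "5 \<le> W" using L1 L2 r0 ln2 unfolding W_def by linarith
  have \<omega>: "exp (- W) = \<epsilon> ^ 5 * (1 - \<rho>)\<^sup>2 / 2 ^ 31"
  proof -
    have "exp (31 * ln 2) = (2::real) ^ 31"
      using exp_of_nat_mult[of 31 "ln (2::real)"] by (simp del: power_numeral)
    moreover have "exp (- W) = exp (- L1) ^ 5 * exp (- L2) ^ 2 / exp (31 * ln 2)"
      by (simp add: W_def exp_of_nat_mult[symmetric] exp_add[symmetric] exp_diff[symmetric])
    ultimately show ?thesis by (simp add: L1e[symmetric] L2e[symmetric])
  qed
  define m where "m = nat \<lceil>2 * W / \<kappa>\<rceil>"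
  have Wk: "0 \<le> 2 * W / \<kappa>" using W1 \<kappa>0 by simp
  have m: "2 * W / \<kappa> \<le> real m" "real m \<le> 2 * W / \<kappa> + 1" unfolding m_def using Wk by linarith+
  have sm: "s ^ m \<le> exp (- W)"
  proof -
    have "\<kappa> = (1 - s) * (1 + s)" by (simp add: \<kappa>_def power2_eq_square algebra_simps)
    also have "\<dots> \<le> (1 - s) * 2" using s1 by (intro mult_left_mono) auto
    finally have "s \<le> 1 + - \<kappa> / 2" by simp
    also have "\<dots> \<le> exp (- \<kappa> / 2)" by (rule exp_ge_add_one_self)
    finally have "s ^ m \<le> exp (- \<kappa> / 2) ^ m" using s0 by (intro power_mono) auto
    also have "\<dots> = exp (- (real m * \<kappa> / 2))" by (simp add: exp_of_nat_mult[symmetric])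
    also have "\<dots> \<le> exp (- W)" using m(1) \<kappa>0 by (simp add: field_simps)
    finally show ?thesis .
  qed
  have tm: "3 ^ m * sqrt \<tau> \<le> exp (- W)"
  proof -
    define X where "X = 5000 * (L1 * L2 / ((1 - \<rho>) * \<epsilon>)) * L1"
    have "\<tau> = exp (5000 * (L1 * L2 / ((1 - \<rho>) * \<epsilon>)) * ln \<epsilon>)"
      using eps by (simp add: \<tau>_def influence_threshold_def powr_def L1_def L2_def)
    also have "ln \<epsilon> = - L1" using eps by (simp add: L1_def ln_div)
    finally have "\<tau> = exp (- X)" by (simp add: X_def)
    then have sq: "sqrt \<tau> = exp (- X / 2)"
      by (intro real_sqrt_unique) (simp_all add: power2_eq_square exp_add[symmetric])
    have "\<rho> * W \<le> 38 * (L1 * L1 * L2)"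
    proof -
      have "\<rho> * W \<le> \<rho> * (36 * L1 + 2 * L2)" using r0 L1 ln2 by (intro mult_left_mono) (auto simp: W_def)
      also have "\<dots> = 36 * (\<rho> * L1) + 2 * (\<rho> * L2)" by (simp add: algebra_simps)
      also have "\<dots> \<le> 36 * (L1 * L1 * L2) + 2 * (L1 * L1 * L2)"
      proof (intro add_mono mult_left_mono)
        have "\<rho> * L1 \<le> L2 * L1" using L1 L2 by (intro mult_right_mono) auto
        also have "\<dots> \<le> L2 * (L1 * L1)" using L1 L2 r0 by (intro mult_left_mono) (auto intro: mult_left_mono[of 1 L1 L1, simplified])
        finally show "\<rho> * L1 \<le> L1 * L1 * L2" by (simp add: mult.commute)
        have "\<rho> * L2 \<le> (1 * 1) * L2" using rho L2 r0 by (intro mult_right_mono) auto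
        also have "\<dots> \<le> (L1 * L1) * L2" using L1 L2 r0 by (intro mult_right_mono mult_mono) auto
        finally show "\<rho> * L2 \<le> L1 * L1 * L2" .
      qed auto
      finally show ?thesis by simp
    qed
    moreover have "0 \<le> L1 * L1 * L2" using L1 L2 r0 by simp
    ultimately have "126 * (\<rho> * W) \<le> 5000 * (L1 * L1 * L2)" by linarith
    then have "126 * (\<rho> * W) / (\<epsilon> * (1 - \<rho>)) \<le> 5000 * (L1 * L1 * L2) / (\<epsilon> * (1 - \<rho>))"
      using gap by (intro divide_right_mono) auto
    also have "\<dots> = X" by (simp add: X_def mult_ac)
    finally have X: "126 * (\<rho> * W) / (\<epsilon> * (1 - \<rho>)) \<le> X" .
    \<comment> \<open>By \<open>inv\<kappa>\<close> the required \<open>14 W / \<kappa>\<close> is at most the left-hand side of \<open>X\<close>, as \<open>14 * 9 = 126\<close>; and \<open>126 * 38 \<le> 5000\<close>.\<close>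
    have k1: "1 \<le> 1 / \<kappa>" using \<kappa>0 \<kappa>1 by simp
    have "W * 1 \<le> W * (1 / \<kappa>)" using k1 W1 by (intro mult_left_mono) auto
    then have "W + 2 * (2 * W / \<kappa> + 1) \<le> 7 * (W * (1 / \<kappa>))" using W1 by simp
    also have "\<dots> \<le> 7 * (W * (9 * \<rho> / (\<epsilon> * (1 - \<rho>))))"
      using inv\<kappa> W1 by (intro mult_left_mono) auto
    also have "\<dots> = (126 * (\<rho> * W) / (\<epsilon> * (1 - \<rho>))) / 2"
    proof -
      have "7 * (W * (9 * \<rho> / D)) = 126 * (\<rho> * W) / D / 2" for D by simp
      then show ?thesis .
    qed
    also have "\<dots> \<le> X / 2" using X by (rule divide_right_mono) simp
    finally have key: "W + 2 * (2 * W / \<kappa> + 1) \<le> X / 2" .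
    \<comment> \<open>The bound \<open>ln 3 \<le> 2\<close> in exponential form.\<close>
    have "(3::real) \<le> exp 2" using exp_ge_add_one_self[of 2] by simp
    then have "(3::real) ^ m \<le> exp 2 ^ m" by (intro power_mono) auto
    also have "\<dots> = exp (2 * real m)" by (simp add: exp_of_nat_mult[symmetric] mult.commute)
    finally have "3 ^ m * sqrt \<tau> \<le> exp (2 * real m) * exp (- X / 2)"
      unfolding sq by (intro mult_right_mono) auto
    also have "\<dots> = exp (2 * real m - X / 2)" by (simp add: exp_add[symmetric])
    also have "\<dots> \<le> exp (- W)" using key m(2) by simp
    finally show ?thesis .
  qed
  show "\<exists>m. 1728 / ((\<epsilon> / 16) ^ 3 * (1 - \<rho>')) * (3 ^ m * sqrt \<tau> / (1 - s\<^sup>2) + s ^ m / (1 - s)) \<le> \<epsilon> / 4"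
  proof (intro exI)
    have inv: "1 / (1 - s) \<le> 2 / \<kappa>"
    proof -
      have "\<kappa> = (1 - s) * (1 + s)" by (simp add: \<kappa>_def power2_eq_square algebra_simps)
      also have "\<dots> \<le> (1 - s) * 2" using s1 by (intro mult_left_mono) auto
      finally show ?thesis using s1 \<kappa>0 by (simp add: field_simps)
    qed
    have "3 ^ m * sqrt \<tau> / (1 - s\<^sup>2) + s ^ m / (1 - s) = 3 ^ m * sqrt \<tau> * (1 / \<kappa>) + s ^ m * (1 / (1 - s))"
      by (simp add: \<kappa>_def)
    also have "\<dots> \<le> exp (- W) * (2 / \<kappa>) + exp (- W) * (2 / \<kappa>)"
      using tm sm inv \<kappa>0 s0 s1 \<tau> by (intro add_mono mult_mono) (auto intro: divide_right_mono)
    also have "\<dots> = exp (- W) * 4 * (1 / \<kappa>)" by simp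
    also have "\<dots> \<le> exp (- W) * 4 * (9 * \<rho> / (\<epsilon> * (1 - \<rho>)))" using inv\<kappa> by (intro mult_left_mono) auto
    also have "\<dots> \<le> exp (- W) * 4 * (9 / (\<epsilon> * (1 - \<rho>)))"
      using rho gap by (intro mult_left_mono divide_right_mono) auto
    finally have a: "3 ^ m * sqrt \<tau> / (1 - s\<^sup>2) + s ^ m / (1 - s) \<le> exp (- W) * 4 * (9 / (\<epsilon> * (1 - \<rho>)))" .
    have b: "1728 / ((\<epsilon> / 16) ^ 3 * (1 - \<rho>')) \<le> 1728 / ((\<epsilon> / 16) ^ 3 * ((1 - \<rho>) / 2))"
      using half eps r0 by (intro divide_left_mono mult_left_mono) auto
    have "1728 / ((\<epsilon> / 16) ^ 3 * (1 - \<rho>')) * (3 ^ m * sqrt \<tau> / (1 - s\<^sup>2) + s ^ m / (1 - s)) \<le>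
        1728 / ((\<epsilon> / 16) ^ 3 * ((1 - \<rho>) / 2)) * (exp (- W) * 4 * (9 / (\<epsilon> * (1 - \<rho>))))"
      using eps r0 \<tau> \<kappa>0 s0 s1 by (intro mult_mono a b) (auto simp: \<kappa>_def)
    also have "\<dots> = (1728 * 4096 * 2 * 36 / 2 ^ 31) * \<epsilon>"
    proof -
      have "1728 / ((\<epsilon> / 16) ^ 3 * (t / 2)) * (\<epsilon> ^ 5 * t\<^sup>2 / 2 ^ 31 * 4 * (9 / (\<epsilon> * t))) =
          (1728 * 4096 * 2 * 36 / 2 ^ 31) * \<epsilon>" if "0 < t" for t
        using that eps by (simp add: field_simps power2_eq_square eval_nat_numeral)
      then show ?thesis unfolding \<omega> using r0(2) .
    qed
    also have "\<dots> \<le> (1 / 4) * \<epsilon>" using eps by (intro mult_right_mono) auto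
    finally show "1728 / ((\<epsilon> / 16) ^ 3 * (1 - \<rho>')) * (3 ^ m * sqrt \<tau> / (1 - s\<^sup>2) + s ^ m / (1 - s)) \<le> \<epsilon> / 4" by simp
  qed
qed

theorem theorem2p8:
  shows "\<exists>C > 0. \<exists>c > 0. \<exists>K > 0. \<forall>\<epsilon> > 0. \<forall>\<rho>. 0 \<le> \<rho> \<and> \<rho> < 1 \<longrightarrow>
    (\<exists>r > 0. \<exists>\<alpha> > 0. \<exists>\<tau> > 0.
       \<tau> = \<epsilon> powr (K * (ln (1 / \<epsilon>) * ln (1 / (1 - \<rho>)) / ((1 - \<rho>) * \<epsilon>))) \<and>
       r = C * (1 / (\<epsilon>\<^sup>2 * (1 - \<rho>) * \<tau>)) \<and>
       \<alpha> = c * (\<epsilon> * 2 powr (- r)) \<and>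
       (\<forall>n f g. resilient n r \<alpha> f \<and>
          (\<forall>x \<in> cube {..<n}. f x \<in> {0..1}) \<and> (\<forall>x \<in> cube {..<n}. g x \<in> {0..1}) \<longrightarrow>
          noisy_inner n \<rho> f g
            \<le> gauss_inner \<rho> (halfline_ind (cube_mean n f)) (halfline_ind (cube_mean n g)) + \<epsilon>))"
proof (rule exI[of _ 18], rule conjI, simp, rule exI[of _ "1 / 4"], rule conjI, simp,
    rule exI[of _ 5000], rule conjI, simp, intro allI impI)
  fix \<epsilon> \<rho> :: real
  assume eps: "0 < \<epsilon>" and "0 \<le> \<rho> \<and> \<rho> < 1"
  then have r: "0 \<le> \<rho>" "\<rho> < 1" by auto
  define \<tau> where "\<tau> = influence_threshold \<epsilon> \<rho>"
  define R where "R = 18 * (1 / (\<epsilon>\<^sup>2 * (1 - \<rho>) * \<tau>))"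
  define \<alpha> where "\<alpha> = 1 / 4 * (\<epsilon> * 2 powr (- R))"
  have \<tau>: "0 < \<tau>" using eps by (simp add: \<tau>_def influence_threshold_def)
  have R: "0 < R" using eps r \<tau> by (simp add: R_def)
  have \<alpha>: "0 < \<alpha>" using eps by (simp add: \<alpha>_def)
  have \<alpha>_le: "\<alpha> \<le> \<epsilon> / 4"
  proof -
    have "2 powr (- R) \<le> 2 powr 0" using R by (intro powr_mono) auto
    then show ?thesis using eps by (simp add: \<alpha>_def mult_left_le)
  qed
  have bound: "noisy_inner n \<rho> f g \<le> J \<rho> (cube_mean n f) (cube_mean n g) + \<epsilon>"
    if res: "resilient n R \<alpha> f" and f: "\<forall>x \<in> cube {..<n}. f x \<in> {0..1}" and g: "\<forall>x \<in> cube {..<n}. g x \<in> {0..1}"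
    for n f g
  proof (cases "\<rho> \<le> 4 * \<epsilon>")
    case True
    have mean01: "cube_mean n q \<in> {0..1}" if "\<forall>x \<in> cube {..<n}. q x \<in> {0..1}" for q
      unfolding cube_mean_eq[of n q undefined]
      by (rule average_range) (use that vertex_in_cube weights_fair in auto)
    have "noisy_inner n \<rho> f g \<le> cube_mean n f * cube_mean n g + \<rho> / 4"
      by (rule noisy_inner_le_product[OF r f g])
    also have "cube_mean n f * cube_mean n g \<le> J \<rho> (cube_mean n f) (cube_mean n g)"
      using mean01[OF f] mean01[OF g] r by (intro J_ge_prod) auto
    finally show ?thesis using True by simp
  next
    case False
    then have main: "4 * \<epsilon> < \<rho>" by simp
    note P = parameters[OF eps main r(2), folded \<tau>_def]
    define \<rho>' where "\<rho>' = \<rho> + \<epsilon> * (1 - \<rho>) / 8"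
    define s where "s = sqrt (\<rho> / \<rho>')"
    note P = P[folded \<rho>'_def, folded s_def, folded R_def]
    obtain m where m: "1728 / ((\<epsilon> / 16) ^ 3 * (1 - \<rho>')) * (3 ^ m * sqrt \<tau> / (1 - s\<^sup>2) + s ^ m / (1 - s)) \<le> \<epsilon> / 4"
      using P(9) by blast
    have d: "0 < \<epsilon> / 16" "\<epsilon> / 16 < 1 / 2" using eps main r by auto
    have "noisy_inner n \<rho> f g \<le> J \<rho> (cube_mean n f) (cube_mean n g) +
      (4 * (\<epsilon> / 16) + \<alpha> + (\<rho>' - \<rho>) / (1 - \<rho>') +
       1728 / ((\<epsilon> / 16) ^ 3 * (1 - \<rho>')) * (3 ^ m * sqrt \<tau> / (1 - s\<^sup>2) + s ^ m / (1 - s)))"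
      by (rule noisy_inner_le_gauss[OF r(1) P(2,3,4,5,6) d \<tau> res P(7) f g])
    then show ?thesis using m P(8) \<alpha>_le by linarith
  qed
  show "\<exists>r > 0. \<exists>\<alpha> > 0. \<exists>\<tau> > 0.
       \<tau> = \<epsilon> powr (5000 * (ln (1 / \<epsilon>) * ln (1 / (1 - \<rho>)) / ((1 - \<rho>) * \<epsilon>))) \<and>
       r = 18 * (1 / (\<epsilon>\<^sup>2 * (1 - \<rho>) * \<tau>)) \<and>
       \<alpha> = 1 / 4 * (\<epsilon> * 2 powr (- r)) \<and>
       (\<forall>n f g. resilient n r \<alpha> f \<and>
          (\<forall>x \<in> cube {..<n}. f x \<in> {0..1}) \<and> (\<forall>x \<in> cube {..<n}. g x \<in> {0..1}) \<longrightarrow>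
          noisy_inner n \<rho> f g
            \<le> gauss_inner \<rho> (halfline_ind (cube_mean n f)) (halfline_ind (cube_mean n g)) + \<epsilon>)"
    by (rule exI[of _ R], rule conjI[OF R], rule exI[of _ \<alpha>], rule conjI[OF \<alpha>], rule exI[of _ \<tau>], rule conjI[OF \<tau>],
        intro conjI R_def \<alpha>_def \<tau>_def[unfolded influence_threshold_def])
      (use bound in \<open>auto simp: J_def\<close>)
qed

end
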